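(* Consider the decision problem: given a connected graph $G=(V,E)$, a positive rational number $\delta$, and an integer $k$, decide whether $\mathrm{disp}_\delta(G)\ge k$. This problem lies in NP (with $\delta$ given as part of the input).
   Context: All graphs are finite, undirected and connected, and every edge is regarded as a rectifiable curve of length $1$. For a graph $G=(V,E)$, $P(G)$ denotes the set of all points on all edges (interior points) together with all vertices. For $p,q\in P(G)$, $d(p,q)$ is the length of a shortest path between $p$ and $q$ in this metric space. For a real $\delta>0$, a set $S\subset P(G)$ is $\delta$-dispersed if $d(p,q)\ge\delta$ for all distinct $p,q\in S$. The $\delta$-dispersion number $\mathrm{disp}_\delta(G)$ is the maximum cardinality of a $\delta$-dispersed subset of $P(G)$. *)

theory Defs
  imports Complex_Main "HOL-Computational_Algebra.Polynomial"
begin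

section \<open>Metric graphs and dispersion numbers\<close>

definition connected_graph :: "'a set \<Rightarrow> 'a set set \<Rightarrow> bool" where
  "connected_graph V E \<longleftrightarrow>
     finite V \<and> V \<noteq> {} \<and> E \<subseteq> {e. e \<subseteq> V \<and> card e = 2} \<and>
     (\<forall>u\<in>V. \<forall>v\<in>V. (u, v) \<in> {(x, y). {x, y} \<in> E}\<^sup>*)"

text \<open>
  Points are given by their barycentric coordinates, that is, as elements of the usual geometric
  realisation of the graph.  This makes the representation of a point unique:
  \<open>edge_point u v t\<close>, the point at distance \<open>t\<close> from \<open>u\<close> on the edge \<open>{u, v}\<close>, is the same
  function as \<open>edge_point v u (1 - t)\<close>, and the end point of an edge is the same
  function for all edges that share it.
\<close>

type_synonym 'a point = "'a \<Rightarrow> real"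

definition vertex_point :: "'a \<Rightarrow> 'a point" where
  "vertex_point v = (\<lambda>w. if w = v then 1 else 0)"

definition edge_point :: "'a \<Rightarrow> 'a \<Rightarrow> real \<Rightarrow> 'a point" where
  "edge_point u v t = (\<lambda>w. if w = u then 1 - t else if w = v then t else 0)"

lemma edge_point_swap: "u \<noteq> v \<Longrightarrow> edge_point u v t = edge_point v u (1 - t)"
  by (auto simp: edge_point_def)

lemma edge_point_0: "u \<noteq> v \<Longrightarrow> edge_point u v 0 = vertex_point u"
  by (auto simp: edge_point_def vertex_point_def)

definition points :: "'a set \<Rightarrow> 'a set set \<Rightarrow> 'a point set" where
  "points V E = vertex_point ` V \<union> {edge_point u v t | u v t. {u, v} \<in> E \<and> 0 \<le> t \<and> t \<le> 1}"

text \<open>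
  \<open>route E p q l\<close>: there is a path from \<open>p\<close> to \<open>q\<close> of length \<open>l\<close>, composed of finitely many
  segments, each of which runs inside a single edge.
\<close>

inductive route :: "'a set set \<Rightarrow> 'a point \<Rightarrow> 'a point \<Rightarrow> real \<Rightarrow> bool" for E :: "'a set set" where
  route_refl: "route E p p 0"
| route_step: "route E p (edge_point u v s) l \<Longrightarrow> {u, v} \<in> E \<Longrightarrow> 0 \<le> s \<Longrightarrow> s \<le> 1 \<Longrightarrow> 0 \<le> t \<Longrightarrow> t \<le> 1
    \<Longrightarrow> route E p (edge_point u v t) (l + \<bar>s - t\<bar>)"

definition point_dist :: "'a set set \<Rightarrow> 'a point \<Rightarrow> 'a point \<Rightarrow> real" where
  "point_dist E p q = Inf {l. route E p q l}"

definition dispersed :: "'a set \<Rightarrow> 'a set set \<Rightarrow> real \<Rightarrow> 'a point set \<Rightarrow> bool" where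
  "dispersed V E \<delta> S \<longleftrightarrow>
     S \<subseteq> points V E \<and> (\<forall>p\<in>S. \<forall>q\<in>S. p \<noteq> q \<longrightarrow> \<delta> \<le> point_dist E p q)"

text \<open>
  The maximum exists, and no dispersed set is infinite (which \<open>card\<close> would count as \<open>0\<close>);
  see \<open>finite_dispersed\<close> and \<open>disp_props\<close> below.
\<close>

definition disp :: "'a set \<Rightarrow> 'a set set \<Rightarrow> real \<Rightarrow> nat" where
  "disp V E \<delta> = Max (card ` {S. dispersed V E \<delta> S})"

lemma route_nonneg: "route E p q l \<Longrightarrow> 0 \<le> l"
  by (induction rule: route.induct) auto

lemma point_dist_le: "route E p q l \<Longrightarrow> point_dist E p q \<le> l"
  unfolding point_dist_def
  by (rule cInf_lower) (auto intro!: bdd_belowI[of _ 0] dest: route_nonneg)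

lemma point_dist_edge_le:
  assumes "{u, v} \<in> E" "0 \<le> s" "s \<le> 1" "0 \<le> t" "t \<le> 1"
  shows "point_dist E (edge_point u v s) (edge_point u v t) \<le> \<bar>s - t\<bar>"
  using point_dist_le[OF route_step[OF route_refl assms]] by simp

lemma dispersed_bounded:
  assumes G: "connected_graph V E" and "\<delta> > 0"
  shows "\<exists>N. \<forall>S. dispersed V E \<delta> S \<longrightarrow> finite S \<and> card S \<le> N"
proof -
  define I where "I = (\<lambda>v. Inl v :: 'a + 'a \<times> 'a \<times> int) ` V \<union>
     (\<lambda>x. Inr x) ` (V \<times> V \<times> {0..\<lfloor>2 / \<delta>\<rfloor>})"
  have finI: "finite I" using G by (auto simp: I_def connected_graph_def)
  define R :: "'a point \<Rightarrow> 'a + 'a \<times> 'a \<times> int \<Rightarrow> bool" where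
    "R = (\<lambda>p i. case i of Inl v \<Rightarrow> p = vertex_point v
       | Inr (u, v, j) \<Rightarrow> {u, v} \<in> E \<and>
           (\<exists>t. 0 \<le> t \<and> t \<le> 1 \<and> j = \<lfloor>2 * t / \<delta>\<rfloor> \<and> p = edge_point u v t))"
  have ex: "\<exists>i\<in>I. R p i" if "p \<in> points V E" for p
    using that unfolding points_def
  proof
    assume "p \<in> vertex_point ` V"
    then obtain v where v: "v \<in> V" "p = vertex_point v" by blast
    then have "Inl v \<in> I" "R p (Inl v)" by (auto simp: I_def R_def)
    then show ?thesis by blast
  next
    assume "p \<in> {edge_point u v t | u v t. {u, v} \<in> E \<and> 0 \<le> t \<and> t \<le> 1}"
    then obtain u v t where *: "{u, v} \<in> E" "0 \<le> t" "t \<le> 1" "p = edge_point u v t" by blast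
    have "u \<in> V" "v \<in> V" using * G by (auto simp: connected_graph_def)
    moreover have "2 * t / \<delta> \<le> 2 / \<delta>" "0 \<le> 2 * t / \<delta>"
      using * \<open>\<delta> > 0\<close> by (auto simp: divide_right_mono)
    ultimately have "Inr (u, v, \<lfloor>2 * t / \<delta>\<rfloor>) \<in> I"
      by (auto simp: I_def floor_mono)
    moreover have "R p (Inr (u, v, \<lfloor>2 * t / \<delta>\<rfloor>))" using * by (auto simp: R_def)
    ultimately show ?thesis by blast
  qed
  define f where "f p = (SOME i. i \<in> I \<and> R p i)" for p
  have f: "f p \<in> I \<and> R p (f p)" if "p \<in> points V E" for p
    using someI_ex[of "\<lambda>i. i \<in> I \<and> R p i"] ex[OF that] unfolding f_def by blast
  have "finite S \<and> card S \<le> card I" if S: "dispersed V E \<delta> S" for S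
  proof -
    have "inj_on f S"
    proof (rule inj_onI, rule ccontr)
      fix p q assume pq: "p \<in> S" "q \<in> S" "f p = f q" "p \<noteq> q"
      have R: "R p (f p)" "R q (f p)" using f[of p] f[of q] pq S unfolding dispersed_def by auto
      have d: "\<delta> \<le> point_dist E p q" using S pq by (auto simp: dispersed_def)
      show False
      proof (cases "f p")
        case (Inl v) then show False using R pq by (auto simp: R_def)
      next
        case (Inr x)
        obtain u v j where x: "x = (u, v, j)" by (cases x) auto
        obtain s t where st: "{u, v} \<in> E" "0 \<le> s" "s \<le> 1" "0 \<le> t" "t \<le> 1"
          "j = \<lfloor>2 * s / \<delta>\<rfloor>" "j = \<lfloor>2 * t / \<delta>\<rfloor>" "p = edge_point u v s" "q = edge_point u v t"
          using R by (auto simp: R_def Inr x)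
        have "\<bar>2 * s / \<delta> - 2 * t / \<delta>\<bar> < 1" using st(6,7) by linarith
        then have "\<bar>2 * (s - t) / \<delta>\<bar> < 1" by (simp add: diff_divide_distrib right_diff_distrib)
        then have "\<bar>2 * (s - t)\<bar> < \<delta>" using \<open>\<delta> > 0\<close> by simp
        then have "2 * \<bar>s - t\<bar> < \<delta>" by linarith
        moreover have "\<delta> \<le> \<bar>s - t\<bar>"
          using d point_dist_edge_le[OF st(1-5)] st(8,9) by simp
        moreover have False if "2 * r < \<delta>" "\<delta> \<le> r" for r
          using that \<open>\<delta> > 0\<close> by linarith
        ultimately show False by blast
      qed
    qed
    moreover have "f ` S \<subseteq> I" using f S by (auto simp: dispersed_def)
    ultimately show ?thesis using finI by (meson card_inj_on_le inj_on_finite)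
  qed
  then show ?thesis by blast
qed

lemma finite_dispersed:
  "connected_graph V E \<Longrightarrow> \<delta> > 0 \<Longrightarrow> dispersed V E \<delta> S \<Longrightarrow> finite S"
  using dispersed_bounded by blast

lemma disp_props:
  assumes "connected_graph V E" "\<delta> > 0"
  shows "\<exists>S. dispersed V E \<delta> S \<and> card S = disp V E \<delta>"
    and "\<And>S. dispersed V E \<delta> S \<Longrightarrow> card S \<le> disp V E \<delta>"
proof -
  obtain N where N: "\<And>S. dispersed V E \<delta> S \<Longrightarrow> card S \<le> N"
    using dispersed_bounded[OF assms] by blast
  have fin: "finite (card ` {S. dispersed V E \<delta> S})"
    by (rule finite_subset[of _ "{..N}"]) (auto dest: N)
  have ne: "dispersed V E \<delta> {}" by (simp add: dispersed_def)
  show "\<exists>S. dispersed V E \<delta> S \<and> card S = disp V E \<delta>"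
    using Max_in[OF fin] ne unfolding disp_def by fastforce
  show "card S \<le> disp V E \<delta>" if "dispersed V E \<delta> S" for S
    unfolding disp_def by (rule Max_ge[OF fin]) (use that in blast)
qed


section \<open>Turing machines and the class NP\<close>

text \<open>
  Deterministic multi-tape Turing machines with two-way infinite tapes.  States are
  \<open>0, \<dots>, num_states - 1\<close>: the machine starts in state \<open>0\<close>, accepts in state \<open>1\<close> and rejects in
  state \<open>2\<close>.  Tape symbols are \<open>0, \<dots>, num_symbols - 1\<close>: the blank is \<open>0\<close>, and \<open>1\<close> and \<open>2\<close> stand
  for the bits \<open>False\<close> and \<open>True\<close>.  The transition function receives the state and the list of the
  scanned symbols; it yields the new state and, for each tape, the symbol to be written and the
  head movement.
\<close>

datatype head_move = Go_Left | Stay | Go_Right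

record turing_machine =
  num_tapes :: nat
  num_states :: nat
  num_symbols :: nat
  transition :: "nat \<Rightarrow> nat list \<Rightarrow> nat \<times> (nat \<times> head_move) list"

definition wf_tm :: "turing_machine \<Rightarrow> bool" where
  "wf_tm M \<longleftrightarrow> num_tapes M \<ge> 2 \<and> num_states M \<ge> 3 \<and> num_symbols M \<ge> 3 \<and>
     (\<forall>q < num_states M. \<forall>rs. length rs = num_tapes M \<and> set rs \<subseteq> {..<num_symbols M} \<longrightarrow>
        (case transition M q rs of (q', as) \<Rightarrow>
           q' < num_states M \<and> length as = num_tapes M \<and> fst ` set as \<subseteq> {..<num_symbols M}))"

type_synonym tape = "(int \<Rightarrow> nat) \<times> int"   \<comment> \<open>contents and head position\<close>
type_synonym config = "nat \<times> tape list"

definition scan :: "tape \<Rightarrow> nat" where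
  "scan = (\<lambda>(c, h). c h)"

fun head_shift :: "head_move \<Rightarrow> int" where
  "head_shift Go_Left = -1"
| "head_shift Stay = 0"
| "head_shift Go_Right = 1"

definition act :: "nat \<times> head_move \<Rightarrow> tape \<Rightarrow> tape" where
  "act = (\<lambda>(s, m) (c, h). (c(h := s), h + head_shift m))"

definition tm_step :: "turing_machine \<Rightarrow> config \<Rightarrow> config" where
  "tm_step M = (\<lambda>(q, ts).
     if q \<in> {1, 2} then (q, ts)
     else let (q', as) = transition M q (map scan ts) in (q', map2 act as ts))"

definition word_tape :: "bool list \<Rightarrow> tape" where
  "word_tape w =
     ((\<lambda>i. if 0 \<le> i \<and> i < int (length w) then (if w ! nat i then 2 else 1) else 0), 0)"

text \<open>The input is given on tape \<open>0\<close>, the certificate on tape \<open>1\<close>; the other tapes are blank.\<close>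

definition start_config :: "turing_machine \<Rightarrow> bool list \<Rightarrow> bool list \<Rightarrow> config" where
  "start_config M x u =
     (0, word_tape x # word_tape u # replicate (num_tapes M - 2) (word_tape []))"

definition state_after :: "turing_machine \<Rightarrow> bool list \<Rightarrow> bool list \<Rightarrow> nat \<Rightarrow> nat" where
  "state_after M x u t = fst ((tm_step M ^^ t) (start_config M x u))"

definition accepts :: "turing_machine \<Rightarrow> bool list \<Rightarrow> bool list \<Rightarrow> bool" where
  "accepts M x u \<longleftrightarrow> (\<exists>t. state_after M x u t = 1)"

definition polytime_tm :: "turing_machine \<Rightarrow> bool" where
  "polytime_tm M \<longleftrightarrow> wf_tm M \<and>
     (\<exists>p :: nat poly. \<forall>x u. state_after M x u (poly p (length x + length u)) \<in> {1, 2})"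

definition NP :: "bool list set set" where
  "NP = {L. \<exists>M. polytime_tm M \<and>
     (\<exists>p :: nat poly. \<forall>x. x \<in> L \<longleftrightarrow> (\<exists>u. length u \<le> poly p (length x) \<and> accepts M x u))}"


section \<open>The decision problem\<close>

text \<open>
  Instances are encoded by a prefix-free binary code.  Numbers are written in binary, least
  significant bit first and without leading zeros.  A list is written by putting \<open>True\<close> before each
  of its elements and \<open>False\<close> at the end.
\<close>

fun bits :: "nat \<Rightarrow> bool list" where
  "bits n = (if n = 0 then [] else odd n # bits (n div 2))"

declare bits.simps [simp del]

definition enc_list :: "('b \<Rightarrow> bool list) \<Rightarrow> 'b list \<Rightarrow> bool list" where
  "enc_list f xs = concat (map (\<lambda>x. True # f x) xs) @ [False]"

definition enc_nat :: "nat \<Rightarrow> bool list" where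
  "enc_nat n = enc_list (\<lambda>b. [b]) (bits n)"

definition enc_int :: "int \<Rightarrow> bool list" where
  "enc_int k = (k < 0) # enc_nat (nat \<bar>k\<bar>)"

definition enc_edge :: "nat \<times> nat \<Rightarrow> bool list" where
  "enc_edge e = enc_nat (fst e) @ enc_nat (snd e)"

definition enc_instance :: "nat \<Rightarrow> (nat \<times> nat) list \<Rightarrow> nat \<Rightarrow> nat \<Rightarrow> int \<Rightarrow> bool list" where
  "enc_instance n es a b k =
     enc_nat n @ enc_list enc_edge es @ enc_nat a @ enc_nat b @ enc_int k"

definition edge_set :: "(nat \<times> nat) list \<Rightarrow> nat set set" where
  "edge_set es = {{u, v} | u v. (u, v) \<in> set es}"

text \<open>
  An instance consists of a connected graph with vertices \<open>0, \<dots>, n - 1\<close>, given by a list of its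
  edges, of a positive rational \<open>\<delta> = a / b\<close> and of an integer \<open>k\<close>.
\<close>

definition DISPERSION :: "bool list set" where
  "DISPERSION = {enc_instance n es a b k | n es a b k.
     connected_graph {..<n} (edge_set es) \<and> a > 0 \<and> b > 0 \<and>
     int (disp {..<n} (edge_set es) (real a / real b)) \<ge> k}"

lemma bits_0: "bits 0 = []"
  by (subst bits.simps) simp

lemma bits_pos: "n > 0 \<Longrightarrow> bits n = odd n # bits (n div 2)"
  by (subst bits.simps) simp

lemma bits_inj: "bits m = bits n \<Longrightarrow> m = n"
proof (induction m arbitrary: n rule: less_induct)
  case (less m)
  show ?case
  proof (cases "m = 0 \<or> n = 0")
    case True
    then show ?thesis using less.prems bits_pos[of m] bits_pos[of n] bits_0
      by (metis gr0I list.distinct(1))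
  next
    case False
    then have "odd m = odd n" "bits (m div 2) = bits (n div 2)"
      using less.prems bits_pos[of m] bits_pos[of n] by auto
    moreover from this(2) have "m div 2 = n div 2" using less.IH[of "m div 2"] False by simp
    ultimately show ?thesis by presburger
  qed
qed

lemma enc_list_append_eq:
  assumes "\<And>x y r s. f x @ r = f y @ s \<Longrightarrow> x = y \<and> r = s"
  shows "enc_list f xs @ r = enc_list f ys @ s \<Longrightarrow> xs = ys \<and> r = s"
proof (induction xs arbitrary: ys)
  case Nil then show ?case by (cases ys) (auto simp: enc_list_def)
next
  case (Cons x xs)
  then obtain y ys' where ys: "ys = y # ys'" by (cases ys) (auto simp: enc_list_def)
  have "f x @ (enc_list f xs @ r) = f y @ (enc_list f ys' @ s)"
    using Cons.prems ys by (simp add: enc_list_def)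
  from assms[OF this] Cons.IH ys show ?case by blast
qed

lemma enc_nat_append_eq: "enc_nat m @ r = enc_nat n @ s \<Longrightarrow> m = n \<and> r = s"
  unfolding enc_nat_def by (drule enc_list_append_eq[rotated]) (auto dest: bits_inj)

lemma enc_edge_append_eq: "enc_edge e @ r = enc_edge e' @ s \<Longrightarrow> e = e' \<and> r = s"
  unfolding enc_edge_def by (metis append.assoc enc_nat_append_eq prod.expand)

lemma enc_int_inj: "enc_int k = enc_int k' \<Longrightarrow> k = k'"
  unfolding enc_int_def using enc_nat_append_eq[of "nat \<bar>k\<bar>" "[]" "nat \<bar>k'\<bar>" "[]"] by auto

lemma enc_instance_inj:
  assumes "enc_instance n es a b k = enc_instance n' es' a' b' k'"
  shows "n = n' \<and> es = es' \<and> a = a' \<and> b = b' \<and> k = k'"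
proof -
  note * = assms[unfolded enc_instance_def]
  note 1 = enc_nat_append_eq[OF *]
  note 2 = enc_list_append_eq[OF enc_edge_append_eq 1[THEN conjunct2]]
  note 3 = enc_nat_append_eq[OF 2[THEN conjunct2]]
  note 4 = enc_nat_append_eq[OF 3[THEN conjunct2]]
  note 5 = enc_int_inj[OF 4[THEN conjunct2]]
  show ?thesis using 1 2 3 4 5 by simp
qed

end

theory Submission
  imports Defs
begin

text \<open>
  The certificate lists, for every edge, only the number of points on it and the positions of the
  outermost two, because the points in between may be assumed equidistant and there can be
  exponentially many of them.  All conditions on these positions have the form
  \<open>\<plusminus>s \<plusminus> t \<le> c\<close> with \<open>c\<close> a multiple of \<open>1/b\<close>, where \<open>\<delta> = a/b\<close>; replacing every position \<open>s\<close> by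
  \<open>(\<lfloor>b s\<rfloor> + \<lceil>b s\<rceil>) / (2 b)\<close> preserves them, so positions of polynomial bit length suffice.  Distances
  between points on different edges are bounded from below by vertex potentials that are part of the
  certificate and need only be checked along edges.  Two points on the same edge are at distance
  \<open>\<bar>s - t\<bar>\<close> because a detour has length at least \<open>2\<close>.

  The verifier is written as a function of small numbers in unary that is built by
  polynomially bounded primitive recursion; such functions are computed in polynomial time by
  counter programs, in which the position of the head on an otherwise unused tape is a counter.
  The exponentially large numbers appear only in linear inequalities, which are checked by propagating a
  bounded carry.\<close>

section \<open>Structured programs as Turing machines\<close>

text \<open>The same position occurs with both signs: the room on an edge bounds
  \<open>X + Y\<close> from above, the separation of two edges bounds such sums from below. Rounding
  in one direction would violate one kind. The mean of floor and ceiling commutes with negation,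
  which is why conditions with two unknowns survive it and why the unit is \<open>1/(2*b)\<close>.
  Products do not fit into a comparison of sums, so \<open>2 * a * h\<close> is certified by a chain
  of halvings of \<open>h\<close>, one binary digit per link. Tables are compared by
  \<open><=\<close> only: a table that passes need not be the intended one, but the bound follows
  from the inequalities alone. The language contains connected graphs only, and a rank that falls
  towards vertex 0 proves connectivity without a search. Loops in unary run over vertices, edges and
  digits; they are short because a connected graph with \<open>m\<close> edges has at most
  \<open>max 1 (2 * m)\<close> vertices.\<close>

datatype cmd = Move nat head_move | Mark nat | Seq cmd cmd | Cond nat nat cmd cmd
  | Loop nat nat cmd | Halt bool

type_synonym tapes = "nat \<Rightarrow> tape"

fun control :: "cmd list \<Rightarrow> (nat \<Rightarrow> nat) \<Rightarrow> cmd list" where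
  "control [] s = []"
| "control (Move i d # K) s = K"
| "control (Mark i # K) s = K"
| "control (Seq c d # K) s = c # d # K"
| "control (Cond i a c d # K) s = (if s i = a then c else d) # K"
| "control (Loop i a c # K) s = (if s i = a then K else c # Loop i a c # K)"
| "control (Halt b # K) s = Halt b # K"

fun action :: "cmd list \<Rightarrow> (nat \<Rightarrow> nat) \<Rightarrow> nat \<Rightarrow> nat \<times> head_move" where
  "action [] s j = (s j, Stay)"
| "action (Move i d # K) s j = (s j, if j = i then d else Stay)"
| "action (Mark i # K) s j = (if j = i then 1 else s j, Stay)"
| "action (Seq c d # K) s j = (s j, Stay)"
| "action (Cond i a c d # K) s j = (s j, Stay)"
| "action (Loop i a c # K) s j = (s j, Stay)"
| "action (Halt b # K) s j = (s j, Stay)"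

text \<open>A state of the machine is the list of the commands that remain to be executed.\<close>

definition run_step :: "cmd list \<times> tapes \<Rightarrow> cmd list \<times> tapes" where
  "run_step = (\<lambda>(K, T). (control K (\<lambda>i. scan (T i)), \<lambda>i. act (action K (\<lambda>i. scan (T i)) i) (T i)))"

lemma act_scan [simp]: "act (scan t, Stay) t = t"
  by (cases t) (simp add: act_def scan_def)

text \<open>The stacks met from the moment \<open>c\<close> lies on top of \<open>K\<close> until
  \<open>K\<close> itself is exposed. They are finitely many because a \<open>Loop\<close> returns
  to the very stack it started from; this makes stacks usable as machine states.\<close>

fun conts :: "cmd \<Rightarrow> cmd list \<Rightarrow> cmd list set" where
  "conts (Seq c d) K = insert (Seq c d # K) (conts c (d # K) \<union> conts d K)"
| "conts (Cond i a c d) K = insert (Cond i a c d # K) (conts c K \<union> conts d K)"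
| "conts (Loop i a c) K = insert (Loop i a c # K) (conts c (Loop i a c # K))"
| "conts c K = {c # K}"

lemma finite_conts: "finite (conts c K)"
  by (induction c K rule: conts.induct) auto

lemma conts_self: "c # K \<in> conts c K"
  by (cases c) auto

text \<open>What a subcommand leaves when it is done is the rest it was started on, and that rest is
  a stack of the enclosing command by \<open>conts_self\<close>. Hence only \<open>[]\<close> can be
  reached from \<open>conts c []\<close> outside of it.\<close>

lemma control_conts: "K' \<in> conts c K \<Longrightarrow> control K' s \<in> insert K (conts c K)"
proof (induction c arbitrary: K K')
  case (Seq c d)
  then show ?case using conts_self[of d K] conts_self[of c "d # K"] by fastforce
next
  case (Cond i a c d)
  from Cond.prems consider "K' = Cond i a c d # K" | "K' \<in> conts c K" | "K' \<in> conts d K" by auto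
  then show ?case using Cond.IH(1)[of K' K] Cond.IH(2)[of K' K] conts_self[of d K] conts_self[of c K]
    by cases auto
next
  case (Loop i a c)
  from Loop.prems consider "K' = Loop i a c # K" | "K' \<in> conts c (Loop i a c # K)" by auto
  then show ?case using Loop.IH[of K' "Loop i a c # K"] conts_self[of c "Loop i a c # K"]
    by cases auto
qed auto

fun width :: "cmd \<Rightarrow> nat" where
  "width (Move i d) = Suc i"
| "width (Mark i) = Suc i"
| "width (Seq c d) = max (width c) (width d)"
| "width (Cond i a c d) = max (Suc i) (max (width c) (width d))"
| "width (Loop i a c) = max (Suc i) (width c)"
| "width (Halt b) = 0"

definition fits :: "nat \<Rightarrow> cmd list \<Rightarrow> bool" where
  "fits k K \<longleftrightarrow> (\<forall>c\<in>set K. width c \<le> k)"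

lemma fits_control: "fits k K \<Longrightarrow> fits k (control K s)"
  by (cases "(K, s)" rule: control.cases) (auto simp: fits_def)

lemma control_cong: "fits k K \<Longrightarrow> (\<And>i. i < k \<Longrightarrow> s i = s' i) \<Longrightarrow> control K s = control K s'"
  by (cases "(K, s)" rule: control.cases) (auto simp: fits_def)

lemma action_cong: "s i = s' i \<Longrightarrow> action K s i = action K s' i"
  by (cases "(K, s, i)" rule: action.cases) auto

lemma fst_action: "s i < 3 \<Longrightarrow> fst (action K s i) < 3"
  by (cases "(K, s, i)" rule: action.cases) auto

text \<open>Tapes from \<open>k\<close> on do not exist in the machine. They get their mark in
  advance, because the initial program marks finitely many tapes while the register view
  \<open>tapes_of\<close> speaks about all.\<close>

definition start_tapes :: "nat \<Rightarrow> bool list \<Rightarrow> bool list \<Rightarrow> tapes" where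
  "start_tapes k x u = (\<lambda>i. if i = 0 then word_tape x else if i = 1 then word_tape u
     else if i < k then word_tape [] else ((\<lambda>p. if p = 0 then 1 else 0), 0))"

lemma run_step_Halt: "(run_step ^^ t) (Halt b # K, T) = (Halt b # K, T)"
  by (induction t) (simp_all add: run_step_def)

text \<open>Stacks, numbered by their place in a list, become the states. As \<open>c\<close> is a
  \<open>Seq\<close>, the stack \<open>[c]\<close> differs from the two halting stacks, which have
  to be the states 1 and 2.\<close>

theorem tm_of_cmd:
  fixes p :: "nat poly"
  assumes main: "c = Seq c1 c2" and wd: "width c \<le> k" and k: "2 \<le> k"
    and run: "\<And>x u. \<exists>t\<le>poly p (length x + length u). \<exists>T.
      (run_step ^^ t) ([c], start_tapes k x u) = ([Halt (V x u)], T)"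
  shows "\<exists>M. polytime_tm M \<and> (\<forall>x u. accepts M x u \<longleftrightarrow> V x u)"
proof -
  let ?acc = "[Halt True]" and ?rej = "[Halt False]"
  define S where "S = conts c [] \<union> {[], ?acc, ?rej}"
  have closed: "control K s \<in> S" if "K \<in> S" for K s
    using that control_conts[of K c "[]" s] by (auto simp: S_def)
  have "finite (S - {[c], ?acc, ?rej})" by (simp add: S_def finite_conts)
  then obtain xs where xs: "set xs = S - {[c], ?acc, ?rej}" "distinct xs"
    using finite_distinct_list[of "S - {[c], ?acc, ?rej}"] by metis
  \<comment> \<open>The order yields the numbers that the machine model prescribes: start 0, accept
    1, reject 2.\<close>
  define L where "L = [c] # ?acc # ?rej # xs"
  have L: "distinct L" "set L = S"
  proof -
    have "[c] \<in> S" "?acc \<in> S" "?rej \<in> S" "[c] \<noteq> ?acc" "[c] \<noteq> ?rej"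
      using conts_self[of c "[]"] main by (auto simp: S_def)
    then show "distinct L" "set L = S" using xs by (auto simp: L_def)
  qed
  have bij: "bij_betw (nth L) {..<length L} S"
    using bij_betw_nth[OF L(1)] L(2) by auto
  define e where "e = inv_into {..<length L} (nth L)"
  have e: "e (L ! i) = i" if "i < length L" for i
    unfolding e_def using bij that by (simp add: bij_betw_inv_into_left)
  have Le: "L ! e K = K" "e K < length L" if "K \<in> S" for K
    using that bij unfolding e_def
    by (auto simp: bij_betw_inv_into_right) (metis bij_betw_def inv_into_into lessThan_iff)
  have LS: "L ! i \<in> S" if "i < length L" for i using that L(2) nth_mem by blast
  have e012: "e [c] = 0" "e ?acc = 1" "e ?rej = 2"
    using e[of 0] e[of 1] e[of 2] by (auto simp: L_def)
  define tr where "tr = (\<lambda>q rs. let s = (\<lambda>i. rs ! i) in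
    (e (control (L ! q) s), map (action (L ! q) s) [0..<k]))"
  define M where "M = \<lparr>num_tapes = k, num_states = length L, num_symbols = 3, transition = tr\<rparr>"
  have L3: "3 \<le> length L" by (simp add: L_def)
  have wf: "wf_tm M"
    unfolding wf_tm_def
  proof (intro conjI allI impI)
    fix q rs assume q: "q < num_states M" and rs: "length rs = num_tapes M \<and> set rs \<subseteq> {..<num_symbols M}"
    have "e (control (L ! q) ((!) rs)) < length L"
      using q by (intro Le(2) closed LS) (simp add: M_def)
    moreover have "rs ! i < 3" if "i < k" for i
      using rs that nth_mem[of i rs] by (auto simp: M_def simp del: nth_mem)
    ultimately show "case transition M q rs of (q', as) \<Rightarrow> q' < num_states M \<and>
        length as = num_tapes M \<and> fst ` set as \<subseteq> {..<num_symbols M}"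
      using fst_action by (auto simp: M_def tr_def Let_def)
  qed (use k L3 in \<open>simp_all add: M_def\<close>)
  have step: "tm_step M (e K, map T [0..<k]) = (e K', map T' [0..<k])"
    if K: "K \<in> S" "fits k K" and st: "run_step (K, T) = (K', T')" for K T K' T'
  proof (cases "K = ?acc \<or> K = ?rej")
    case True
    then show ?thesis using st e012 by (auto simp: run_step_def tm_step_def)
  next
    case False
    have "e K \<notin> {1, 2}"
    proof
      assume "e K \<in> {1, 2}"
      then have "L ! e K = ?acc \<or> L ! e K = ?rej" by (auto simp: L_def)
      then show False using False Le(1)[OF K(1)] by simp
    qed
    moreover have "control K (\<lambda>i. map scan (map T [0..<k]) ! i) = control K (\<lambda>i. scan (T i))"
      using K(2) by (intro control_cong) auto
    moreover have "action K (\<lambda>i. map scan (map T [0..<k]) ! i) i = action K (\<lambda>i. scan (T i)) i" if "i < k" for i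
      using that by (intro action_cong) auto
    ultimately show ?thesis using st Le(1)[OF K(1)]
      by (auto simp: run_step_def tm_step_def M_def tr_def Let_def map2_map_map cong: map_cong)
  qed
  have sim: "K \<in> S \<and> fits k K \<and> (tm_step M ^^ t) (start_config M x u) = (e K, map T [0..<k])"
    if "(run_step ^^ t) ([c], start_tapes k x u) = (K, T)" for t x u K T
    using that
  proof (induction t arbitrary: K T)
    case 0
    have "start_config M x u = (0, map (start_tapes k x u) [0..<k])"
    proof -
      have "word_tape x # word_tape u # replicate (k - 2) (word_tape [])
        = map (start_tapes k x u) [0..<k]" (is "?l = ?r")
      proof (rule nth_equalityI)
        show "length ?l = length ?r" using k by simp
        show "?l ! i = ?r ! i" if "i < length ?l" for i
          using that k by (auto simp: start_tapes_def nth_Cons split: nat.splits)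
      qed
      then show ?thesis by (simp add: start_config_def M_def)
    qed
    then show ?case using 0 e012 wd conts_self[of c "[]"] by (auto simp: fits_def S_def)
  next
    case (Suc t)
    obtain K0 T0 where 0: "(run_step ^^ t) ([c], start_tapes k x u) = (K0, T0)" by fastforce
    then have s: "run_step (K0, T0) = (K, T)" using Suc.prems by simp
    have K: "K = control K0 (\<lambda>i. scan (T0 i))" using s by (simp add: run_step_def)
    have K0: "K0 \<in> S" "fits k K0" "(tm_step M ^^ t) (start_config M x u) = (e K0, map T0 [0..<k])"
      using Suc.IH[OF 0] by blast+
    have "tm_step M (e K0, map T0 [0..<k]) = (e K, map T [0..<k])" by (rule step[OF K0(1,2) s])
    moreover have "K \<in> S" "fits k K" unfolding K by (rule closed[OF K0(1)], rule fits_control[OF K0(2)])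
    ultimately show ?case using K0(3) by simp
  qed
  \<comment> \<open>\<open>Halt\<close> is a fixed point of \<open>run_step\<close>, so the verdict
    persists once it is reached.\<close>
  have late: "state_after M x u t' = (if V x u then 1 else 2)"
    if t: "(run_step ^^ t) ([c], start_tapes k x u) = ([Halt (V x u)], T)" "t \<le> t'" for x u t t' T
  proof -
    have "(run_step ^^ t') ([c], start_tapes k x u) = ([Halt (V x u)], T)"
      using t run_step_Halt[of "t' - t" "V x u" "[]" T]
      funpow_add[of "t' - t" t run_step] by simp
    from sim[OF this] show ?thesis using e012 by (cases "V x u") (auto simp: state_after_def)
  qed
  have "polytime_tm M"
    unfolding polytime_tm_def
  proof (intro conjI exI allI wf)
    fix x u
    obtain t T where "t \<le> poly p (length x + length u)"
      "(run_step ^^ t) ([c], start_tapes k x u) = ([Halt (V x u)], T)" using run by blast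
    from late[OF this(2,1)] show "state_after M x u (poly p (length x + length u)) \<in> {1, 2}"
      by (cases "V x u") simp_all
  qed
  moreover have "accepts M x u \<longleftrightarrow> V x u" for x u
  proof -
    obtain t T where t: "(run_step ^^ t) ([c], start_tapes k x u) = ([Halt (V x u)], T)"
      using run by blast
    show ?thesis
    proof
      assume "accepts M x u"
      then obtain t' where t': "state_after M x u t' = 1" by (auto simp: accepts_def)
      \<comment> \<open>Acceptance is absorbing as well; at time \<open>t' + t\<close> it meets the
        verdict of the run.\<close>
      have mono: "state_after M x u (t' + n) = 1" for n
      proof (induction n)
        case (Suc n)
        then show ?case
          by (cases "(tm_step M ^^ (t' + n)) (start_config M x u)") (simp add: state_after_def tm_step_def)
      qed (simp add: t')
      have "state_after M x u (t' + t) = (if V x u then 1 else 2)"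
        by (rule late[OF t]) simp
      with mono[of t] show "V x u" by (cases "V x u") simp_all
    next
      assume "V x u"
      with late[OF t order_refl] have "state_after M x u t = 1" by simp
      then show "accepts M x u" unfolding accepts_def by (rule exI)
    qed
  qed
  ultimately show ?thesis by blast
qed

section \<open>Timed execution of commands under arbitrary continuations\<close>

definition exec :: "cmd \<Rightarrow> tapes \<Rightarrow> tapes \<Rightarrow> nat \<Rightarrow> bool" where
  "exec c T T' b \<longleftrightarrow> (\<exists>t\<le>b. \<forall>K. (run_step ^^ t) (c # K, T) = (K, T'))"

lemma exec_le: "exec c T T' a \<Longrightarrow> a \<le> b \<Longrightarrow> exec c T T' b"
  by (auto simp: exec_def intro: order_trans)

lemma run_trans:
  "(run_step ^^ t) a = b \<Longrightarrow> (run_step ^^ t') b = c \<Longrightarrow> (run_step ^^ (t' + t)) a = c"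
  by (simp add: funpow_add)

lemma run_Suc: "run_step a = b \<Longrightarrow> (run_step ^^ t) b = c \<Longrightarrow> (run_step ^^ Suc t) a = c"
  by (simp add: funpow_swap1)

lemma exec_Seq:
  assumes "exec c T T1 a" "exec d T1 T2 b" "a + b + 1 \<le> n"
  shows "exec (Seq c d) T T2 n"
proof -
  obtain t1 where 1: "t1 \<le> a" "\<And>K. (run_step ^^ t1) (c # K, T) = (K, T1)"
    using assms(1) by (auto simp: exec_def)
  obtain t2 where 2: "t2 \<le> b" "\<And>K. (run_step ^^ t2) (d # K, T1) = (K, T2)"
    using assms(2) by (auto simp: exec_def)
  have "(run_step ^^ Suc (t2 + t1)) (Seq c d # K, T) = (K, T2)" for K
    by (rule run_Suc[OF _ run_trans[OF 1(2) 2(2)]]) (simp add: run_step_def)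
  then show ?thesis unfolding exec_def using 1(1) 2(1) assms(3)
    by (intro exI[of _ "Suc (t2 + t1)"]) auto
qed

lemma exec_Cond:
  assumes "exec (if scan (T i) = a then c else d) T T' b" "b + 1 \<le> n"
  shows "exec (Cond i a c d) T T' n"
proof -
  obtain t where t: "t \<le> b" "\<And>K. (run_step ^^ t) ((if scan (T i) = a then c else d) # K, T) = (K, T')"
    using assms(1) by (auto simp: exec_def)
  have "(run_step ^^ Suc t) (Cond i a c d # K, T) = (K, T')" for K
    by (rule run_Suc[OF _ t(2)]) (simp add: run_step_def)
  then show ?thesis unfolding exec_def using t(1) assms(2)
    by (intro exI[of _ "Suc t"]) auto
qed

lemma exec_Loop:
  assumes "\<And>j. j < n \<Longrightarrow> scan (F j i) \<noteq> a" "scan (F n i) = a"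
    and "\<And>j. j < n \<Longrightarrow> exec c (F j) (F (Suc j)) b" and "n * (b + 1) + 1 \<le> t"
  shows "exec (Loop i a c) (F 0) (F n) t"
proof -
  \<comment> \<open>Induction on the number \<open>m\<close> of rounds still to come: a loop unrolls
    from its first round, so the claim starts at \<open>F (n - m)\<close>.\<close>
  have "exec (Loop i a c) (F (n - m)) (F n) (m * (b + 1) + 1)" if "m \<le> n" for m
    using that
  proof (induction m)
    case 0
    have "(run_step ^^ 1) (Loop i a c # K, F n) = (K, F n)" for K
      using assms(2) by (simp add: run_step_def)
    then show ?case unfolding exec_def by (intro exI[of _ 1]) auto
  next
    case (Suc m)
    let ?j = "n - Suc m"
    have j: "?j < n" "Suc ?j = n - m" using Suc.prems by auto
    obtain t1 where 1: "t1 \<le> b" "\<And>K. (run_step ^^ t1) (c # K, F ?j) = (K, F (n - m))"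
      using assms(3)[OF j(1)] j(2) by (auto simp: exec_def)
    obtain t2 where 2: "t2 \<le> m * (b + 1) + 1"
      "\<And>K. (run_step ^^ t2) (Loop i a c # K, F (n - m)) = (K, F n)"
      using Suc by (auto simp: exec_def)
    have "(run_step ^^ Suc (t2 + t1)) (Loop i a c # K, F ?j) = (K, F n)" for K
      by (rule run_Suc[OF _ run_trans[OF 1(2) 2(2)]])
        (use assms(1)[OF j(1)] in \<open>simp add: run_step_def\<close>)
    then show ?case unfolding exec_def using 1(1) 2(1)
      by (intro exI[of _ "Suc (t2 + t1)"]) auto
  qed
  from this[of n] show ?thesis using assms(4) by (auto intro: exec_le)
qed

type_synonym input = "bool list \<times> bool list"
type_synonym env = "nat \<Rightarrow> nat"

text \<open>Tape \<open>i \<ge> 2\<close> serves as a register: its cell \<open>0\<close> is marked and its head position is the value.  The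
  heads of the input and certificate tapes are numbered likewise and rest at \<open>0\<close>.\<close>

definition cell :: "input \<Rightarrow> nat \<Rightarrow> int \<Rightarrow> nat" where
  "cell w i = (if i = 0 then fst (word_tape (fst w)) else if i = 1 then fst (word_tape (snd w))
     else (\<lambda>p. if p = 0 then 1 else 0))"

definition tapes_of :: "input \<Rightarrow> env \<Rightarrow> tapes" where
  "tapes_of w \<rho> = (\<lambda>i. (cell w i, int (\<rho> i)))"

lemma scan_tapes_of: "scan (tapes_of w \<rho> i) = cell w i (int (\<rho> i))"
  by (simp add: scan_def tapes_of_def)

lemma scan_register: "2 \<le> i \<Longrightarrow> scan (tapes_of w \<rho> i) = 1 \<longleftrightarrow> \<rho> i = 0"
  by (simp add: scan_tapes_of cell_def)

abbreviation "Inc i \<equiv> Move i Go_Right"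
abbreviation "Dec i \<equiv> Move i Go_Left"

lemma exec_Inc: "exec (Inc i) (tapes_of w \<rho>) (tapes_of w (\<rho>(i := Suc (\<rho> i)))) 1"
  unfolding exec_def
  by (intro exI[of _ 1]) (auto simp: run_step_def tapes_of_def act_def scan_def fun_eq_iff)

lemma exec_Dec: "\<rho> i \<noteq> 0 \<Longrightarrow> exec (Dec i) (tapes_of w \<rho>) (tapes_of w (\<rho>(i := \<rho> i - 1))) 1"
  unfolding exec_def
  by (intro exI[of _ 1]) (auto simp: run_step_def tapes_of_def act_def scan_def fun_eq_iff of_nat_diff)

lemma exec_weaken: "exec c T (tapes_of w \<rho>1) a \<Longrightarrow> \<rho>1 = \<rho>2 \<Longrightarrow> a \<le> b \<Longrightarrow> exec c T (tapes_of w \<rho>2) b"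
  by (auto intro: exec_le)

lemma exec_count:
  assumes "2 \<le> i" "F 0 = \<rho>" "F n = \<rho>'" "\<And>j. j < n \<Longrightarrow> F j i \<noteq> 0" "F n i = 0"
    and "\<And>j. j < n \<Longrightarrow> exec c (tapes_of w (F j)) (tapes_of w (F (Suc j))) b" and "n * (b + 1) + 1 \<le> t"
  shows "exec (Loop i 1 c) (tapes_of w \<rho>) (tapes_of w \<rho>') t"
  unfolding assms(2,3)[symmetric]
  by (rule exec_Loop[where F = "\<lambda>j. tapes_of w (F j)"])
    (use assms(1,4-7) in \<open>simp_all only: scan_register not_False_eq_True\<close>)

definition "clear i = Loop i 1 (Dec i)"
definition "transfer i j = Loop i 1 (Seq (Dec i) (Inc j))"
text \<open>Reading a register means running its head back to 0. A copy therefore empties it into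
  two registers and moves one of them back.\<close>

definition "transfer2 i j k = Loop i 1 (Seq (Dec i) (Seq (Inc j) (Inc k)))"

lemma exec_clear:
  assumes "2 \<le> i" "\<rho>' = \<rho>(i := 0)" "\<rho> i * 2 + 1 \<le> t"
  shows "exec (clear i) (tapes_of w \<rho>) (tapes_of w \<rho>') t"
  unfolding clear_def
proof (rule exec_count[where F = "\<lambda>j. \<rho>(i := \<rho> i - j)" and n = "\<rho> i" and b = 1])
  show "exec (Dec i) (tapes_of w (\<rho>(i := \<rho> i - j))) (tapes_of w (\<rho>(i := \<rho> i - Suc j))) 1" if "j < \<rho> i" for j
    by (rule exec_weaken[OF exec_Dec]) (use that in auto)
qed (use assms in auto)

lemma exec_transfer:
  assumes "2 \<le> i" "i \<noteq> j" "\<rho>' = \<rho>(i := 0, j := \<rho> j + \<rho> i)" "\<rho> i * 4 + 1 \<le> t"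
  shows "exec (transfer i j) (tapes_of w \<rho>) (tapes_of w \<rho>') t"
  unfolding transfer_def
proof (rule exec_count[where F = "\<lambda>l. \<rho>(i := \<rho> i - l, j := \<rho> j + l)" and n = "\<rho> i" and b = 3])
  show "exec (Seq (Dec i) (Inc j)) (tapes_of w (\<rho>(i := \<rho> i - l, j := \<rho> j + l)))
    (tapes_of w (\<rho>(i := \<rho> i - Suc l, j := \<rho> j + Suc l))) 3" if "l < \<rho> i" for l
    by (rule exec_weaken[OF exec_Seq[OF exec_Dec exec_Inc order_refl]]) (use that assms in \<open>auto simp: fun_eq_iff\<close>)
qed (use assms in auto)

lemma exec_transfer2:
  assumes "2 \<le> i" "distinct [i, j, k]" "\<rho>' = \<rho>(i := 0, j := \<rho> j + \<rho> i, k := \<rho> k + \<rho> i)"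
    "\<rho> i * 6 + 1 \<le> t"
  shows "exec (transfer2 i j k) (tapes_of w \<rho>) (tapes_of w \<rho>') t"
  unfolding transfer2_def
proof (rule exec_count[where F = "\<lambda>l. \<rho>(i := \<rho> i - l, j := \<rho> j + l, k := \<rho> k + l)"
        and n = "\<rho> i" and b = 5])
  show "exec (Seq (Dec i) (Seq (Inc j) (Inc k))) (tapes_of w (\<rho>(i := \<rho> i - l, j := \<rho> j + l, k := \<rho> k + l)))
    (tapes_of w (\<rho>(i := \<rho> i - Suc l, j := \<rho> j + Suc l, k := \<rho> k + Suc l))) 5" if "l < \<rho> i" for l
    by (rule exec_weaken[OF exec_Seq[OF exec_Dec exec_Seq[OF exec_Inc exec_Inc order_refl] order_refl]])
      (use that assms in \<open>auto simp: fun_eq_iff\<close>)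
qed (use assms in auto)

section \<open>Polynomial-time functions of unary arguments\<close>

text \<open>The base \<open>B + 2\<close> is at least 2 even for \<open>B = 0\<close>, so constants
  and sums are absorbed by a larger exponent.\<close>

definition poly_growth :: "(nat \<Rightarrow> nat) \<Rightarrow> bool" where
  "poly_growth t \<longleftrightarrow> (\<exists>d. \<forall>B. t B \<le> (B + 2) ^ d)"

lemma poly_growth_mono: "poly_growth t \<Longrightarrow> (\<And>B. s B \<le> t B) \<Longrightarrow> poly_growth s"
  unfolding poly_growth_def by (meson order_trans)

lemma poly_growth_id: "poly_growth (\<lambda>B. B)"
  unfolding poly_growth_def by (rule exI[of _ 1]) simp

lemma poly_growth_const: "poly_growth (\<lambda>B. k)"
  unfolding poly_growth_def
proof (intro exI allI)
  fix B :: nat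
  have "k \<le> 2 ^ k" by (rule less_imp_le[OF less_exp])
  also have "\<dots> \<le> (B + 2) ^ k" by (rule power_mono) auto
  finally show "k \<le> (B + 2) ^ k" .
qed

lemma poly_growth_mult:
  assumes "poly_growth s" "poly_growth t" shows "poly_growth (\<lambda>B. s B * t B)"
proof -
  obtain d e where "\<And>B. s B \<le> (B + 2) ^ d" "\<And>B. t B \<le> (B + 2) ^ e"
    using assms by (auto simp: poly_growth_def)
  then have "s B * t B \<le> (B + 2) ^ (d + e)" for B
    by (simp add: power_add mult_mono)
  then show ?thesis by (auto simp: poly_growth_def)
qed

lemma poly_growth_add:
  assumes "poly_growth s" "poly_growth t" shows "poly_growth (\<lambda>B. s B + t B)"
proof (rule poly_growth_mono)
  \<comment> \<open>Sums reduce to products by \<open>s + t <= (s + 1) * (t + 1)\<close>.\<close>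
  show "poly_growth (\<lambda>B. (s B + 1) * (t B + 1))"
  proof -
    have "poly_growth (\<lambda>B. s B + 1)" if s: "poly_growth s" for s
    proof -
      obtain d where d: "\<And>B. s B \<le> (B + 2) ^ d" using s by (auto simp: poly_growth_def)
      have "s B + 1 \<le> (B + 2) ^ Suc d" for B
      proof -
        have "1 \<le> (B + 2) ^ d" by simp
        then have "s B + 1 \<le> 2 * (B + 2) ^ d" using d[of B] by linarith
        also have "\<dots> \<le> (B + 2) ^ Suc d" by simp
        finally show ?thesis .
      qed
      then show ?thesis unfolding poly_growth_def by blast
    qed
    with assms show ?thesis by (intro poly_growth_mult) auto
  qed
qed (simp add: algebra_simps)

lemma poly_growth_compose:
  assumes "poly_growth s" "poly_growth t" shows "poly_growth (\<lambda>B. s (t B))"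
proof -
  obtain e where e: "\<And>B. s B \<le> (B + 2) ^ e" using assms by (auto simp: poly_growth_def)
  have "poly_growth (\<lambda>B. t B + 2)" using assms by (intro poly_growth_add poly_growth_const)
  then obtain d where d: "\<And>B. t B + 2 \<le> (B + 2) ^ d" by (auto simp: poly_growth_def)
  have "s (t B) \<le> (B + 2) ^ (d * e)" for B
    using order_trans[OF e[of "t B"] power_mono[OF d[of B]]] by (simp add: power_mult)
  then show ?thesis by (auto simp: poly_growth_def)
qed

lemmas poly_growth_intros = poly_growth_id poly_growth_const poly_growth_add poly_growth_mult

definition size_le :: "input \<Rightarrow> nat \<Rightarrow> bool" where
  "size_le w B \<longleftrightarrow> length (fst w) + length (snd w) \<le> B"

definition poly_bounded :: "(input \<Rightarrow> env \<Rightarrow> nat) \<Rightarrow> bool" where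
  "poly_bounded f \<longleftrightarrow> (\<exists>t. poly_growth t \<and> (\<forall>w \<rho> B. size_le w B \<longrightarrow> (\<forall>j. \<rho> j \<le> B) \<longrightarrow> f w \<rho> \<le> t B))"

lemma poly_boundedI: "poly_growth t \<Longrightarrow> (\<And>w \<rho> B. size_le w B \<Longrightarrow> (\<And>j. \<rho> j \<le> B) \<Longrightarrow> f w \<rho> \<le> t B) \<Longrightarrow> poly_bounded f"
  unfolding poly_bounded_def by blast

lemma poly_boundedE: assumes "poly_bounded f" obtains t where "poly_growth t"
  "\<And>w \<rho> B. size_le w B \<Longrightarrow> (\<And>j. \<rho> j \<le> B) \<Longrightarrow> f w \<rho> \<le> t B"
  using assms unfolding poly_bounded_def by blast

lemma poly_bounded_const: "poly_bounded (\<lambda>w \<rho>. k)" by (rule poly_boundedI[OF poly_growth_const]) auto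
lemma poly_bounded_var: "poly_bounded (\<lambda>w \<rho>. \<rho> k)" by (rule poly_boundedI[OF poly_growth_id]) auto
lemma poly_bounded_len: "poly_bounded (\<lambda>w \<rho>. length (fst w))" by (rule poly_boundedI[OF poly_growth_id]) (auto simp: size_le_def)

lemma poly_bounded_add: assumes "poly_bounded f" "poly_bounded g" shows "poly_bounded (\<lambda>w \<rho>. f w \<rho> + g w \<rho>)"
proof -
  obtain s t where st: "poly_growth s" "poly_growth t"
    "\<And>w \<rho> B. size_le w B \<Longrightarrow> (\<And>j. \<rho> j \<le> B) \<Longrightarrow> f w \<rho> \<le> s B"
    "\<And>w \<rho> B. size_le w B \<Longrightarrow> (\<And>j. \<rho> j \<le> B) \<Longrightarrow> g w \<rho> \<le> t B"
    using assms by (metis poly_boundedE)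
  show ?thesis by (rule poly_boundedI[OF poly_growth_add[OF st(1,2)]]) (simp add: add_mono st(3,4))
qed

lemma poly_bounded_mult: assumes "poly_bounded f" "poly_bounded g" shows "poly_bounded (\<lambda>w \<rho>. f w \<rho> * g w \<rho>)"
proof -
  obtain s t where st: "poly_growth s" "poly_growth t"
    "\<And>w \<rho> B. size_le w B \<Longrightarrow> (\<And>j. \<rho> j \<le> B) \<Longrightarrow> f w \<rho> \<le> s B"
    "\<And>w \<rho> B. size_le w B \<Longrightarrow> (\<And>j. \<rho> j \<le> B) \<Longrightarrow> g w \<rho> \<le> t B"
    using assms by (metis poly_boundedE)
  show ?thesis by (rule poly_boundedI[OF poly_growth_mult[OF st(1,2)]]) (simp add: mult_mono st(3,4))
qed

lemma poly_bounded_le: assumes "poly_bounded g" "\<And>w \<rho>. f w \<rho> \<le> g w \<rho>" shows "poly_bounded f"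
  using assms by (metis poly_boundedE poly_boundedI order_trans)

definition bounds :: "(nat \<Rightarrow> nat) \<Rightarrow> (input \<Rightarrow> env \<Rightarrow> nat) \<Rightarrow> bool" where
  "bounds t f \<longleftrightarrow> (\<forall>w \<rho> B. size_le w B \<longrightarrow> (\<forall>j. \<rho> j \<le> B) \<longrightarrow> f w \<rho> \<le> t B)"

lemma poly_bounded_bounds: "poly_bounded f \<Longrightarrow> \<exists>t. poly_growth t \<and> bounds t f"
  by (simp add: poly_bounded_def bounds_def)

lemma boundsD: "bounds t f \<Longrightarrow> size_le w B \<Longrightarrow> (\<And>j. \<rho> j \<le> B) \<Longrightarrow> f w \<rho> \<le> t B"
  unfolding bounds_def by blast

text \<open>The variable \<open>j\<close> of \<open>f\<close> is held in register \<open>r j\<close>.  The program writes the result to register \<open>m\<close> and leaves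
  all registers beyond \<open>m\<close> at \<open>0\<close>, as it found them.\<close>

definition computes :: "nat \<Rightarrow> (nat \<Rightarrow> nat) \<Rightarrow> (input \<Rightarrow> env \<Rightarrow> nat) \<Rightarrow> cmd \<Rightarrow> (nat \<Rightarrow> nat) \<Rightarrow> bool" where
  "computes m r f c t \<longleftrightarrow> poly_growth t \<and> (\<forall>w \<rho> B. size_le w B \<longrightarrow> (\<forall>j. \<rho> j \<le> B) \<longrightarrow>
     \<rho> 0 = 0 \<longrightarrow> \<rho> 1 = 0 \<longrightarrow> (\<forall>j\<ge>m. \<rho> j = 0) \<longrightarrow>
     exec c (tapes_of w \<rho>) (tapes_of w (\<rho>(m := f w (\<rho> \<circ> r)))) (t B))"

lemma computesI:
  assumes "poly_growth t" "\<And>w \<rho> B. size_le w B \<Longrightarrow> \<forall>j. \<rho> j \<le> B \<Longrightarrow> \<rho> 0 = 0 \<Longrightarrow> \<rho> 1 = 0 \<Longrightarrow>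
    \<forall>j\<ge>m. \<rho> j = 0 \<Longrightarrow> exec c (tapes_of w \<rho>) (tapes_of w (\<rho>(m := f w (\<rho> \<circ> r)))) (t B)"
  shows "\<exists>c t. computes m r f c t"
  using assms unfolding computes_def by blast

lemma computesD: "computes m r f c t \<Longrightarrow> poly_growth t"
  "computes m r f c t \<Longrightarrow> size_le w B \<Longrightarrow> (\<And>j. \<rho> j \<le> B) \<Longrightarrow> \<rho> 0 = 0 \<Longrightarrow> \<rho> 1 = 0 \<Longrightarrow>
    (\<And>j. m \<le> j \<Longrightarrow> \<rho> j = 0) \<Longrightarrow> exec c (tapes_of w \<rho>) (tapes_of w (\<rho>(m := f w (\<rho> \<circ> r)))) (t B)"
  unfolding computes_def by blast+

text \<open>Every placement \<open>r\<close> below every \<open>m\<close> is allowed, injective or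
  not, since \<open>ptime_subst\<close> and \<open>ptime_rec\<close> use placements of their own.
  The bound on the value belongs to the notion because values are held in unary.\<close>

definition ptime :: "(input \<Rightarrow> env \<Rightarrow> nat) \<Rightarrow> bool" where
  "ptime f \<longleftrightarrow> poly_bounded f \<and> (\<forall>r m. (\<forall>j. 2 \<le> r j \<and> r j < m) \<longrightarrow> (\<exists>c t. computes m r f c t))"

abbreviation ptime_dec :: "(input \<Rightarrow> env \<Rightarrow> bool) \<Rightarrow> bool" where
  "ptime_dec P \<equiv> ptime (\<lambda>w \<rho>. of_bool (P w \<rho>))"

lemma ptime_poly_bounded: "ptime f \<Longrightarrow> poly_bounded f"
  by (simp add: ptime_def)

lemma ptimeI:
  assumes "poly_bounded f" and "\<And>r m. (\<And>j. 2 \<le> r j) \<Longrightarrow> (\<And>j. r j < m) \<Longrightarrow> 2 < m \<Longrightarrow> \<exists>c t. computes m r f c t"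
  shows "ptime f"
  unfolding ptime_def using assms by (metis le_less_trans)

lemma ptimeE:
  assumes "ptime f" "\<And>j. 2 \<le> r j" "\<And>j. r j < m"
  shows "\<exists>c t. computes m r f c t"
  using assms unfolding ptime_def by blast

lemma ptime_zero: "ptime (\<lambda>w \<rho>. 0)"
proof (rule ptimeI)
  show "poly_bounded (\<lambda>w \<rho>. 0)" by (rule poly_bounded_const)
  fix r :: "nat \<Rightarrow> nat" and m
  show "\<exists>c t. computes m r (\<lambda>w \<rho>. 0) c t"
  \<comment> \<open>Register \<open>m\<close> is 0 already; stepping forth and back is the idle
    program.\<close>
  proof (rule computesI[where c = "Seq (Inc m) (Dec m)" and t = "\<lambda>_. 3", OF poly_growth_const])
    fix w B and \<rho> :: env assume "\<forall>j\<ge>m. \<rho> j = 0"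
    then show "exec (Seq (Inc m) (Dec m)) (tapes_of w \<rho>) (tapes_of w (\<rho>(m := 0))) 3"
      by (intro exec_weaken[OF exec_Seq[OF exec_Inc exec_Dec order_refl]]) auto
  qed
qed

lemma ptime_Suc: assumes f: "ptime f" shows "ptime (\<lambda>w \<rho>. Suc (f w \<rho>))"
proof (rule ptimeI)
  show "poly_bounded (\<lambda>w \<rho>. Suc (f w \<rho>))" using poly_bounded_add[OF poly_bounded_const[of 1] ptime_poly_bounded[OF f]] by simp
  fix r :: "nat \<Rightarrow> nat" and m assume r: "\<And>j. 2 \<le> r j" "\<And>j. r j < m"
  obtain c t where c: "computes m r f c t"
    using ptimeE[where r = r, OF f r] by blast
  show "\<exists>c t. computes m r (\<lambda>w \<rho>. Suc (f w \<rho>)) c t"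
  proof (rule computesI[where c = "Seq c (Inc m)" and t = "\<lambda>B. t B + 2"])
    show "poly_growth (\<lambda>B. t B + 2)" by (intro poly_growth_intros computesD(1)[OF c])
    fix w B and \<rho> :: env
    assume a: "size_le w B" "\<forall>j. \<rho> j \<le> B" "\<rho> 0 = 0" "\<rho> 1 = 0" "\<forall>j\<ge>m. \<rho> j = 0"
    show "exec (Seq c (Inc m)) (tapes_of w \<rho>) (tapes_of w (\<rho>(m := Suc (f w (\<rho> \<circ> r))))) (t B + 2)"
      by (rule exec_weaken[OF exec_Seq[OF computesD(2)[OF c] exec_Inc order_refl]]) (use a in auto)
  qed
qed

lemma ptime_var: "ptime (\<lambda>w \<rho>. \<rho> k)"
proof (rule ptimeI)
  show "poly_bounded (\<lambda>w \<rho>. \<rho> k)" by (rule poly_bounded_var)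
  fix r :: "nat \<Rightarrow> nat" and m assume r: "\<And>j. 2 \<le> r j" "\<And>j. r j < m" "2 < m"
  let ?c = "Seq (transfer2 (r k) m (Suc m)) (transfer (Suc m) (r k))"
  show "\<exists>c t. computes m r (\<lambda>w \<rho>. \<rho> k) c t"
  proof (rule computesI[where c = ?c and t = "\<lambda>B. B * 10 + 3"])
    show "poly_growth (\<lambda>B. B * 10 + 3)" by (intro poly_growth_intros)
    fix w B and \<rho> :: env
    assume a: "\<forall>j. \<rho> j \<le> B" "\<forall>j\<ge>m. \<rho> j = 0"
    have rk: "r k \<noteq> m" "r k \<noteq> Suc m" using r(2)[of k] by auto
    show "exec ?c (tapes_of w \<rho>) (tapes_of w (\<rho>(m := (\<rho> \<circ> r) k))) (B * 10 + 3)"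
      by (rule exec_weaken[OF exec_Seq[OF exec_transfer2[OF r(1) _ refl order_refl] exec_transfer[OF _ _ refl order_refl] order_refl]])
        (use a r rk in \<open>auto simp: fun_eq_iff\<close>)
  qed
qed

text \<open>Renaming variables costs no code: a program for the placement \<open>r (s j)\<close>
  serves. This is how a function is moved under the bound variables of a recursion.\<close>

lemma ptime_subst:
  assumes f: "ptime f" shows "ptime (\<lambda>w \<rho>. f w (\<lambda>j. \<rho> (s j)))"
proof (rule ptimeI)
  obtain t where t: "poly_growth t" "bounds t f"
    using poly_bounded_bounds[OF ptime_poly_bounded[OF f]] by blast
  show "poly_bounded (\<lambda>w \<rho>. f w (\<lambda>j. \<rho> (s j)))" by (rule poly_boundedI[OF t(1)]) (rule boundsD[OF t(2)])
  fix r :: "nat \<Rightarrow> nat" and m assume r: "\<And>j. 2 \<le> r j" "\<And>j. r j < m"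
  then have "\<And>j. 2 \<le> r (s j)" "\<And>j. r (s j) < m" by auto
  then obtain c t where c: "computes m (\<lambda>j. r (s j)) f c t"
    using ptimeE[OF f, of "\<lambda>j. r (s j)"] by blast
  from c show "\<exists>c t. computes m r (\<lambda>w \<rho>. f w (\<lambda>j. \<rho> (s j))) c t"
    by (intro exI[of _ c] exI[of _ t]) (auto simp: computes_def o_def)
qed

text \<open>In the body, variables 0 and 1 stand for the accumulator and the loop index.\<close>

lemma ptime_rec:
  assumes n: "ptime n" and z: "ptime z"
    and s: "ptime (\<lambda>w \<rho>. s w (\<lambda>j. \<rho> (Suc (Suc j))) (\<rho> 1) (\<rho> 0))"
    and h: "poly_bounded h" "\<And>w \<rho> l. l \<le> n w \<rho> \<Longrightarrow> rec_nat (z w \<rho>) (s w \<rho>) l \<le> h w \<rho>"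
  shows "ptime (\<lambda>w \<rho>. rec_nat (z w \<rho>) (\<lambda>l a. s w \<rho> l a) (n w \<rho>))"
proof (rule ptimeI)
  \<comment> \<open>Iteration can turn polynomial growth of the step into exponential growth;
    \<open>h\<close> bounds all accumulators, and thereby each run of the body.\<close>
  obtain th where th: "poly_growth th" "bounds th h"
    using poly_bounded_bounds[OF h(1)] by blast
  obtain tn where tn: "poly_growth tn" "bounds tn n"
    using poly_bounded_bounds[OF ptime_poly_bounded[OF n]] by blast
  show "poly_bounded (\<lambda>w \<rho>. rec_nat (z w \<rho>) (\<lambda>l a. s w \<rho> l a) (n w \<rho>))"
    by (rule poly_bounded_le[OF h(1)]) (simp add: h(2))
  fix r :: "nat \<Rightarrow> nat" and m assume r: "\<And>j. 2 \<le> r j" "\<And>j. r j < m" "2 < m"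
  \<comment> \<open>Register \<open>m\<close> counts the remaining rounds, \<open>m + 1\<close>
    holds the accumulator and \<open>m + 2\<close> the index; the body writes to
    \<open>m + 3\<close>.\<close>
  let ?m1 = "m + 1" and ?m2 = "m + 2" and ?m3 = "m + 3"
  define r' where "r' = case_nat ?m1 (case_nat ?m2 r)"
  have r': "\<And>j. 2 \<le> r' j" "\<And>j. r' j < ?m3"
    using r by (auto simp: r'_def split: nat.splits intro: trans_less_add1)
  have r1: "\<And>j. r j < ?m1" using r(2) by (simp add: less_SucI)
  obtain cn t1 where cn: "computes m r n cn t1"
    using ptimeE[where r = r, OF n r(1,2)] by blast
  obtain cz t2 where cz: "computes ?m1 r z cz t2"
    using ptimeE[where r = r, OF z r(1) r1] by blast
  obtain cs t3 where cs: "computes ?m3 r' (\<lambda>w \<rho>. s w (\<lambda>j. \<rho> (Suc (Suc j))) (\<rho> 1) (\<rho> 0)) cs t3"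
    using ptimeE[where r = r', OF s r'] by blast
  let ?body = "Seq (Dec m) (Seq cs (Seq (clear ?m1) (Seq (transfer ?m3 ?m1) (Inc ?m2))))"
  let ?c = "Seq cn (Seq cz (Seq (Loop m 1 ?body) (Seq (clear ?m2) (transfer ?m1 m))))"
  \<comment> \<open>The body runs with all registers below \<open>B + tn B + th B\<close>: the old
    ones, the two counters and the accumulator.\<close>
  define b where "b = (\<lambda>B. t3 (B + tn B + th B) + 6 * th B + 12)"
  define t where "t = (\<lambda>B. t1 B + t2 (B + tn B) + tn B * (b B + 1) + 2 * tn B + 4 * th B + 12)"
  show "\<exists>c t. computes m r (\<lambda>w \<rho>. rec_nat (z w \<rho>) (\<lambda>l a. s w \<rho> l a) (n w \<rho>)) c t"
  proof (rule computesI[where c = ?c and t = t])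
    show "poly_growth t" unfolding t_def b_def
      by (intro poly_growth_intros computesD(1)[OF cn] th(1) tn(1) poly_growth_compose[OF computesD(1)[OF cz]] poly_growth_compose[OF computesD(1)[OF cs]])
    fix w B and \<rho> :: env
    assume a: "size_le w B" "\<forall>j. \<rho> j \<le> B" "\<rho> 0 = 0" "\<rho> 1 = 0" "\<forall>j\<ge>m. \<rho> j = 0"
    define N where "N = n w (\<rho> \<circ> r)"
    define R where "R = rec_nat (z w (\<rho> \<circ> r)) (s w (\<rho> \<circ> r))"
    have N: "N \<le> tn B" unfolding N_def by (rule boundsD[OF tn(2) a(1)]) (use a in simp)
    have R: "R l \<le> th B" if "l \<le> N" for l
      using h(2)[of l w "\<rho> \<circ> r"] boundsD[OF th(2) a(1), of "\<rho> \<circ> r"] that a(2)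
      by (auto simp: R_def N_def intro: order_trans)
    define F where "F j = \<rho>(m := N - j, ?m1 := R j, ?m2 := j)" for j
    have rne: "r j \<noteq> m" "r j \<noteq> m + i" for i j using r(2)[of j] by auto
    have e1: "exec cn (tapes_of w \<rho>) (tapes_of w (\<rho>(m := N))) (t1 B)"
      unfolding N_def by (rule computesD(2)[OF cn]) (use a in auto)
    have e2: "exec cz (tapes_of w (\<rho>(m := N))) (tapes_of w (F 0)) (t2 (B + tn B))"
    proof (rule exec_weaken[OF computesD(2)[OF cz]])
      show "size_le w (B + tn B)" using a(1) by (simp add: size_le_def)
      show "(\<rho>(m := N)) j \<le> B + tn B" for j using a(2) N by (simp add: trans_le_add1 trans_le_add2)
      show "(\<rho>(m := N))(m + 1 := z w ((\<rho>(m := N)) \<circ> r)) = F 0"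
      proof -
        have e: "(\<rho>(m := N)) \<circ> r = \<rho> \<circ> r" using rne by (auto simp: fun_eq_iff)
        show ?thesis unfolding e using a(5) by (auto simp: F_def R_def fun_eq_iff)
      qed
    qed (use a r in auto)
    have body: "exec ?body (tapes_of w (F j)) (tapes_of w (F (Suc j))) (b B)" if j: "j < N" for j
    proof -
      define G where "G = (F j)(m := N - Suc j)"
      have G: "G \<circ> r = \<rho> \<circ> r" "G ?m1 = R j" "G ?m2 = j" "G ?m3 = 0" "G m = N - Suc j"
        using rne(1) rne(2)[of _ 1] rne(2)[of _ 2] a(5) by (auto simp: G_def F_def fun_eq_iff)
      have x1: "exec (Dec m) (tapes_of w (F j)) (tapes_of w G) 1"
        by (rule exec_weaken[OF exec_Dec]) (use j in \<open>auto simp: F_def G_def\<close>)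
      have x2: "exec cs (tapes_of w G) (tapes_of w (G(?m3 := R (Suc j)))) (t3 (B + tn B + th B))"
      proof (rule exec_weaken[OF computesD(2)[OF cs]])
        show "size_le w (B + tn B + th B)" using a(1) by (simp add: size_le_def)
        have "N - Suc j \<le> B + tn B + th B" "R j \<le> B + tn B + th B" "j \<le> B + tn B + th B"
          using N j R[of j] by linarith+
        moreover have "\<rho> i \<le> B + tn B + th B" for i using a(2) by (simp add: trans_le_add1)
        ultimately show "G i \<le> B + tn B + th B" for i by (simp add: G_def F_def)
        show "G 0 = 0" "G 1 = 0" using a r(3) by (auto simp: G_def F_def)
        show "G i = 0" if "?m3 \<le> i" for i using a(5) that by (auto simp: G_def F_def)
        have "(\<lambda>j. (G \<circ> r') (Suc (Suc j))) = \<rho> \<circ> r" "(G \<circ> r') 1 = j" "(G \<circ> r') 0 = R j"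
          using G by (auto simp: r'_def fun_eq_iff)
        then show "G(?m3 := s w (\<lambda>j. (G \<circ> r') (Suc (Suc j))) ((G \<circ> r') 1) ((G \<circ> r') 0)) = G(?m3 := R (Suc j))"
          by (simp add: R_def)
      qed simp
      have x3: "exec (clear ?m1) (tapes_of w (G(?m3 := R (Suc j)))) (tapes_of w (G(?m3 := R (Suc j), ?m1 := 0))) (2 * th B + 1)"
        by (rule exec_clear) (use r(3) R[of j] G(2) j in \<open>auto simp: fun_eq_iff\<close>)
      have x4: "exec (transfer ?m3 ?m1) (tapes_of w (G(?m3 := R (Suc j), ?m1 := 0))) (tapes_of w (G(?m1 := R (Suc j)))) (4 * th B + 1)"
        by (rule exec_transfer) (use R[of "Suc j"] G(4) j in \<open>auto simp: fun_eq_iff\<close>)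
      have x5: "exec (Inc ?m2) (tapes_of w (G(?m1 := R (Suc j)))) (tapes_of w (F (Suc j))) 1"
        by (rule exec_weaken[OF exec_Inc]) (auto simp: G_def F_def fun_eq_iff)
      show ?thesis
        by (rule exec_le[OF exec_Seq[OF x1 exec_Seq[OF x2 exec_Seq[OF x3 exec_Seq[OF x4 x5 order_refl] order_refl] order_refl] order_refl]])
          (simp add: b_def)
    qed
    have e3: "exec (Loop m 1 ?body) (tapes_of w (F 0)) (tapes_of w (F N)) (tn B * (b B + 1) + 1)"
      by (rule exec_count[where F = F and n = N, OF _ refl refl _ _ body])
        (use r(3) N in \<open>auto simp: F_def simp del: One_nat_def intro!: mult_mono\<close>)
    have e4: "exec (clear ?m2) (tapes_of w (F N)) (tapes_of w ((F N)(?m2 := 0))) (2 * tn B + 1)"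
      by (rule exec_clear) (use N in \<open>auto simp: F_def\<close>)
    have e5: "exec (transfer ?m1 m) (tapes_of w ((F N)(?m2 := 0))) (tapes_of w (\<rho>(m := R N))) (4 * th B + 1)"
      by (rule exec_transfer) (use R[of N] a(5) r in \<open>auto simp: F_def fun_eq_iff\<close>)
    show "exec ?c (tapes_of w \<rho>) (tapes_of w (\<rho>(m := rec_nat (z w (\<rho> \<circ> r)) (\<lambda>l a. s w (\<rho> \<circ> r) l a) (n w (\<rho> \<circ> r))))) (t B)"
      using exec_Seq[OF e1 exec_Seq[OF e2 exec_Seq[OF e3 exec_Seq[OF e4 e5 order_refl] order_refl] order_refl] order_refl]
      by (rule exec_weaken) (simp_all add: t_def R_def N_def)
  qed
qed

definition bit_at :: "bool list \<Rightarrow> nat \<Rightarrow> bool" where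
  "bit_at x p \<longleftrightarrow> p < length x \<and> x ! p"

lemma cell_word:
  "cell w 0 (int p) = (if p < length (fst w) then if bit_at (fst w) p then 2 else 1 else 0)"
  "cell w 1 (int p) = (if p < length (snd w) then if bit_at (snd w) p then 2 else 1 else 0)"
  by (auto simp: cell_def word_tape_def bit_at_def)

lemma ptime_look:
  assumes f: "ptime f" and k: "k < 2"
  shows "ptime (\<lambda>w \<rho>. of_bool (cell w k (int (f w \<rho>)) = 2))"
proof (rule ptimeI)
  show "poly_bounded (\<lambda>w \<rho>. of_bool (cell w k (int (f w \<rho>)) = 2))" by (rule poly_bounded_le[OF poly_bounded_const[of 1]]) simp
  obtain tf where tf: "poly_growth tf" "bounds tf f"
    using poly_bounded_bounds[OF ptime_poly_bounded[OF f]] by blast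
  fix r :: "nat \<Rightarrow> nat" and m assume r: "\<And>j. 2 \<le> r j" "\<And>j. r j < m" "2 < m"
  obtain c t where c: "computes m r f c t"
    using ptimeE[where r = r, OF f r(1,2)] by blast
  \<comment> \<open>Walking head \<open>k\<close> to its position empties register \<open>m\<close>,
    which is then free for the bit, while \<open>m + 1\<close> remembers the way back.\<close>
  let ?go = "transfer2 m (m + 1) k" and ?read = "Cond k 2 (Inc m) (Seq (Inc m) (Dec m))"
  let ?back = "Loop (m + 1) 1 (Seq (Dec (m + 1)) (Dec k))"
  let ?c = "Seq c (Seq ?go (Seq ?read ?back))"
  show "\<exists>c t. computes m r (\<lambda>w \<rho>. of_bool (cell w k (int (f w \<rho>)) = 2)) c t"
  proof (rule computesI[where c = ?c and t = "\<lambda>B. t B + tf B * 10 + 9"])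
    show "poly_growth (\<lambda>B. t B + tf B * 10 + 9)" by (intro poly_growth_intros computesD(1)[OF c] tf(1))
    fix w B and \<rho> :: env
    assume a: "size_le w B" "\<forall>j. \<rho> j \<le> B" "\<rho> 0 = 0" "\<rho> 1 = 0" "\<forall>j\<ge>m. \<rho> j = 0"
    define v where "v = f w (\<rho> \<circ> r)"
    define y :: nat where "y = of_bool (cell w k (int v) = 2)"
    have v: "v \<le> tf B" unfolding v_def by (rule boundsD[OF tf(2) a(1)]) (use a in simp)
    have k0: "\<rho> k = 0" using k a(3,4) by (auto simp: less_2_cases_iff)
    have e1: "exec c (tapes_of w \<rho>) (tapes_of w (\<rho>(m := v))) (t B)"
      unfolding v_def by (rule computesD(2)[OF c]) (use a in auto)
    have e2: "exec ?go (tapes_of w (\<rho>(m := v))) (tapes_of w (\<rho>(m + 1 := v, k := v))) (tf B * 6 + 1)"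
      by (rule exec_transfer2) (use r(3) k v a(5) k0 in \<open>auto simp: fun_eq_iff\<close>)
    have e3: "exec ?read (tapes_of w (\<rho>(m + 1 := v, k := v))) (tapes_of w (\<rho>(m := y, m + 1 := v, k := v))) 4"
    proof (cases "cell w k (int v) = 2")
      case True
      have "exec (Inc m) (tapes_of w (\<rho>(m + 1 := v, k := v))) (tapes_of w (\<rho>(m := y, m + 1 := v, k := v))) 3"
        by (rule exec_weaken[OF exec_Inc]) (use True a(5) k r(3) in \<open>auto simp: y_def fun_eq_iff\<close>)
      then show ?thesis by (intro exec_Cond) (auto simp: scan_tapes_of True)
    next
      case False
      have "exec (Seq (Inc m) (Dec m)) (tapes_of w (\<rho>(m + 1 := v, k := v))) (tapes_of w (\<rho>(m := y, m + 1 := v, k := v))) 3"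
        by (rule exec_weaken[OF exec_Seq[OF exec_Inc exec_Dec order_refl]])
          (use False a(5) k r(3) in \<open>auto simp: y_def fun_eq_iff\<close>)
      then show ?thesis by (intro exec_Cond) (auto simp: scan_tapes_of False)
    qed
    have e4: "exec ?back (tapes_of w (\<rho>(m := y, m + 1 := v, k := v))) (tapes_of w (\<rho>(m := y))) (tf B * 4 + 1)"
    proof (rule exec_count[where F = "\<lambda>l. \<rho>(m := y, m + 1 := v - l, k := v - l)" and n = v and b = 3])
      show "exec (Seq (Dec (m + 1)) (Dec k)) (tapes_of w (\<rho>(m := y, m + 1 := v - j, k := v - j)))
        (tapes_of w (\<rho>(m := y, m + 1 := v - Suc j, k := v - Suc j))) 3" if "j < v" for j
        by (rule exec_weaken[OF exec_Seq[OF exec_Dec exec_Dec order_refl]])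
          (use that k r(3) in \<open>auto simp: fun_eq_iff\<close>)
    qed (use r(3) k v k0 a(5) in \<open>auto simp: fun_eq_iff\<close>)
    show "exec ?c (tapes_of w \<rho>) (tapes_of w (\<rho>(m := of_bool (cell w k (int (f w (\<rho> \<circ> r))) = 2)))) (t B + tf B * 10 + 9)"
      using exec_Seq[OF e1 exec_Seq[OF e2 exec_Seq[OF e3 e4 order_refl] order_refl] order_refl]
      by (rule exec_weaken) (simp_all add: y_def v_def)
  qed
qed

lemma dec_bit_x: "ptime f \<Longrightarrow> ptime_dec (\<lambda>w \<rho>. bit_at (fst w) (f w \<rho>))"
  and dec_bit_u: "ptime f \<Longrightarrow> ptime_dec (\<lambda>w \<rho>. bit_at (snd w) (f w \<rho>))"
proof -
  have e: "(cell w 0 (int p) = 2) = bit_at (fst w) p" "(cell w 1 (int p) = 2) = bit_at (snd w) p" for w p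
    by (auto simp: cell_word simp del: One_nat_def) (auto simp: bit_at_def)
  show "ptime f \<Longrightarrow> ptime_dec (\<lambda>w \<rho>. bit_at (fst w) (f w \<rho>))"
    using ptime_look[of f 0] by (simp only: e)
  show "ptime f \<Longrightarrow> ptime_dec (\<lambda>w \<rho>. bit_at (snd w) (f w \<rho>))"
    using ptime_look[of f 1] by (simp only: e)
qed

lemma ptime_len: "ptime (\<lambda>w \<rho>. length (fst w))"
proof (rule ptimeI)
  show "poly_bounded (\<lambda>w \<rho>. length (fst w))" by (rule poly_bounded_len)
  fix r :: "nat \<Rightarrow> nat" and m assume r: "\<And>j. 2 \<le> r j" "\<And>j. r j < m" "2 < m"
  \<comment> \<open>No symbol of the input is the blank \<open>0\<close>, so the walk of head 0 to
    the first blank counts the length.\<close>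
  let ?go = "Loop 0 0 (Seq (Inc 0) (Seq (Inc m) (Inc (m + 1))))"
  let ?back = "Loop (m + 1) 1 (Seq (Dec (m + 1)) (Dec 0))"
  let ?c = "Seq ?go ?back"
  show "\<exists>c t. computes m r (\<lambda>w \<rho>. length (fst w)) c t"
  proof (rule computesI[where c = ?c and t = "\<lambda>B. B * 10 + 3"])
    show "poly_growth (\<lambda>B. B * 10 + 3)" by (intro poly_growth_intros)
    fix w B and \<rho> :: env
    assume a: "size_le w B" "\<forall>j. \<rho> j \<le> B" "\<rho> 0 = 0" "\<rho> 1 = 0" "\<forall>j\<ge>m. \<rho> j = 0"
    define v where "v = length (fst w)"
    have v: "v \<le> B" using a(1) by (simp add: size_le_def v_def)
    let ?F = "\<lambda>l. \<rho>(m := l, m + 1 := l, 0 := l)"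
    have "exec ?go (tapes_of w (?F 0)) (tapes_of w (?F v)) (B * 6 + 1)"
    proof (rule exec_Loop[where F = "\<lambda>l. tapes_of w (?F l)" and n = v and b = 5])
      show "exec (Seq (Inc 0) (Seq (Inc m) (Inc (m + 1)))) (tapes_of w (?F j)) (tapes_of w (?F (Suc j))) 5" for j
        by (rule exec_weaken[OF exec_Seq[OF exec_Inc exec_Seq[OF exec_Inc exec_Inc order_refl] order_refl]])
          (use r(3) in \<open>auto simp: fun_eq_iff\<close>)
    qed (use v in \<open>auto simp: scan_tapes_of cell_word v_def\<close>)
    moreover have "?F 0 = \<rho>" using a by (auto simp: fun_eq_iff)
    ultimately have e1: "exec ?go (tapes_of w \<rho>) (tapes_of w (?F v)) (B * 6 + 1)" by simp
    have e2: "exec ?back (tapes_of w (?F v)) (tapes_of w (\<rho>(m := v))) (B * 4 + 1)"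
    proof (rule exec_count[where F = "\<lambda>l. \<rho>(m := v, m + 1 := v - l, 0 := v - l)" and n = v and b = 3])
      show "exec (Seq (Dec (m + 1)) (Dec 0)) (tapes_of w (\<rho>(m := v, m + 1 := v - j, 0 := v - j)))
        (tapes_of w (\<rho>(m := v, m + 1 := v - Suc j, 0 := v - Suc j))) 3" if "j < v" for j
        by (rule exec_weaken[OF exec_Seq[OF exec_Dec exec_Dec order_refl]])
          (use that r(3) in \<open>auto simp: fun_eq_iff\<close>)
    qed (use r(3) v a in \<open>auto simp: fun_eq_iff\<close>)
    show "exec ?c (tapes_of w \<rho>) (tapes_of w (\<rho>(m := length (fst w)))) (B * 10 + 3)"
      using exec_Seq[OF e1 e2 order_refl] by (rule exec_weaken) (simp_all add: v_def)
  qed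
qed

section \<open>Closure under arithmetic, comparison and bounded quantification\<close>

lemma ptime_cong: "ptime f \<Longrightarrow> (\<And>w \<rho>. f w \<rho> = g w \<rho>) \<Longrightarrow> ptime g"
  by (metis ext)

lemma ptime_const: "ptime (\<lambda>w \<rho>. k)"
  by (induction k) (auto intro: ptime_zero ptime_Suc)

lemma ptime_add:
  assumes "ptime f" "ptime g" shows "ptime (\<lambda>w \<rho>. f w \<rho> + g w \<rho>)"
proof -
  have r: "rec_nat m (\<lambda>l a. Suc a) n = m + n" for m n :: nat by (induction n) auto
  have "ptime (\<lambda>w \<rho>. rec_nat (f w \<rho>) (\<lambda>l a. Suc a) (g w \<rho>))"
    by (rule ptime_rec[OF assms(2,1) _ poly_bounded_add[OF assms[THEN ptime_poly_bounded]]]) (auto simp: r intro: ptime_Suc ptime_var)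
  then show ?thesis by (simp only: r)
qed

lemma ptime_mult:
  assumes "ptime f" "ptime g" shows "ptime (\<lambda>w \<rho>. f w \<rho> * g w \<rho>)"
proof -
  have r: "rec_nat 0 (\<lambda>l a. a + m) n = m * n" for m n :: nat by (induction n) auto
  have "ptime (\<lambda>w \<rho>. rec_nat 0 (\<lambda>l a. a + f w \<rho>) (g w \<rho>))"
    by (rule ptime_rec[OF assms(2) ptime_zero _ poly_bounded_mult[OF assms[THEN ptime_poly_bounded]]])
      (simp_all only: r order_refl ptime_add[OF ptime_var ptime_subst[OF assms(1)]] mult_le_mono2)
  then show ?thesis by (simp only: r)
qed

text \<open>A conditional is a recursion with at most one round whose step ignores the
  accumulator.\<close>

lemma ptime_if:
  assumes P: "ptime_dec P" and f: "ptime f" and g: "ptime g"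
  shows "ptime (\<lambda>w \<rho>. if P w \<rho> then f w \<rho> else g w \<rho>)"
proof -
  have r: "rec_nat n (\<lambda>l a. m) (of_bool b) = (if b then m else n)" for m n :: nat and b by simp
  have "ptime (\<lambda>w \<rho>. rec_nat (g w \<rho>) (\<lambda>l a. f w \<rho>) (of_bool (P w \<rho>)))"
  proof (rule ptime_rec[OF P g])
    show "ptime (\<lambda>w \<rho>. f w (\<lambda>j. \<rho> (Suc (Suc j))))" by (rule ptime_subst[OF f])
    show "poly_bounded (\<lambda>w \<rho>. f w \<rho> + g w \<rho>)" by (intro poly_bounded_add ptime_poly_bounded f g)
    show "rec_nat (g w \<rho>) (\<lambda>l a. f w \<rho>) l \<le> f w \<rho> + g w \<rho>" for w \<rho> l by (cases l) auto
  qed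
  then show ?thesis by (simp only: r)
qed

text \<open>The last of \<open>n\<close> rounds has the index \<open>n - 1\<close>, so a step that
  returns its index computes the predecessor.\<close>

lemma ptime_pred: assumes f: "ptime f" shows "ptime (\<lambda>w \<rho>. f w \<rho> - 1)"
proof -
  have r: "rec_nat 0 (\<lambda>l a. l) n = n - 1" for n :: nat by (cases n) auto
  have "ptime (\<lambda>w \<rho>. rec_nat 0 (\<lambda>l a. l) (f w \<rho>))"
    by (rule ptime_rec[OF f ptime_zero _ ptime_poly_bounded[OF f]]) (auto simp: r intro: ptime_var)
  then show ?thesis by (simp only: r)
qed

lemma ptime_diff:
  assumes "ptime f" "ptime g" shows "ptime (\<lambda>w \<rho>. f w \<rho> - g w \<rho>)"
proof -
  have r: "rec_nat m (\<lambda>l a. a - 1) n = m - n" for m n :: nat by (induction n) auto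
  have "ptime (\<lambda>w \<rho>. rec_nat (f w \<rho>) (\<lambda>l a. a - 1) (g w \<rho>))"
  proof (rule ptime_rec[OF assms(2,1) _ ptime_poly_bounded[OF assms(1)]])
    show "ptime (\<lambda>w \<rho>. \<rho> 0 - 1)" by (intro ptime_pred ptime_var)
  qed (simp only: r diff_le_self)
  then show ?thesis by (simp only: r)
qed

lemma dec_less:
  assumes "ptime f" "ptime g" shows "ptime_dec (\<lambda>w \<rho>. f w \<rho> < g w \<rho>)"
proof -
  have r: "rec_nat 0 (\<lambda>l a. 1) (n - m) = of_bool (m < n)" for m n :: nat
    by (cases "n - m") auto
  have "ptime (\<lambda>w \<rho>. rec_nat 0 (\<lambda>l a. 1) (g w \<rho> - f w \<rho>))"
  proof (rule ptime_rec[OF ptime_diff[OF assms(2,1)] ptime_zero ptime_const poly_bounded_const])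
    show "rec_nat 0 (\<lambda>l a. 1) l \<le> (1 :: nat)" for l by (cases l) auto
  qed
  then show ?thesis by (simp only: r)
qed

lemma dec_not: assumes "ptime_dec P" shows "ptime_dec (\<lambda>w \<rho>. \<not> P w \<rho>)"
  by (rule ptime_cong[OF ptime_diff[OF ptime_const[of 1] assms]]) simp

lemma dec_conj: assumes "ptime_dec P" "ptime_dec Q" shows "ptime_dec (\<lambda>w \<rho>. P w \<rho> \<and> Q w \<rho>)"
  by (rule ptime_cong[OF ptime_mult[OF assms]]) simp

lemma dec_imp: assumes "ptime_dec P" "ptime_dec Q" shows "ptime_dec (\<lambda>w \<rho>. P w \<rho> \<longrightarrow> Q w \<rho>)"
  by (rule ptime_cong[OF dec_not[OF dec_conj[OF assms(1) dec_not[OF assms(2)]]]]) simp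

lemma dec_disj: assumes "ptime_dec P" "ptime_dec Q" shows "ptime_dec (\<lambda>w \<rho>. P w \<rho> \<or> Q w \<rho>)"
  by (rule ptime_cong[OF dec_imp[OF dec_not[OF assms(1)] assms(2)]]) auto

lemma dec_le: assumes "ptime f" "ptime g" shows "ptime_dec (\<lambda>w \<rho>. f w \<rho> \<le> g w \<rho>)"
  by (rule ptime_cong[OF dec_not[OF dec_less[OF assms(2,1)]]]) (simp add: not_less)

lemma dec_eq: assumes "ptime f" "ptime g" shows "ptime_dec (\<lambda>w \<rho>. f w \<rho> = g w \<rho>)"
  by (rule ptime_cong[OF dec_conj[OF dec_le[OF assms] dec_le[OF assms(2,1)]]]) (simp add: eq_iff)

lemma dec_ex:
  assumes n: "ptime n" and P: "ptime_dec (\<lambda>w \<rho>. P w (\<lambda>j. \<rho> (Suc j)) (\<rho> 0))"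
  shows "ptime_dec (\<lambda>w \<rho>. \<exists>i<n w \<rho>. P w \<rho> i)"
proof -
  have r: "rec_nat 0 (\<lambda>l a. if Q l then 1 else a) m = (of_bool (\<exists>i<m. Q i) :: nat)" for Q m
    by (induction m) (auto simp: less_Suc_eq)
  have "ptime (\<lambda>w \<rho>. rec_nat 0 (\<lambda>l a. if P w \<rho> l then 1 else a) (n w \<rho>))"
  proof (rule ptime_rec[OF n ptime_zero])
    show "ptime (\<lambda>w \<rho>. if P w (\<lambda>j. \<rho> (Suc (Suc j))) (\<rho> 1) then 1 else \<rho> 0)"
      \<comment> \<open>The bound variable of \<open>P\<close> becomes the loop index, variable 1;
        the accumulator, variable 0, is skipped.\<close>
      using ptime_subst[OF P, of "case_nat 1 (\<lambda>j. Suc (Suc j))"]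
      by (intro ptime_if ptime_const ptime_var) simp
  qed (rule poly_bounded_const[of 1], simp add: r)
  then show ?thesis by (simp only: r)
qed

lemma dec_all:
  assumes n: "ptime n" and P: "ptime_dec (\<lambda>w \<rho>. P w (\<lambda>j. \<rho> (Suc j)) (\<rho> 0))"
  shows "ptime_dec (\<lambda>w \<rho>. \<forall>i<n w \<rho>. P w \<rho> i)"
  by (rule ptime_cong[OF dec_not[OF dec_ex[where P = "\<lambda>w \<rho> i. \<not> P w \<rho> i", OF n dec_not[OF P]]]]) simp

lemma ptime_min: assumes "ptime f" "ptime g" shows "ptime (\<lambda>w \<rho>. min (f w \<rho>) (g w \<rho>))"
  by (rule ptime_cong[OF ptime_if[OF dec_le[OF assms] assms]]) auto

text \<open>The accumulator rises by one per round while \<open>2 * Suc a <= n\<close> and thus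
  stops at \<open>n div 2\<close>; \<open>n\<close> rounds are enough.\<close>

lemma ptime_div2: assumes f: "ptime f" shows "ptime (\<lambda>w \<rho>. f w \<rho> div 2)"
proof -
  have r: "rec_nat 0 (\<lambda>l a. if 2 * Suc a \<le> n then Suc a else a) m = min m (n div 2)" for n m :: nat
    by (induction m) (auto simp: min_def)
  have "ptime (\<lambda>w \<rho>. rec_nat 0 (\<lambda>l a. if 2 * Suc a \<le> f w \<rho> then Suc a else a) (f w \<rho>))"
  proof (rule ptime_rec[OF f ptime_zero _ ptime_poly_bounded[OF f]])
    show "ptime (\<lambda>w \<rho>. if 2 * Suc (\<rho> 0) \<le> f w (\<lambda>j. \<rho> (Suc (Suc j))) then Suc (\<rho> 0) else \<rho> 0)"
      by (intro ptime_if dec_le ptime_mult ptime_const ptime_Suc ptime_var ptime_subst[OF f])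
    show "l \<le> f w \<rho> \<Longrightarrow> rec_nat 0 (\<lambda>l a. if 2 * Suc a \<le> f w \<rho> then Suc a else a) l \<le> f w \<rho>" for w \<rho> l
      unfolding r by simp
  qed
  then show ?thesis unfolding r by (rule ptime_cong) simp
qed

text \<open>The carry compares two binary numbers whose digits are bounded but may exceed \<open>1\<close>.\<close>

lemma carry_eq:
  fixes d :: "nat \<Rightarrow> nat"
  shows "rec_nat c (\<lambda>l a. (a + d l) div 2) n = (c + (\<Sum>l<n. d l * 2 ^ l)) div 2 ^ n"
proof (induction n)
  case (Suc n)
  have "((c + (\<Sum>l<n. d l * 2 ^ l)) div 2 ^ n + d n) = (c + (\<Sum>l<Suc n. d l * 2 ^ l)) div 2 ^ n"
    by (simp add: add.assoc[symmetric])
  then show ?case using Suc by (simp only: old.nat.simps power_Suc2 div_mult2_eq)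
qed simp

text \<open>Subtracting a digit as \<open>K - Q l\<close> avoids negative numbers. The offsets
  \<open>K\<close> at all places and the initial carry \<open>K\<close> add up to
  \<open>K * 2 ^ n\<close>, so the final carry reaches \<open>K\<close> exactly if the
  \<open>P\<close> sum is at least the \<open>Q\<close> sum.\<close>

lemma carry_le_iff:
  fixes P Q :: "nat \<Rightarrow> nat"
  assumes Q: "\<And>l. Q l \<le> K"
  shows "K \<le> rec_nat K (\<lambda>l a. (a + (P l + (K - Q l))) div 2) n \<longleftrightarrow>
    (\<Sum>l<n. Q l * 2 ^ l) \<le> (\<Sum>l<n. P l * 2 ^ l)"
proof -
  have "(\<Sum>l<n. (K - Q l) * 2 ^ l) + (\<Sum>l<n. Q l * 2 ^ l) = (\<Sum>l<n. K * 2 ^ l)"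
    unfolding sum.distrib[symmetric] using Q by (intro sum.cong) (auto simp: add_mult_distrib[symmetric])
  also have "\<dots> + K = K * 2 ^ n" by (induction n) auto
  finally have e: "(\<Sum>l<n. (K - Q l) * 2 ^ l) + (\<Sum>l<n. Q l * 2 ^ l) + K = K * 2 ^ n" by simp
  have "(\<Sum>l<n. (P l + (K - Q l)) * 2 ^ l) = (\<Sum>l<n. P l * 2 ^ l) + (\<Sum>l<n. (K - Q l) * 2 ^ l)"
    by (simp add: add_mult_distrib sum.distrib)
  then have "K * 2 ^ n \<le> K + (\<Sum>l<n. (P l + (K - Q l)) * 2 ^ l) \<longleftrightarrow>
      (\<Sum>l<n. Q l * 2 ^ l) \<le> (\<Sum>l<n. P l * 2 ^ l)"
    using e by linarith
  moreover have "K \<le> x div 2 ^ n \<longleftrightarrow> K * 2 ^ n \<le> x" for x :: nat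
    by (simp add: less_eq_div_iff_mult_less_eq)
  ultimately show ?thesis by (simp only: carry_eq)
qed

lemma dec_sum_le:
  assumes n: "ptime n" and P: "ptime (\<lambda>w \<rho>. P w (\<lambda>j. \<rho> (Suc j)) (\<rho> 0))"
    and Q: "ptime (\<lambda>w \<rho>. Q w (\<lambda>j. \<rho> (Suc j)) (\<rho> 0))"
    and le: "\<And>w \<rho> l. P w \<rho> l \<le> K" "\<And>w \<rho> l. Q w \<rho> l \<le> K"
  shows "ptime_dec (\<lambda>w \<rho>. (\<Sum>l<n w \<rho>. Q w \<rho> l * 2 ^ l) \<le> (\<Sum>l<n w \<rho>. P w \<rho> l * 2 ^ l))"
proof -
  have "ptime (\<lambda>w \<rho>. rec_nat K (\<lambda>l a. (a + (P w \<rho> l + (K - Q w \<rho> l))) div 2) (n w \<rho>))"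
  proof (rule ptime_rec[OF n ptime_const _ poly_bounded_const[of "2 * K"]])
    show "ptime (\<lambda>w \<rho>. (\<rho> 0 + (P w (\<lambda>j. \<rho> (Suc (Suc j))) (\<rho> 1) + (K - Q w (\<lambda>j. \<rho> (Suc (Suc j))) (\<rho> 1)))) div 2)"
      using ptime_subst[OF P, of "case_nat 1 (\<lambda>j. Suc (Suc j))"]
        ptime_subst[OF Q, of "case_nat 1 (\<lambda>j. Suc (Suc j))"]
      by (intro ptime_div2 ptime_add ptime_diff ptime_const ptime_var) (simp only: nat.case One_nat_def)+
    \<comment> \<open>A place adds at most \<open>2 * K\<close> to a carry of at most
      \<open>2 * K\<close>, and halving restores the bound.\<close>
    show "rec_nat K (\<lambda>l a. (a + (P w \<rho> l + (K - Q w \<rho> l))) div 2) l \<le> 2 * K" for w \<rho> l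
    proof (induction l)
      case (Suc l)
      then show ?case using le(1)[of w \<rho> l] by simp
    qed simp
  qed
  from dec_le[OF ptime_const[of K] this] show ?thesis
    using carry_le_iff[OF le(2)] by simp
qed

lemmas ptime_intros = ptime_const ptime_Suc ptime_var ptime_add ptime_mult ptime_if ptime_diff ptime_min ptime_len
  dec_less dec_le dec_eq dec_not dec_conj dec_disj dec_imp dec_ex dec_all dec_bit_x dec_bit_u

section \<open>From decision procedures to machines and to NP\<close>

fun marks :: "nat \<Rightarrow> cmd \<Rightarrow> cmd" where
  "marks 0 c = c"
| "marks (Suc k) c = Seq (Mark (k + 2)) (marks k c)"

lemma width_marks: "width (marks k c) \<le> max (k + 2) (width c)"
  by (induction k) auto

lemma exec_Mark: "exec (Mark i) T (T(i := act (1, Stay) (T i))) 1"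
  unfolding exec_def by (intro exI[of _ 1]) (auto simp: run_step_def)

text \<open>Blank tapes carry no origin. Once the cells under the heads are marked, the tapes
  \<open>2\<close> to \<open>k + 1\<close> can act as registers.\<close>

lemma exec_marks:
  "exec c (\<lambda>i. if i \<in> {2..<k + 2} then act (1, Stay) (T i) else T i) T' b \<Longrightarrow> exec (marks k c) T T' (b + 2 * k)"
proof (induction k arbitrary: T)
  case (Suc k)
  let ?T = "T(k + 2 := act (1, Stay) (T (k + 2)))"
  have "(\<lambda>i. if i \<in> {2..<k + 2} then act (1, Stay) (?T i) else ?T i)
    = (\<lambda>i. if i \<in> {2..<Suc k + 2} then act (1, Stay) (T i) else T i)" by (auto simp: fun_eq_iff)
  with Suc.prems have "exec (marks k c) ?T T' (b + 2 * k)" by (intro Suc.IH) simp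
  from exec_Seq[OF exec_Mark this order_refl] show ?case by (simp add: add.commute)
qed simp

theorem tm_of_dec:
  assumes V: "ptime_dec (\<lambda>w \<rho>. V (fst w) (snd w))"
  shows "\<exists>M. polytime_tm M \<and> (\<forall>x u. accepts M x u \<longleftrightarrow> V x u)"
proof -
  \<comment> \<open>The verdict depends on no variables, so all of them may share register 2; the
    result goes to register 3, hence the four tapes in \<open>k\<close>.\<close>
  have "\<exists>c t. computes 3 (\<lambda>_. 2) (\<lambda>w \<rho>. of_bool (V (fst w) (snd w))) c t"
    by (rule ptimeE[where r = "\<lambda>_. 2", OF V]) auto
  then obtain c t where ct: "computes 3 (\<lambda>_. 2) (\<lambda>w \<rho>. of_bool (V (fst w) (snd w))) c t" by blast
  define k where "k = max 4 (width c)"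
  define c1 where "c1 = marks (k - 2) c"
  \<comment> \<open>The head of tape 3 sees the mark exactly if the result is 0, that is, on
    rejection.\<close>
  let ?test = "Cond 3 1 (Halt False) (Halt True)"
  have "poly_growth (\<lambda>B. t B + 2 * k + 2)" by (intro poly_growth_intros computesD(1)[OF ct])
  then obtain d where d: "\<And>B. t B + 2 * k + 2 \<le> (B + 2) ^ d" by (auto simp: poly_growth_def)
  define p where "p = [:2, 1 :: nat:] ^ d"
  have p: "poly p B = (B + 2) ^ d" for B by (simp add: p_def poly_power add.commute)
  show ?thesis
  proof (rule tm_of_cmd)
    show "Seq c1 ?test = Seq c1 ?test" by simp
    show "width (Seq c1 ?test) \<le> k"
      using width_marks[of "k - 2" c] by (auto simp: c1_def k_def)
    show "2 \<le> k" by (simp add: k_def)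
    fix x u :: "bool list"
    let ?w = "(x, u)" and ?B = "length x + length u"
    define T where "T = tapes_of ?w ((\<lambda>_. 0)(3 := of_bool (V x u)))"
    have "exec c (tapes_of ?w (\<lambda>_. 0)) T (t ?B)"
      using computesD(2)[OF ct, of ?w ?B "\<lambda>_. 0"] by (simp add: size_le_def T_def)
    moreover have "tapes_of ?w (\<lambda>_. 0) = (\<lambda>i. if i \<in> {2..<(k - 2) + 2} then act (1, Stay) (start_tapes k x u i) else start_tapes k x u i)"
      by (auto simp: tapes_of_def start_tapes_def cell_def word_tape_def act_def k_def fun_eq_iff)
    ultimately have "exec c1 (start_tapes k x u) T (t ?B + 2 * (k - 2))"
      unfolding c1_def by (intro exec_marks) simp
    then obtain n where n: "n \<le> t ?B + 2 * (k - 2)"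
      "\<And>K. (run_step ^^ n) (c1 # K, start_tapes k x u) = (K, T)" by (auto simp: exec_def)
    have "(run_step ^^ 1) ([?test], T) = ([Halt (V x u)], T)"
      by (auto simp: run_step_def T_def scan_tapes_of cell_def)
    from run_Suc[OF _ run_trans[OF n(2) this]]
    have "(run_step ^^ Suc (1 + n)) ([Seq c1 ?test], start_tapes k x u) = ([Halt (V x u)], T)"
      by (simp add: run_step_def)
    moreover have "Suc (1 + n) \<le> poly p ?B" using n(1) d[of ?B] by (simp add: p)
    ultimately show "\<exists>t\<le>poly p ?B. \<exists>T. (run_step ^^ t) ([Seq c1 ?test], start_tapes k x u) = ([Halt (V x u)], T)"
      by blast
  qed
qed

theorem NP_I:
  fixes p :: "nat poly"
  assumes "ptime_dec (\<lambda>w \<rho>. V (fst w) (snd w))"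
    and "\<And>x. x \<in> L \<longleftrightarrow> (\<exists>u. length u \<le> poly p (length x) \<and> V x u)"
  shows "L \<in> NP"
proof -
  obtain M where "polytime_tm M" "\<And>x u. accepts M x u \<longleftrightarrow> V x u"
    using tm_of_dec[OF assms(1)] by blast
  then show ?thesis unfolding NP_def using assms(2) by (intro CollectI exI[of _ M] conjI exI[of _ p]) auto
qed

section \<open>Distances in metric graphs\<close>

lemma connected_graphD:
  assumes "connected_graph V E" "{u, v} \<in> E"
  shows "u \<in> V" "v \<in> V" "u \<noteq> v"
proof -
  have "{u, v} \<subseteq> V" "card {u, v} = 2" using assms by (auto simp: connected_graph_def)
  then show "u \<in> V" "v \<in> V" "u \<noteq> v" by auto
qed

lemma edge_point_1: "u \<noteq> v \<Longrightarrow> edge_point u v 1 = vertex_point v"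
  by (auto simp: edge_point_def vertex_point_def)

lemma edge_point_apply: "u \<noteq> v \<Longrightarrow> edge_point u v t v = t" "edge_point u v t u = 1 - t"
  by (auto simp: edge_point_def)

lemma route_trans: "route E q r l' \<Longrightarrow> route E p q l \<Longrightarrow> route E p r (l + l')"
proof (induction rule: route.induct)
  case (route_step q u v s l' t)
  have "route E p (edge_point u v t) (l + l' + \<bar>s - t\<bar>)"
    by (rule route.route_step) (use route_step in auto)
  then show ?case by (simp add: add.assoc)
qed simp

lemma route_edge:
  "{u, v} \<in> E \<Longrightarrow> 0 \<le> s \<Longrightarrow> s \<le> 1 \<Longrightarrow> 0 \<le> t \<Longrightarrow> t \<le> 1 \<Longrightarrow>
    route E (edge_point u v s) (edge_point u v t) \<bar>s - t\<bar>"
  using route_step[OF route_refl, of u v E s t] by simp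

section \<open>Combinatorial distance and upper bounds on distances\<close>

definition adj :: "'a set set \<Rightarrow> ('a \<times> 'a) set" where
  "adj E = {(x, y). {x, y} \<in> E}"

definition gdist :: "'a set set \<Rightarrow> 'a \<Rightarrow> 'a \<Rightarrow> nat" where
  "gdist E u v = (LEAST n. (u, v) \<in> adj E ^^ n)"

lemma gdist_le: "(u, v) \<in> adj E ^^ n \<Longrightarrow> gdist E u v \<le> n"
  unfolding gdist_def by (rule Least_le)

lemma gdist_refl: "gdist E u u = 0"
  using gdist_le[of u u 0 E] by simp

lemma gdist_relpow:
  assumes "connected_graph V E" "u \<in> V" "v \<in> V"
  shows "(u, v) \<in> adj E ^^ gdist E u v"
proof -
  have "(u, v) \<in> (adj E)\<^sup>*" using assms by (auto simp: connected_graph_def adj_def)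
  then obtain n where "(u, v) \<in> adj E ^^ n" using rtrancl_imp_relpow by blast
  then show ?thesis unfolding gdist_def by (rule LeastI)
qed

lemma gdist_step:
  assumes "connected_graph V E" "u \<in> V" "{v, w} \<in> E"
  shows "gdist E u w \<le> Suc (gdist E u v)"
proof -
  have "(u, v) \<in> adj E ^^ gdist E u v"
    by (rule gdist_relpow[OF assms(1,2) connected_graphD(1)[OF assms(1,3)]])
  moreover have "(v, w) \<in> adj E" using assms by (simp add: adj_def)
  ultimately have "(u, w) \<in> adj E ^^ Suc (gdist E u v)" by auto
  then show ?thesis by (rule gdist_le)
qed

text \<open>A shortest walk is no longer than the number of adjacent pairs. The bound is crude, but
  only its bit length will matter.\<close>

lemma gdist_bound:
  assumes G: "connected_graph V E" and "u \<in> V" "v \<in> V"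
  shows "gdist E u v \<le> card V * card V"
proof -
  have sub: "adj E \<subseteq> V \<times> V" using connected_graphD[OF G] by (auto simp: adj_def)
  have fin: "finite V" using G by (simp add: connected_graph_def)
  have "finite (adj E)" by (rule finite_subset[OF sub]) (simp add: fin)
  moreover have "(u, v) \<in> (adj E)\<^sup>*" using assms by (auto simp: connected_graph_def adj_def)
  ultimately obtain n where n: "n \<le> card (adj E)" "(u, v) \<in> adj E ^^ n"
    by (auto simp: rtrancl_finite_eq_relpow)
  have "card (adj E) \<le> card (V \<times> V)" by (rule card_mono[OF _ sub]) (simp add: fin)
  then show ?thesis using n gdist_le[OF n(2)] by (simp add: card_cartesian_product)
qed

lemma route_relpow:
  assumes "connected_graph V E"
  shows "(u, v) \<in> adj E ^^ n \<Longrightarrow> route E (vertex_point u) (vertex_point v) (real n)"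
proof (induction n arbitrary: v)
  case (Suc n)
  then obtain w where w: "(u, w) \<in> adj E ^^ n" "{w, v} \<in> E" by (auto simp: adj_def)
  have "w \<noteq> v" using connected_graphD[OF assms w(2)] by simp
  then have "route E (vertex_point w) (vertex_point v) 1"
    using route_edge[OF w(2), of 0 1] by (simp add: edge_point_0 edge_point_1)
  from route_trans[OF this Suc.IH[OF w(1)]] show ?case by (simp add: add.commute)
qed (simp add: route_refl)

lemma route_edge_points:
  assumes G: "connected_graph V E" and e: "{u, v} \<in> E" "0 \<le> s" "s \<le> 1"
    and f: "{w, z} \<in> E" "0 \<le> t" "t \<le> 1"
  shows "route E (edge_point u v s) (edge_point w z t) (s + gdist E u w + t)"
proof -
  note uv = connected_graphD[OF G e(1)] and wz = connected_graphD[OF G f(1)]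
  have 1: "route E (edge_point u v s) (vertex_point u) s"
    using route_edge[OF e(1), of s 0] e uv by (simp add: edge_point_0)
  have 2: "route E (vertex_point u) (vertex_point w) (gdist E u w)"
    by (rule route_relpow[OF G gdist_relpow[OF G]]) (use uv wz in auto)
  have 3: "route E (vertex_point w) (edge_point w z t) t"
    using route_edge[OF f(1), of 0 t] f wz by (simp add: edge_point_0)
  from route_trans[OF 3 route_trans[OF 2 1]] show ?thesis .
qed

section \<open>Lower bounds on distances by 1-Lipschitz functions\<close>

lemma lipschitz_route:
  assumes L: "\<And>u v s t. {u, v} \<in> E \<Longrightarrow> 0 \<le> s \<Longrightarrow> s \<le> 1 \<Longrightarrow> 0 \<le> t \<Longrightarrow> t \<le> 1 \<Longrightarrow>
      \<Phi> (edge_point u v t) \<le> \<Phi> (edge_point u v s) + \<bar>s - t\<bar>"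
  shows "route E p q l \<Longrightarrow> \<Phi> q \<le> \<Phi> p + l"
proof (induction rule: route.induct)
  case (route_step p u v s l t)
  then show ?case using L[of u v s t] by linarith
qed simp

text \<open>A function on the points that does not depend on the chosen edge representation: it is
  prescribed by \<open>g\<close> along one edge, and elsewhere it is the largest 1-Lipschitz
  extension of the vertex potential \<open>\<psi>\<close>.\<close>

definition potential :: "'a \<Rightarrow> 'a \<Rightarrow> (real \<Rightarrow> real) \<Rightarrow> ('a \<Rightarrow> real) \<Rightarrow> 'a point \<Rightarrow> real" where
  "potential u v g \<psi> q = (if \<exists>t. 0 \<le> t \<and> t \<le> 1 \<and> q = edge_point u v t then g (q v)
     else Min ((\<lambda>w. \<psi> w + 1 - q w) ` {w. q w \<noteq> 0}))"

lemma potential_same: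
  "u \<noteq> v \<Longrightarrow> 0 \<le> t \<Longrightarrow> t \<le> 1 \<Longrightarrow> potential u v g \<psi> (edge_point u v t) = g t"
  unfolding potential_def by (auto simp: edge_point_apply)

text \<open>An interior point knows its edge by its support. At a vertex, the bounds on
  \<open>\<psi>\<close> make the minimum equal to the potential there, and \<open>g\<close> agrees
  with \<open>\<psi>\<close> at \<open>u\<close> and \<open>v\<close>, so the edges meeting in a
  vertex assign it the same value.\<close>

lemma potential_other:
  assumes "u \<noteq> v" "a \<noteq> b" "{a, b} \<noteq> {u, v}" and t: "0 \<le> t" "t \<le> 1"
    and g: "g 0 = \<psi> u" "g 1 = \<psi> v" and \<psi>: "\<psi> a \<le> \<psi> b + 1" "\<psi> b \<le> \<psi> a + 1"
  shows "potential u v g \<psi> (edge_point a b t) = min (\<psi> a + t) (\<psi> b + 1 - t)"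
proof (cases "0 < t \<and> t < 1")
  case True
  have sup: "{w. edge_point a b t w \<noteq> 0} = {a, b}"
    using True assms(2) by (auto simp: edge_point_def)
  have no: "edge_point a b t \<noteq> edge_point u v t'" for t'
  proof
    assume e: "edge_point a b t = edge_point u v t'"
    have "{a, b} \<subseteq> {u, v}" using sup unfolding e by (auto simp: edge_point_def split: if_splits)
    then show False using assms(1-3) by auto
  qed
  have "edge_point a b t a = 1 - t" "edge_point a b t b = t"
    using assms(2) by (auto simp: edge_point_def)
  then show ?thesis unfolding potential_def using no sup by (simp add: min.commute)
next
  case False
  then consider "t = 0" | "t = 1" using t by linarith
  then obtain c where c: "edge_point a b t = vertex_point c" "min (\<psi> a + t) (\<psi> b + 1 - t) = \<psi> c"
    using assms(2) \<psi> by cases (auto simp: edge_point_0 edge_point_1 min_def)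
  show ?thesis
  proof (cases "c \<in> {u, v}")
    case True
    have "vertex_point c = edge_point u v (if c = u then 0 else 1)"
      using True assms(1) by (auto simp: edge_point_0 edge_point_1)
    then show ?thesis unfolding c using True assms(1) potential_same[OF assms(1), of _ g \<psi>] g
      by (auto split: if_splits)
  next
    case False
    have no: "vertex_point c \<noteq> edge_point u v t'" for t'
    proof
      assume "vertex_point c = edge_point u v t'"
      from fun_cong[OF this, of c] show False using False by (auto simp: vertex_point_def edge_point_def)
    qed
    moreover have "{w. vertex_point c w \<noteq> 0} = {c}" by (auto simp: vertex_point_def)
    ultimately show ?thesis unfolding c potential_def by (simp add: vertex_point_def)
  qed
qed

text \<open>The function \<open>potential\<close> is 1-Lipschitz along every edge and equals
  \<open>g s\<close> at the first point, so no route is shorter than the difference of values. That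
  some route exists makes the infimum meaningful.\<close>

lemma point_dist_potential:
  assumes G: "connected_graph V E" and e: "{u, v} \<in> E" "0 \<le> s" "s \<le> 1"
    and f: "{w, z} \<in> E" "0 \<le> t" "t \<le> 1"
    and gL: "\<And>s t. 0 \<le> s \<Longrightarrow> s \<le> 1 \<Longrightarrow> 0 \<le> t \<Longrightarrow> t \<le> 1 \<Longrightarrow> g t \<le> g s + \<bar>s - t\<bar>"
    and g: "g 0 = \<psi> u" "g 1 = \<psi> v"
    and \<psi>: "\<And>a b. {a, b} \<in> E \<Longrightarrow> {a, b} \<noteq> {u, v} \<Longrightarrow> \<psi> a \<le> \<psi> b + 1"
  shows "potential u v g \<psi> (edge_point w z t) - g s \<le> point_dist E (edge_point u v s) (edge_point w z t)"
proof -
  have uv: "u \<noteq> v" using connected_graphD[OF G e(1)] by simp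
  have other: "potential u v g \<psi> (edge_point a b t) = min (\<psi> a + t) (\<psi> b + 1 - t)"
    if "{a, b} \<in> E" "{a, b} \<noteq> {u, v}" "0 \<le> t" "t \<le> 1" for a b t
    using that connected_graphD[OF G that(1)] \<psi>[of a b] \<psi>[of b a]
    by (intro potential_other uv g) (auto simp: insert_commute)
  have L: "potential u v g \<psi> (edge_point a b t) \<le> potential u v g \<psi> (edge_point a b s) + \<bar>s - t\<bar>"
    if ab: "{a, b} \<in> E" and st: "0 \<le> s" "s \<le> 1" "0 \<le> t" "t \<le> 1" for a b s t
  proof (cases "{a, b} = {u, v}")
    case True
    then consider "a = u" "b = v" | "a = v" "b = u" by (auto simp: doubleton_eq_iff)
    then show ?thesis
    proof cases
      case 1
      then show ?thesis using potential_same[OF uv] gL[OF st] st by simp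
    next
      case 2
      then show ?thesis using potential_same[OF uv, of "1 - s" g \<psi>] potential_same[OF uv, of "1 - t" g \<psi>]
          gL[of "1 - s" "1 - t"] st uv by (simp add: edge_point_swap[of v u])
    qed
  next
    case False
    show ?thesis unfolding other[OF ab False st(1,2)] other[OF ab False st(3,4)] by linarith
  qed
  have "potential u v g \<psi> (edge_point w z t) - g s \<le> l"
    if "route E (edge_point u v s) (edge_point w z t) l" for l
    using lipschitz_route[of E "potential u v g \<psi>", OF L that] potential_same[OF uv e(2,3), of g \<psi>] by simp
  moreover have "\<exists>l. route E (edge_point u v s) (edge_point w z t) l"
    using route_edge_points[OF G e f] by blast
  ultimately show ?thesis unfolding point_dist_def by (intro cInf_greatest) auto
qed

lemma point_dist_same_edge:
  assumes G: "connected_graph V E" and e: "{u, v} \<in> E" "0 \<le> s" "s \<le> 1" "0 \<le> t" "t \<le> 1"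
  shows "\<bar>s - t\<bar> \<le> point_dist E (edge_point u v s) (edge_point u v t)"
proof -
  \<comment> \<open>At \<open>u\<close> and \<open>v\<close> the values are forced by
    \<open>\<bar>s - t\<bar>\<close>. The constant \<open>1 / 2\<close> elsewhere is within 1 of
    both, so a detour never pays.\<close>
  define \<psi> where "\<psi> w = (if w = u then s else if w = v then 1 - s else 1 / 2)" for w
  have uv: "u \<noteq> v" using connected_graphD[OF G e(1)] by simp
  have "potential u v (\<lambda>t. \<bar>s - t\<bar>) \<psi> (edge_point u v t) - \<bar>s - s\<bar>
      \<le> point_dist E (edge_point u v s) (edge_point u v t)"
    by (rule point_dist_potential[OF G e(1-3) e(1,4,5)]) (use e uv in \<open>auto simp: \<psi>_def\<close>)
  then show ?thesis using potential_same[OF uv e(4,5)] by simp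
qed

lemma point_dist_other_edge:
  assumes G: "connected_graph V E" and e: "{u, v} \<in> E" "0 \<le> s" "s \<le> 1"
    and f: "{w, z} \<in> E" "0 \<le> t" "t \<le> 1" and ne: "{w, z} \<noteq> {u, v}"
    and \<psi>: "\<And>a b. {a, b} \<in> E \<Longrightarrow> \<psi> a \<le> \<psi> b + 1" "\<And>a. 0 \<le> \<psi> a" "\<psi> u \<le> s" "\<psi> v \<le> 1 - s"
  shows "min (\<psi> w + t) (\<psi> z + 1 - t) \<le> point_dist E (edge_point u v s) (edge_point w z t)"
proof -
  have uv: "u \<noteq> v" using connected_graphD[OF G e(1)] by simp
  have swap: "\<psi> a \<le> \<psi> b + 1" if "{b, a} \<in> E" for a b using \<psi>(1)[of a b] that by (simp add: insert_commute)
  \<comment> \<open>The distance from \<open>s\<close> is capped by the slopes issuing from the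
    ends: this pulls the end values down to exactly \<open>\<psi> u\<close> and
    \<open>\<psi> v\<close>, while \<open>g s = 0\<close> survives as \<open>\<psi>\<close> is
    nonnegative.\<close>
  define g where "g t = min \<bar>s - t\<bar> (min (\<psi> u + t) (\<psi> v + 1 - t))" for t
  have "potential u v g \<psi> (edge_point w z t) - g s \<le> point_dist E (edge_point u v s) (edge_point w z t)"
  proof (rule point_dist_potential[OF G e f])
    show "g t \<le> g s + \<bar>s - t\<bar>" for s t unfolding g_def by linarith
    show "g 0 = \<psi> u" unfolding g_def using e \<psi>(3) \<psi>(1)[OF e(1)] by auto
    show "g 1 = \<psi> v" unfolding g_def using e \<psi>(4) swap[OF e(1)] by auto
  qed (use \<psi>(1) in auto)
  moreover have "g s = 0" unfolding g_def using \<psi>(2)[of u] \<psi>(2)[of v] e by auto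
  moreover have "potential u v g \<psi> (edge_point w z t) = min (\<psi> w + t) (\<psi> z + 1 - t)"
  proof (rule potential_other[OF uv _ ne f(2,3)])
    show "g 0 = \<psi> u" unfolding g_def using e \<psi>(3) \<psi>(1)[OF e(1)] by auto
    show "g 1 = \<psi> v" unfolding g_def using e \<psi>(4) swap[OF e(1)] by auto
  qed (use connected_graphD[OF G f(1)] \<psi>(1)[OF f(1)] swap[OF f(1)] in auto)
  ultimately show ?thesis by simp
qed

lemma separated_span:
  fixes A :: "real set"
  assumes "finite A" "A \<noteq> {}" "\<And>s t. s \<in> A \<Longrightarrow> t \<in> A \<Longrightarrow> s < t \<Longrightarrow> \<delta> \<le> t - s"
  shows "(real (card A) - 1) * \<delta> \<le> Max A - Min A"
  using assms
proof (induction A rule: finite_linorder_max_induct)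
  case (insert b A)
  show ?case
  proof (cases "A = {}")
    case False
    have b: "Max A < b" "Min A < b" "b \<notin> A" using insert.hyps False by auto
    have "\<delta> \<le> b - Max A" using insert.prems(2)[of "Max A" b] insert.hyps False b by auto
    moreover have "(real (card A) - 1) * \<delta> \<le> Max A - Min A"
      using insert.IH[OF False] insert.prems(2) by auto
    ultimately show ?thesis using insert.hyps(1) False b by (simp add: algebra_simps)
  qed simp
qed simp

section \<open>Certificates for dispersion\<close>

text \<open>The tables stand for: \<open>F 0 v 0\<close> a rank that decreases along some edge towards vertex \<open>0\<close>; \<open>F 1 e i\<close> the number
  \<open>h\<close> of points on edge \<open>e\<close>, divided by \<open>2 ^ i\<close>; \<open>F 2 e i\<close> the product \<open>2 * a * F 1 e i\<close>; \<open>F 3 e 0\<close> and \<open>F 4 e 0\<close> the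
  distances, in units of \<open>1/(2*b)\<close>, of the outermost points from the source and the target of \<open>e\<close>;
  \<open>F 5 e w\<close> the distance of the vertex \<open>w\<close> from the points of \<open>e\<close>; \<open>F 6 j 0\<close> the number of points on the
  first \<open>j\<close> edges.  A graph without edges has one point, whence \<open>of_bool (m = 0)\<close>.\<close>

definition certificate ::
  "nat \<Rightarrow> nat \<Rightarrow> (nat \<Rightarrow> nat) \<Rightarrow> (nat \<Rightarrow> nat) \<Rightarrow> nat \<Rightarrow> nat \<Rightarrow> nat \<Rightarrow> nat \<Rightarrow>
    (nat \<Rightarrow> nat \<Rightarrow> nat \<Rightarrow> nat) \<Rightarrow> bool" where
  "certificate n m src tgt a b k W F \<longleftrightarrow>
     (\<forall>v<n. 0 < v \<longrightarrow> (\<exists>e<m. (src e = v \<and> F 0 (tgt e) 0 + 1 \<le> F 0 v 0) \<or>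
        (tgt e = v \<and> F 0 (src e) 0 + 1 \<le> F 0 v 0))) \<and>
     (\<forall>e<m. F 1 e W \<le> 0 \<and>
        (\<forall>i<W. F 1 e i \<le> 2 * F 1 e (Suc i) \<and> 2 * F 2 e (Suc i) \<le> F 2 e i \<or>
           F 1 e i \<le> 2 * F 1 e (Suc i) + 1 \<and> 2 * F 2 e (Suc i) + 2 * a \<le> F 2 e i) \<and>
        F 3 e 0 + F 2 e 0 + F 4 e 0 \<le> 2 * a + 2 * b \<and>
        F 5 e (src e) \<le> F 3 e 0 \<and> F 5 e (tgt e) \<le> F 4 e 0 \<and>
        (\<forall>f<m. F 5 e (src f) \<le> F 5 e (tgt f) + 2 * b \<and> F 5 e (tgt f) \<le> F 5 e (src f) + 2 * b \<and>
           (e \<noteq> f \<and> 1 \<le> F 1 e 0 \<and> 1 \<le> F 1 f 0 \<longrightarrow>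
              \<not> (src e = src f \<and> tgt e = tgt f) \<and> \<not> (src e = tgt f \<and> tgt e = src f) \<and>
              2 * a \<le> F 5 e (src f) + F 3 f 0 \<and> 2 * a \<le> F 5 e (tgt f) + F 4 f 0)) \<and>
        F 6 (Suc e) 0 \<le> F 6 e 0 + F 1 e 0) \<and>
     F 6 0 0 \<le> of_bool (m = 0) \<and> k \<le> F 6 m 0"

lemma edge_set_iff: "{u, v} \<in> edge_set es \<longleftrightarrow> (u, v) \<in> set es \<or> (v, u) \<in> set es"
  by (auto simp: edge_set_def doubleton_eq_iff)

lemma edge_set_nth: "e < length es \<Longrightarrow> {fst (es ! e), snd (es ! e)} \<in> edge_set es"
  by (simp add: edge_set_iff)

lemma edge_setE:
  assumes "{u, v} \<in> edge_set es"
  obtains e where "e < length es" "es ! e = (u, v) \<or> es ! e = (v, u)"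
  using assms by (auto simp: edge_set_iff in_set_conv_nth)

lemma disp_single:
  assumes G: "connected_graph {..<n} (edge_set es)" and "\<delta> > 0"
  shows "1 \<le> disp {..<n} (edge_set es) \<delta>"
proof -
  have "n \<noteq> 0" using G by (auto simp: connected_graph_def)
  then have "dispersed {..<n} (edge_set es) \<delta> {vertex_point 0}"
    by (auto simp: dispersed_def points_def)
  from disp_props(2)[OF G \<open>\<delta> > 0\<close> this] show ?thesis by simp
qed

theorem certificate_sound:
  assumes es: "\<And>u v. (u, v) \<in> set es \<Longrightarrow> u < n \<and> v < n \<and> u \<noteq> v" and n: "0 < n"
    and a: "0 < a" and b: "0 < b" and C: "certificate n (length es) (\<lambda>e. fst (es ! e)) (\<lambda>e. snd (es ! e)) a b k W F"
  shows "connected_graph {..<n} (edge_set es)"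
    and "k \<le> disp {..<n} (edge_set es) (real a / real b)"
proof -
  define m src tgt where "m = length es" "src = (\<lambda>e. fst (es ! e))" "tgt = (\<lambda>e. snd (es ! e))"
  note defs = m_src_tgt_def
  define r X Y T where "r v = F 0 v 0" "X e = F 3 e 0" "Y e = F 4 e 0" "T e = F 6 e 0" for v e
  define H Q Z where "H = F 1" "Q = F 2" "Z = F 5"
  note C' = C[folded defs, unfolded certificate_def, folded r_X_Y_T_def H_Q_Z_def]
  have conn: "\<exists>e<m. (src e = v \<and> r (tgt e) + 1 \<le> r v) \<or> (tgt e = v \<and> r (src e) + 1 \<le> r v)"
    if "v < n" "0 < v" for v using C' that by blast
  have HW: "H e W = 0"
    and HQ: "i < W \<Longrightarrow> H e i \<le> 2 * H e (Suc i) \<and> 2 * Q e (Suc i) \<le> Q e i \<or>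
               H e i \<le> 2 * H e (Suc i) + 1 \<and> 2 * Q e (Suc i) + 2 * a \<le> Q e i"
    and span: "X e + Q e 0 + Y e \<le> 2 * a + 2 * b"
    and Zown: "Z e (src e) \<le> X e" "Z e (tgt e) \<le> Y e"
    and TS: "T (Suc e) \<le> T e + H e 0" if "e < m" for e i
    using C' that by blast+
  have Zlip: "Z e (src f) \<le> Z e (tgt f) + 2 * b" "Z e (tgt f) \<le> Z e (src f) + 2 * b"
    if "e < m" "f < m" for e f
    using C' that by blast+
  have pair: "\<not> (src e = src f \<and> tgt e = tgt f) \<and> \<not> (src e = tgt f \<and> tgt e = src f) \<and>
              2 * a \<le> Z e (src f) + X f \<and> 2 * a \<le> Z e (tgt f) + Y f"
    if "e < m" "f < m" "e \<noteq> f" "1 \<le> H e 0" "1 \<le> H f 0" for e f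
    using C' that by blast
  have T0: "T 0 \<le> of_bool (m = 0)" and kT: "k \<le> T m" using C' by blast+
  let ?E = "edge_set es" and ?V = "{..<n}"
  have edge: "{src e, tgt e} \<in> ?E" "src e < n" "tgt e < n" "src e \<noteq> tgt e" if "e < m" for e
    using that es[of "src e" "tgt e"] edge_set_nth[of e es] by (auto simp: defs)
  show G: "connected_graph ?V ?E"
  proof -
    have sym: "sym (({(x, y). {x, y} \<in> ?E})\<^sup>*)"
      by (rule sym_rtrancl) (auto simp: sym_def insert_commute)
    \<comment> \<open>A walk along edges of falling rank can only end at vertex 0.\<close>
    have to0: "(v, 0) \<in> {(x, y). {x, y} \<in> ?E}\<^sup>*" if "v < n" for v
      using that
    proof (induction "r v" arbitrary: v rule: less_induct)
      case less
      show ?case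
      proof (cases "v = 0")
        case False
        then obtain e where e: "e < m" "(src e = v \<and> r (tgt e) + 1 \<le> r v) \<or> (tgt e = v \<and> r (src e) + 1 \<le> r v)"
          using conn[OF less.prems] by blast
        then obtain w where w: "{v, w} \<in> ?E" "w < n" "r w < r v"
          using edge[OF e(1)] by (metis Suc_eq_plus1 Suc_le_eq insert_commute)
        have "(w, 0) \<in> {(x, y). {x, y} \<in> ?E}\<^sup>*" by (rule less.hyps[OF w(3,2)])
        then show ?thesis using w(1) by (intro converse_rtrancl_into_rtrancl[of v w]) auto
      qed simp
    qed
    have "?E \<subseteq> {e. e \<subseteq> ?V \<and> card e = 2}"
      using es by (auto simp: edge_set_def)
    moreover have "(u, v) \<in> {(x, y). {x, y} \<in> ?E}\<^sup>*" if "u < n" "v < n" for u v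
      using to0[OF that(1)] symD[OF sym to0[OF that(2)]] by (rule rtrancl_trans)
    ultimately show ?thesis using n by (auto simp: connected_graph_def)
  qed
  let ?\<delta> = "real a / real b"
  have \<delta>: "0 < ?\<delta>" using a b by simp
  \<comment> \<open>Horner's rule for \<open>H\<close> and \<open>Q\<close> in parallel, from the
    index \<open>W\<close>, where \<open>H\<close> vanishes, down to 0; each disjunct of
    \<open>HQ\<close> stands for one value of the next binary digit.\<close>
  have QH: "2 * a * H e i \<le> Q e i" if "e < m" "i \<le> W" for e i
    using that(2)
  proof (induction i rule: inc_induct)
    case (step i)
    have i: "i < W" using step by simp
    have s: "2 * (2 * a * H e (Suc i)) \<le> 2 * Q e (Suc i)" using step.IH by simp
    from HQ[OF that(1) i] show ?case
    proof
      assume h: "H e i \<le> 2 * H e (Suc i) \<and> 2 * Q e (Suc i) \<le> Q e i"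
      then have "2 * a * H e i \<le> 2 * a * (2 * H e (Suc i))" by (intro mult_le_mono2) simp
      also have "\<dots> = 2 * (2 * a * H e (Suc i))" by simp
      finally show ?thesis using h s by linarith
    next
      assume h: "H e i \<le> 2 * H e (Suc i) + 1 \<and> 2 * Q e (Suc i) + 2 * a \<le> Q e i"
      then have "2 * a * H e i \<le> 2 * a * (2 * H e (Suc i) + 1)" by (intro mult_le_mono2) simp
      also have "\<dots> = 2 * (2 * a * H e (Suc i)) + 2 * a" by (simp add: algebra_simps)
      finally show ?thesis using h s by linarith
    qed
  qed (simp add: HW[OF that(1)])
  \<comment> \<open>Lengths are counted in units of \<open>1/(2*b)\<close>: the points start
    \<open>X e\<close> units from the source, and \<open>\<delta>\<close> is \<open>2 * a\<close>
    units.\<close>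
  define pos where "pos e i = (real (X e) + 2 * real a * real i) / (2 * real b)" for e i
  define P where "P = (\<lambda>(e, i). edge_point (src e) (tgt e) (pos e i))"
  define I where "I = Sigma {..<m} (\<lambda>e. {..<H e 0})"
  have pos: "real (X e) / (2 * real b) \<le> pos e i" "real (Y e) / (2 * real b) \<le> 1 - pos e i"
    if "e < m" "i < H e 0" for e i
  proof -
    show "real (X e) / (2 * real b) \<le> pos e i" unfolding pos_def by (intro divide_right_mono) auto
    \<comment> \<open>The last point has index \<open>H e 0 - 1\<close>; the extra
      \<open>2 * a\<close> on the right of \<open>span\<close> pays for the missing step.\<close>
    have "2 * a * Suc i \<le> 2 * a * H e 0" using that(2) by (intro mult_le_mono2) simp
    then have "X e + 2 * a * i + Y e \<le> 2 * b"
      using QH[OF that(1), of 0] span[OF that(1)] by (simp add: algebra_simps)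
    then have "real (X e + 2 * a * i + Y e) \<le> real (2 * b)" by (simp only: of_nat_le_iff)
    then show "real (Y e) / (2 * real b) \<le> 1 - pos e i" using b by (simp add: pos_def field_simps)
  qed
  have pos01: "0 \<le> pos e i" "pos e i \<le> 1" if "e < m" "i < H e 0" for e i
    using pos[OF that] order_trans[of 0 "real (X e) / (2 * real b)" "pos e i"]
      order_trans[of 0 "real (Y e) / (2 * real b)" "1 - pos e i"] by auto
  have far: "?\<delta> \<le> point_dist ?E (P p) (P q)" if pq: "p \<in> I" "q \<in> I" "p \<noteq> q" for p q
  proof -
    obtain e i f j where p: "p = (e, i)" and q: "q = (f, j)" by fastforce
    have e: "e < m" "i < H e 0" and f: "f < m" "j < H f 0" using pq p q by (auto simp: I_def)
    show ?thesis
    proof (cases "e = f")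
      case True
      then have "1 \<le> \<bar>int i - int j\<bar>" using pq p q by auto
      then have "1 \<le> \<bar>real i - real j\<bar>" by linarith
      then have "?\<delta> * 1 \<le> ?\<delta> * \<bar>real i - real j\<bar>" by (intro mult_left_mono) auto
      also have "\<dots> = \<bar>?\<delta> * (real i - real j)\<bar>" by (simp add: abs_mult)
      also have "?\<delta> * (real i - real j) = pos e i - pos e j" using b by (simp add: pos_def field_simps)
      also have "\<bar>\<dots>\<bar> \<le> point_dist ?E (P p) (P q)"
        using point_dist_same_edge[OF G edge(1)[OF e(1)] pos01[OF e], of "pos e j"] pos01[OF f] True
        by (simp add: P_def p q)
      finally show ?thesis by simp
    next
      case False
      have pr: "{src f, tgt f} \<noteq> {src e, tgt e}" "2 * a \<le> Z e (src f) + X f" "2 * a \<le> Z e (tgt f) + Y f"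
        using pair[OF e(1) f(1) False] e f by (auto simp: doubleton_eq_iff)
      \<comment> \<open>One table \<open>Z e\<close> serves all points of \<open>e\<close>, because
        the outermost points are the nearest ones to the ends of \<open>e\<close>.\<close>
      define \<psi> where "\<psi> v = real (Z e v) / (2 * real b)" for v
      have lip: "\<psi> u \<le> \<psi> v + 1" if uv: "{u, v} \<in> ?E" for u v
      proof -
        obtain g where "g < m" "u = src g \<and> v = tgt g \<or> u = tgt g \<and> v = src g"
          using edge_setE[OF uv] unfolding defs by (metis fst_conv snd_conv)
        then have "Z e u \<le> Z e v + 2 * b" using Zlip[OF e(1)] by auto
        then have "real (Z e u) \<le> real (Z e v + 2 * b)" by (simp only: of_nat_le_iff)
        then show ?thesis using b by (simp add: \<psi>_def field_simps)
      qed
      have "min (\<psi> (src f) + pos f j) (\<psi> (tgt f) + 1 - pos f j) \<le> point_dist ?E (P p) (P q)"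
        unfolding P_def p q prod.case
      proof (rule point_dist_other_edge[OF G edge(1)[OF e(1)] pos01[OF e] edge(1)[OF f(1)] pos01[OF f] pr(1) lip])
        show "0 \<le> \<psi> v" for v by (simp add: \<psi>_def)
        show "\<psi> (src e) \<le> pos e i" "\<psi> (tgt e) \<le> 1 - pos e i"
          using Zown[OF e(1)] pos[OF e] by (auto simp: \<psi>_def divide_right_mono intro: order_trans[rotated])
      qed
      moreover have "?\<delta> \<le> \<psi> (src f) + pos f j"
      proof -
        have "real (2 * a) \<le> real (Z e (src f) + X f)" using pr(2) by (simp only: of_nat_le_iff)
        then have "?\<delta> \<le> \<psi> (src f) + real (X f) / (2 * real b)" using b by (simp add: \<psi>_def field_simps)
        then show ?thesis using pos(1)[OF f] by linarith
      qed
      moreover have "?\<delta> \<le> \<psi> (tgt f) + 1 - pos f j"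
      proof -
        have "real (2 * a) \<le> real (Z e (tgt f) + Y f)" using pr(3) by (simp only: of_nat_le_iff)
        then have "?\<delta> \<le> \<psi> (tgt f) + real (Y f) / (2 * real b)" using b by (simp add: \<psi>_def field_simps)
        then show ?thesis using pos(2)[OF f] by linarith
      qed
      ultimately show ?thesis by linarith
    qed
  qed
  have inj: "inj_on P I"
  proof (rule inj_onI, rule ccontr)
    fix p q assume "p \<in> I" "q \<in> I" "P p = P q" "p \<noteq> q"
    moreover have "point_dist ?E (P q) (P q) \<le> 0" by (rule point_dist_le[OF route_refl])
    ultimately show False using far[of p q] \<delta> by simp
  qed
  have "P ` I \<subseteq> points ?V ?E"
    using edge pos01 by (fastforce simp: P_def I_def points_def)
  then have "dispersed ?V ?E ?\<delta> (P ` I)"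
    unfolding dispersed_def using far by blast
  from disp_props(2)[OF G \<delta> this] have "card I \<le> disp ?V ?E ?\<delta>"
    by (simp add: card_image[OF inj])
  moreover have "card I = (\<Sum>e<m. H e 0)" by (simp add: I_def)
  moreover have TS': "T j \<le> T 0 + (\<Sum>e<j. H e 0)" if "j \<le> m" for j
    using that
  proof (induction j)
    case (Suc j)
    then show ?case using TS[of j] by simp
  qed simp
  ultimately have T: "T m \<le> T 0 + disp ?V ?E ?\<delta>" using TS'[of m] by linarith
  \<comment> \<open>Without edges \<open>T 0\<close> may be 1, and a single vertex pays for
    it.\<close>
  have "T m \<le> disp ?V ?E ?\<delta>"
  proof (cases "m = 0")
    case True
    then show ?thesis using T0 disp_single[OF G \<delta>] by simp
  next
    case False
    then show ?thesis using T T0 by simp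
  qed
  then show "k \<le> disp ?V ?E ?\<delta>" using kT by linarith
qed

section \<open>Half-integral rounding and existence of certificates\<close>

text \<open>Rounding to half-integers preserves bounds on sums by integers.\<close>

lemma round_add_le:
  fixes \<alpha> \<beta> :: real
  assumes "\<alpha> + \<beta> \<le> of_int c"
  shows "(\<lfloor>\<alpha>\<rfloor> + \<lceil>\<alpha>\<rceil>) + (\<lfloor>\<beta>\<rfloor> + \<lceil>\<beta>\<rceil>) \<le> 2 * c"
proof -
  have "\<lceil>\<beta>\<rceil> \<le> c - \<lfloor>\<alpha>\<rfloor>" "\<lceil>\<alpha>\<rceil> \<le> c - \<lfloor>\<beta>\<rfloor>"
    using assms by (simp_all add: ceiling_le_iff) (use of_int_floor_le[of \<alpha>] of_int_floor_le[of \<beta>] in linarith)+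
  then show ?thesis by simp
qed

lemma round_add_ge:
  fixes \<alpha> \<beta> :: real
  assumes "of_int c \<le> \<alpha> + \<beta>"
  shows "2 * c \<le> (\<lfloor>\<alpha>\<rfloor> + \<lceil>\<alpha>\<rceil>) + (\<lfloor>\<beta>\<rfloor> + \<lceil>\<beta>\<rceil>)"
proof -
  have "c - \<lceil>\<beta>\<rceil> \<le> \<lfloor>\<alpha>\<rfloor>" "c - \<lceil>\<alpha>\<rceil> \<le> \<lfloor>\<beta>\<rfloor>"
    using assms by (simp_all add: le_floor_iff) (use le_of_int_ceiling[of \<alpha>] le_of_int_ceiling[of \<beta>] in linarith)+
  then show ?thesis by simp
qed

text \<open>Once there is an edge, connectivity gives every vertex a neighbour, so a vertex is an
  end of some edge.\<close>

lemma point_on_edge: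
  assumes G: "connected_graph V E" and e: "{u0, v0} \<in> E" and p: "p \<in> points V E"
  shows "\<exists>u v t. {u, v} \<in> E \<and> 0 \<le> t \<and> t \<le> 1 \<and> p = edge_point u v t"
proof (cases "p \<in> vertex_point ` V")
  case True
  then obtain v where v: "v \<in> V" "p = vertex_point v" by blast
  obtain u where u: "u \<in> V" "u \<noteq> v" using connected_graphD[OF G e] by metis
  have "(v, u) \<in> {(x, y). {x, y} \<in> E}\<^sup>*" using G u v by (auto simp: connected_graph_def)
  then obtain w where w: "{v, w} \<in> E" using u(2) by (auto elim: converse_rtranclE)
  then have "p = edge_point v w 0" using connected_graphD[OF G w] v by (simp add: edge_point_0)
  with w show ?thesis by (metis zero_le_one order_refl)
next
  case False
  then show ?thesis using p by (auto simp: points_def)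
qed

text \<open>A largest dispersed set satisfies all conditions with its real positions, since routes
  bound its distances from above; rounding keeps them.\<close>

theorem certificate_complete:
  fixes es :: "(nat \<times> nat) list"
  defines "m \<equiv> length es" and "src \<equiv> \<lambda>e. fst (es ! e)" and "tgt \<equiv> \<lambda>e. snd (es ! e)"
  assumes G: "connected_graph {..<n} (edge_set es)" and a: "0 < a" and b: "0 < b"
    and k: "k \<le> disp {..<n} (edge_set es) (real a / real b)"
    and W: "n * n < 2 ^ W" "2 * a + 2 * b + 1 < 2 ^ W" "k + 1 < 2 ^ W"
  shows "\<exists>F. certificate n m src tgt a b k W F \<and> (\<forall>c i j. F c i j < 2 ^ W)"
proof -
  let ?E = "edge_set es" and ?V = "{..<n}" and ?\<delta> = "real a / real b"
  have \<delta>: "0 < ?\<delta>" using a b by simp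
  obtain S where S: "dispersed ?V ?E ?\<delta> S" "card S = disp ?V ?E ?\<delta>"
    using disp_props(1)[OF G \<delta>] by blast
  have finS: "finite S" by (rule finite_dispersed[OF G \<delta> S(1)])
  have n0: "0 < n" using G by (auto simp: connected_graph_def)
  have edge: "{src e, tgt e} \<in> ?E" "src e < n" "tgt e < n" "src e \<noteq> tgt e" if "e < m" for e
    using that edge_set_nth[of e es] connected_graphD[OF G, of "src e" "tgt e"] by (auto simp: assms(1-3))
  show ?thesis
  proof (cases "m = 0")
    case True
    then have E: "?E = {}" by (simp add: m_def edge_set_def)
    have "n = 1"
    proof (rule ccontr)
      assume "n \<noteq> 1"
      then have "(0, 1) \<in> {(x, y). {x, y} \<in> ?E}\<^sup>*" using n0 G by (auto simp: connected_graph_def)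
      then show False by (simp add: E)
    qed
    then have "points ?V ?E = {vertex_point 0}" by (auto simp: points_def E)
    then have "S \<subseteq> {vertex_point 0}" using S(1) by (simp add: dispersed_def)
    then have "card S \<le> 1" using card_mono[of "{vertex_point 0}" S] by simp
    then have "certificate n m src tgt a b k W (\<lambda>c i j. if c = 6 then min k 1 else 0)"
      using True \<open>n = 1\<close> k S(2) by (auto simp: certificate_def)
    moreover have "min k 1 < 2 ^ W" using W(3) by simp
    ultimately show ?thesis by (intro exI conjI) auto
  next
    case False
    then have m0: "0 < m" by simp
    define on where "on e p \<longleftrightarrow> e < m \<and> (\<exists>t. 0 \<le> t \<and> t \<le> 1 \<and> p = edge_point (src e) (tgt e) t)" for e p
    have on_ex: "\<exists>e. on e p" if p: "p \<in> S" for p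
    proof -
      have "p \<in> points ?V ?E" using S(1) p by (auto simp: dispersed_def)
      then obtain u v t where t: "{u, v} \<in> ?E" "0 \<le> t" "t \<le> 1" "p = edge_point u v t"
        using point_on_edge[OF G edge(1)[OF m0]] by blast
      obtain e where e: "e < m" "es ! e = (u, v) \<or> es ! e = (v, u)"
        using edge_setE[OF t(1)] by (metis m_def)
      have "u \<noteq> v" using connected_graphD[OF G t(1)] by simp
      from e(2) show ?thesis
      proof
        assume "es ! e = (u, v)"
        then have "on e p" unfolding on_def using e t by (auto simp: src_def tgt_def)
        then show ?thesis ..
      next
        assume "es ! e = (v, u)"
        then have "on e p" unfolding on_def using e t edge_point_swap[OF \<open>u \<noteq> v\<close>, of t]
          by (auto simp: src_def tgt_def intro!: exI[of _ "1 - t"])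
        then show ?thesis ..
      qed
    qed
    \<comment> \<open>A vertex lies on several edges, and the list may repeat an edge. The least
      index assigns each point once and leaves repeated edges empty.\<close>
    define idx where "idx p = (LEAST e. on e p)" for p
    have idx: "on (idx p) p" if "p \<in> S" for p
      unfolding idx_def using on_ex[OF that] by (rule LeastI_ex)
    have idx_le: "idx p \<le> e" if "on e p" for e p
      unfolding idx_def using that by (rule Least_le)
    define A where "A e = (\<lambda>p. p (tgt e)) ` {p \<in> S. idx p = e}" for e
    define ne where "ne e = card {p \<in> S. idx p = e}" for e
    have rep: "p = edge_point (src e) (tgt e) (p (tgt e))" "0 \<le> p (tgt e)" "p (tgt e) \<le> 1" "e < m"
      if p: "p \<in> S" "idx p = e" for p e
    proof -
      have "on e p" using idx[OF p(1)] p(2) by simp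
      then obtain t where "e < m" "0 \<le> t" "t \<le> 1" "p = edge_point (src e) (tgt e) t"
        by (auto simp: on_def)
      then show "p = edge_point (src e) (tgt e) (p (tgt e))" "0 \<le> p (tgt e)" "p (tgt e) \<le> 1" "e < m"
        using edge(4)[of e] by (auto simp: edge_point_apply)
    qed
    have A: "0 \<le> s" "s \<le> 1" "edge_point (src e) (tgt e) s \<in> S" "idx (edge_point (src e) (tgt e) s) = e" "e < m"
      if s: "s \<in> A e" for s e
    proof -
      obtain p where p: "p \<in> S" "idx p = e" "s = p (tgt e)" using s by (auto simp: A_def)
      show "0 \<le> s" "s \<le> 1" "edge_point (src e) (tgt e) s \<in> S" "idx (edge_point (src e) (tgt e) s) = e" "e < m"
        using rep[OF p(1,2)] p by simp_all
    qed
    have finA: "finite (A e)" for e using finS by (simp add: A_def)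
    have cardA: "card (A e) = ne e" for e
      unfolding A_def ne_def by (rule card_image, rule inj_onI) (metis (mono_tags, lifting) mem_Collect_eq rep(1))
    have dist: "?\<delta> \<le> point_dist ?E p q" if "p \<in> S" "q \<in> S" "p \<noteq> q" for p q
      using S(1) that by (auto simp: dispersed_def)
    have sep: "?\<delta> \<le> t - s" if st: "s \<in> A e" "t \<in> A e" "s < t" for s t e
    proof -
      let ?p = "edge_point (src e) (tgt e) s" and ?q = "edge_point (src e) (tgt e) t"
      have e: "e < m" by (rule A(5)[OF st(1)])
      have "?p (tgt e) \<noteq> ?q (tgt e)" using edge(4)[OF e] st(3) by (simp add: edge_point_apply)
      then have "?\<delta> \<le> point_dist ?E ?p ?q" using A(3)[OF st(1)] A(3)[OF st(2)] by (intro dist) auto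
      also have "\<dots> \<le> \<bar>s - t\<bar>"
        by (rule point_dist_edge_le[OF edge(1)[OF e] A(1,2)[OF st(1)] A(1,2)[OF st(2)]])
      finally show ?thesis using st(3) by simp
    qed
    \<comment> \<open>Coordinates in \<open>A e\<close> are measured from the source, whence
      \<open>1 - Max\<close> for the target; 0 satisfies the span condition on an edge without
      points.\<close>
    define x where "x e = (if A e = {} then 0 else Min (A e))" for e
    define y where "y e = (if A e = {} then 0 else 1 - Max (A e))" for e
    define rd where "rd z = nat (\<lfloor>real b * z\<rfloor> + \<lceil>real b * z\<rceil>)" for z
    have rd: "int (rd z) = \<lfloor>real b * z\<rfloor> + \<lceil>real b * z\<rceil>" if "0 \<le> z" for z
    proof -
      have "0 \<le> real b * z" using that by simp
      then have "0 \<le> \<lfloor>real b * z\<rfloor>" by simp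
      then show ?thesis using floor_le_ceiling[of "real b * z"] by (simp add: rd_def)
    qed
    have xA: "A e \<noteq> {} \<Longrightarrow> x e \<in> A e" "A e \<noteq> {} \<Longrightarrow> 1 - y e \<in> A e" for e
      using finA by (auto simp: x_def y_def)
    have xy01: "0 \<le> x e" "0 \<le> y e" for e
    proof -
      show "0 \<le> x e" by (cases "A e = {}") (use A(1)[OF xA(1)] in \<open>auto simp: x_def\<close>)
      show "0 \<le> y e" by (cases "A e = {}") (use A(2)[OF xA(2), of e] in \<open>auto simp: y_def\<close>)
    qed
    define X Y where "X e = rd (x e)" "Y e = rd (y e)" for e
    have span: "X e + 2 * a * ne e + Y e \<le> 2 * a + 2 * b" for e
    proof (cases "A e = {}")
      case True
      then show ?thesis using cardA[of e] by (simp add: X_Y_def x_def y_def rd_def)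
    next
      case False
      have "(real (ne e) - 1) * ?\<delta> \<le> 1 - y e - x e"
        using separated_span[OF finA False sep] False by (simp add: cardA x_def y_def)
      then have "real b * ((real (ne e) - 1) * ?\<delta>) \<le> real b * (1 - y e - x e)"
        by (rule mult_left_mono) simp
      also have "real b * ((real (ne e) - 1) * ?\<delta>) = real a * (real (ne e) - 1)" using b by simp
      finally have "real b * x e + real b * y e \<le> of_int (int b - int a * (int (ne e) - 1))"
        by (simp add: algebra_simps)
      from round_add_le[OF this] have "int (X e) + int (Y e) \<le> 2 * (int b - int a * (int (ne e) - 1))"
        using rd[OF xy01(1)[of e]] rd[OF xy01(2)[of e]] by (simp add: X_Y_def)
      then have "int (X e + 2 * a * ne e + Y e) \<le> int (2 * a + 2 * b)" by (simp add: algebra_simps)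
      then show ?thesis by (simp only: of_nat_le_iff)
    qed
    \<comment> \<open>The route through the ends \<open>u\<close> and \<open>w\<close> is at least
      \<open>\<delta>\<close> long, and \<open>round_add_ge\<close> transfers this to rounded
      positions. Reading either edge in both directions yields the four cases of
      \<open>pair\<close>.\<close>
    have pair0: "2 * a \<le> rd s + 2 * b * gdist ?E u w + rd t"
      if "{u, u'} \<in> ?E" "{w, w'} \<in> ?E" "0 \<le> s" "s \<le> 1" "0 \<le> t" "t \<le> 1"
        "edge_point u u' s \<in> S" "edge_point w w' t \<in> S" "edge_point u u' s \<noteq> edge_point w w' t"
      for u u' w w' s t
    proof -
      have "?\<delta> \<le> s + gdist ?E u w + t"
        using order_trans[OF dist[OF that(7-9)] point_dist_le[OF route_edge_points[OF G]]] that by blast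
      then have "real b * ?\<delta> \<le> real b * (s + gdist ?E u w + t)" by (rule mult_left_mono) simp
      then have "of_int (int a - int b * int (gdist ?E u w)) \<le> real b * s + real b * t"
        using b by (simp add: algebra_simps)
      from round_add_ge[OF this]
      have "2 * (int a - int b * int (gdist ?E u w)) \<le> int (rd s) + int (rd t)"
        using rd[OF that(3)] rd[OF that(5)] by simp
      then have "int (2 * a) \<le> int (rd s + 2 * b * gdist ?E u w + rd t)" by (simp add: algebra_simps)
      then show ?thesis by (simp only: of_nat_le_iff)
    qed
    have pair: "2 * a \<le> X e + 2 * b * gdist ?E (src e) (src f) + X f"
      "2 * a \<le> X e + 2 * b * gdist ?E (src e) (tgt f) + Y f"
      "2 * a \<le> Y e + 2 * b * gdist ?E (tgt e) (src f) + X f"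
      "2 * a \<le> Y e + 2 * b * gdist ?E (tgt e) (tgt f) + Y f"
      if ef: "e \<noteq> f" "A e \<noteq> {}" "A f \<noteq> {}" for e f
    proof -
      have em: "e < m" "f < m" using A(5)[OF xA(1)] ef by auto
      have sw: "edge_point (tgt g) (src g) t = edge_point (src g) (tgt g) (1 - t)" if "g < m" for g t
        using edge_point_swap[of "src g" "tgt g" "1 - t"] edge(4)[OF that] by simp
      have ne: "edge_point (src e) (tgt e) s \<noteq> edge_point (src f) (tgt f) t" if "s \<in> A e" "t \<in> A f" for s t
        using A(4)[OF that(1)] A(4)[OF that(2)] ef(1) by metis
      have e': "{src e, tgt e} \<in> ?E" "{src f, tgt f} \<in> ?E" "{tgt e, src e} \<in> ?E" "{tgt f, src f} \<in> ?E"
        using edge(1) em by (auto simp: insert_commute)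
      note x1 = xA(1)[OF ef(2)] and x2 = xA(1)[OF ef(3)] and y1 = xA(2)[OF ef(2)] and y2 = xA(2)[OF ef(3)]
      show "2 * a \<le> X e + 2 * b * gdist ?E (src e) (src f) + X f"
        unfolding X_Y_def by (rule pair0[OF e'(1,2)]) (use A(1-3)[OF x1] A(1-3)[OF x2] ne[OF x1 x2] in auto)
      show "2 * a \<le> X e + 2 * b * gdist ?E (src e) (tgt f) + Y f"
        unfolding X_Y_def by (rule pair0[OF e'(1,4)])
          (use A(1-3)[OF x1] A(1-3)[OF y2] ne[OF x1 y2] xy01(2)[of f] in \<open>auto simp: sw[OF em(2)]\<close>)
      show "2 * a \<le> Y e + 2 * b * gdist ?E (tgt e) (src f) + X f"
        unfolding X_Y_def by (rule pair0[OF e'(3,2)])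
          (use A(1-3)[OF y1] A(1-3)[OF x2] ne[OF y1 x2] xy01(2)[of e] in \<open>auto simp: sw[OF em(1)]\<close>)
      show "2 * a \<le> Y e + 2 * b * gdist ?E (tgt e) (tgt f) + Y f"
        unfolding X_Y_def by (rule pair0[OF e'(3,4)])
          (use A(1-3)[OF y1] A(1-3)[OF y2] ne[OF y1 y2] xy01(2) in \<open>auto simp: sw[OF em(1)] sw[OF em(2)]\<close>)
    qed
    \<comment> \<open>The cap keeps entries below \<open>2 ^ W\<close>, which
      \<open>2 * b * gdist\<close> may exceed. Nothing is lost, as \<open>2 * a\<close> is all that
      separation demands, and a minimum of functions with the same Lipschitz bound keeps it.\<close>
    define Z where "Z e w = (if A e = {} \<or> n \<le> w then 0 else
      min (2 * a) (min (X e + 2 * b * gdist ?E (src e) w) (Y e + 2 * b * gdist ?E (tgt e) w)))" for e w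
    have Zlip: "Z e u \<le> Z e w + 2 * b" if uw: "{u, w} \<in> ?E" for e u w
    proof (cases "A e = {}")
      case False
      have em: "e < m" using A(5)[OF xA(1)] False by auto
      have "w < n" "u < n" using connected_graphD[OF G uw] by auto
      have "gdist ?E v u \<le> Suc (gdist ?E v w)" if "v < n" for v
        using gdist_step[OF G, of v w u] uw that by (simp add: insert_commute)
      then have "2 * b * gdist ?E v u \<le> 2 * b * Suc (gdist ?E v w)" if "v < n" for v
        using that by (intro mult_le_mono2) blast
      then have "2 * b * gdist ?E v u \<le> 2 * b * gdist ?E v w + 2 * b" if "v < n" for v
        using that by (simp add: add.commute)
      from this[of "src e"] this[of "tgt e"] show ?thesis
        using edge[OF em] False \<open>w < n\<close> \<open>u < n\<close> unfolding Z_def by simp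
    qed (simp add: Z_def)
    have Zown: "Z e (src e) \<le> X e" "Z e (tgt e) \<le> Y e" for e
      by (auto simp: Z_def gdist_refl)
    \<comment> \<open>A point on the later copy of an edge lies on the earlier one too and would
      have received its index.\<close>
    have distinct_edges: False if ef: "e < f" "A e \<noteq> {}" "A f \<noteq> {}"
        "src e = src f \<and> tgt e = tgt f \<or> src e = tgt f \<and> tgt e = src f" for e f
    proof -
      let ?s = "x f" and ?p = "edge_point (src f) (tgt f) (x f)"
      have em: "e < m" "f < m" using A(5)[OF xA(1)] ef by auto
      note x = A[OF xA(1)[OF ef(3)]]
      have "?p = edge_point (src e) (tgt e) (if tgt e = tgt f then ?s else 1 - ?s)"
        using ef(4) edge(4)[OF em(2)] edge_point_swap[of "src f" "tgt f" ?s] by auto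
      then have "on e ?p" unfolding on_def using em x(1,2) by (auto intro: exI[of _ "1 - ?s"])
      then show False using idx_le[of e ?p] x(4) ef(1) by simp
    qed
    define H where "H e i = ne e div 2 ^ i" for e i
    \<comment> \<open>The cap at \<open>k\<close> keeps the entries below \<open>2 ^ W\<close>; no
      more than \<open>k\<close> points have to be claimed.\<close>
    define T where "T j = min k (\<Sum>e<j. ne e)" for j
    define F where "F c i j = (if c = 0 then if i < n then gdist ?E 0 i else 0
      else if c = 1 then H i j else if c = 2 then 2 * a * H i j
      else if c = 3 then X i else if c = 4 then Y i else if c = 5 then Z i j else if c = 6 then T i else 0)" for c i j :: nat
    have F: "F 0 v 0 = (if v < n then gdist ?E 0 v else 0)" "F 1 = H" "F (Suc 0) = H" "F 2 e i = 2 * a * H e i"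
      "F 3 e 0 = X e" "F 4 e 0 = Y e" "F 5 = Z" "F 6 j 0 = T j" for v e i j
      by (auto simp: F_def fun_eq_iff)
    \<comment> \<open>The room on an edge bounds its count, so \<open>W\<close> halvings bring the
      count to 0.\<close>
    have nb: "ne e \<le> b + 1" for e
    proof (cases "ne e")
      case (Suc c)
      have "2 * a * c \<le> 2 * b" using span[of e] Suc by simp
      moreover have "c \<le> a * c" using a by simp
      ultimately show ?thesis using Suc by linarith
    qed simp
    have active: "1 \<le> H e 0 \<longleftrightarrow> A e \<noteq> {}" for e
      using finA[of e] by (simp add: H_def cardA[symmetric] card_gt_0_iff Suc_le_eq)
    have total: "(\<Sum>e<m. ne e) = card S"
    proof -
      have "idx ` S \<subseteq> {..<m}" using rep(4) by auto
      from sum.group[OF finS _ this, of "\<lambda>_. 1 :: nat"] show ?thesis by (simp add: ne_def)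
    qed
    have "certificate n m src tgt a b k W F"
      unfolding certificate_def F
    proof (intro conjI allI impI)
      fix v assume v: "v < n" "0 < v"
      have p: "(0, v) \<in> adj ?E ^^ gdist ?E 0 v" by (rule gdist_relpow[OF G]) (use v in auto)
      \<comment> \<open>Splitting off the last edge of a shortest walk from 0 yields the neighbour
        \<open>w\<close> of smaller rank.\<close>
      obtain d where d: "gdist ?E 0 v = Suc d"
        using p v by (cases "gdist ?E 0 v") auto
      obtain w where w: "(0, w) \<in> adj ?E ^^ d" "{w, v} \<in> ?E"
        using p unfolding d by (auto simp: adj_def)
      have "gdist ?E 0 w + 1 \<le> gdist ?E 0 v" using gdist_le[OF w(1)] d by simp
      moreover have "w < n" using connected_graphD[OF G w(2)] by simp
      moreover obtain e where "e < m" "src e = v \<and> tgt e = w \<or> tgt e = v \<and> src e = w"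
        using edge_setE[OF w(2)] unfolding m_def src_def tgt_def by (metis fst_conv snd_conv)
      ultimately show "\<exists>e<m. (src e = v \<and> (if tgt e < n then gdist ?E 0 (tgt e) else 0) + 1 \<le> (if v < n then gdist ?E 0 v else 0)) \<or>
        (tgt e = v \<and> (if src e < n then gdist ?E 0 (src e) else 0) + 1 \<le> (if v < n then gdist ?E 0 v else 0))"
        using v by auto
    next
      fix e assume e: "e < m"
      have "ne e < 2 ^ W" using nb[of e] W(2) by linarith
      then show "H e W \<le> 0" by (simp add: H_def)
      show "X e + 2 * a * H e 0 + Y e \<le> 2 * a + 2 * b" using span[of e] by (simp add: H_def)
      show "Z e (src e) \<le> X e" "Z e (tgt e) \<le> Y e" by (rule Zown)+
      show "T (Suc e) \<le> T e + H e 0" by (simp add: T_def H_def)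
      fix i
      have "ne e div 2 ^ Suc i = ne e div 2 ^ i div 2" by (simp only: power_Suc2 div_mult2_eq)
      then have "H e (Suc i) = H e i div 2" by (simp add: H_def)
      then have "H e i = 2 * H e (Suc i) \<or> H e i = 2 * H e (Suc i) + 1" by linarith
      then show "H e i \<le> 2 * H e (Suc i) \<and> 2 * (2 * a * H e (Suc i)) \<le> 2 * a * H e i \<or>
         H e i \<le> 2 * H e (Suc i) + 1 \<and> 2 * (2 * a * H e (Suc i)) + 2 * a \<le> 2 * a * H e i"
        by (elim disjE) (simp_all add: algebra_simps)
    next
      fix e f assume ef: "e < m" "f < m"
      show "Z e (src f) \<le> Z e (tgt f) + 2 * b" by (rule Zlip[OF edge(1)[OF ef(2)]])
      show "Z e (tgt f) \<le> Z e (src f) + 2 * b"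
        by (rule Zlip) (use edge(1)[OF ef(2)] in \<open>simp add: insert_commute\<close>)
      assume act: "e \<noteq> f \<and> 1 \<le> H e 0 \<and> 1 \<le> H f 0"
      then have act': "e \<noteq> f" "A e \<noteq> {}" "A f \<noteq> {}" using active by auto
      have "\<not> (src e = src f \<and> tgt e = tgt f \<or> src e = tgt f \<and> tgt e = src f)"
        using distinct_edges[of e f] distinct_edges[of f e] act' by (metis linorder_neqE_nat)
      then show "\<not> (src e = src f \<and> tgt e = tgt f)" "\<not> (src e = tgt f \<and> tgt e = src f)" by auto
      show "2 * a \<le> Z e (src f) + X f" "2 * a \<le> Z e (tgt f) + Y f"
        using pair[OF act'] edge[OF ef(2)] act'(2) by (auto simp: Z_def min_def)
    next
      show "T 0 \<le> of_bool (m = 0)" by (simp add: T_def)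
      show "k \<le> T m" using k S(2) total by (auto simp: T_def)
    qed
    moreover have "F c i j < 2 ^ W" for c i j
    proof -
      have "gdist ?E 0 i < 2 ^ W" if "i < n"
        using gdist_bound[OF G, of 0 i] that n0 W(1) by simp
      moreover have H: "H i j \<le> ne i" by (simp add: H_def)
      moreover have "2 * a * H i j < 2 ^ W"
        using mult_le_mono2[OF H, of "2 * a"] span[of i] W(2) by linarith
      ultimately show ?thesis
        using nb[of i] span[of i] W unfolding F_def Z_def T_def by auto
    qed
    ultimately show ?thesis by blast
  qed
qed

section \<open>Parsing instances\<close>

text \<open>The position of the first failure of \<open>P\<close>, or \<open>n\<close> if there is
  none; an accumulator below the round number \<open>l\<close> records that a failure has
  occurred.\<close>

definition run_length :: "(nat \<Rightarrow> bool) \<Rightarrow> nat \<Rightarrow> nat" where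
  "run_length P n = rec_nat 0 (\<lambda>l a. if a = l \<and> P l then Suc a else a) n"

lemma run_length_Suc:
  "run_length P (Suc n) = (if run_length P n = n \<and> P n then Suc n else run_length P n)"
  by (simp add: run_length_def)

lemma run_length_props:
  "run_length P n \<le> n" "\<And>i. i < run_length P n \<Longrightarrow> P i" "run_length P n < n \<Longrightarrow> \<not> P (run_length P n)"
proof (induction n)
  case 0
  { case 1 show ?case by (simp add: run_length_def) next
    case 2 then show ?case by (simp add: run_length_def) next
    case 3 then show ?case by simp }
next
  case (Suc n)
  { case 1 show ?case using Suc(1) by (auto simp: run_length_Suc) next
    case 2 then show ?case using Suc(2) by (auto simp: run_length_Suc less_Suc_eq split: if_splits) next
    case 3 then show ?case using Suc(1,3)
      by (cases "run_length P n = n") (auto simp: run_length_Suc split: if_splits) }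
qed

lemma run_length_eq:
  assumes "\<And>i. i < k \<Longrightarrow> P i" "\<not> P k" "k \<le> n"
  shows "run_length P n = k"
proof (rule linorder_cases)
  assume "run_length P n < k"
  then show ?thesis using assms run_length_props(3)[of P n] by auto
next
  assume "k < run_length P n"
  then show ?thesis using assms(2) run_length_props(2)[of k P n] by auto
qed

lemma ptime_run_length:
  assumes n: "ptime n" and P: "ptime_dec (\<lambda>w \<rho>. P w (\<lambda>j. \<rho> (Suc j)) (\<rho> 0))"
  shows "ptime (\<lambda>w \<rho>. run_length (P w \<rho>) (n w \<rho>))"
  unfolding run_length_def
proof (rule ptime_rec[OF n ptime_zero _ ptime_poly_bounded[OF n]])
  show "ptime (\<lambda>w \<rho>. if \<rho> 0 = \<rho> 1 \<and> P w (\<lambda>j. \<rho> (Suc (Suc j))) (\<rho> 1) then Suc (\<rho> 0) else \<rho> 0)"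
    using ptime_subst[OF P, of "case_nat 1 (\<lambda>j. Suc (Suc j))"]
    by (intro ptime_if dec_conj dec_eq ptime_Suc ptime_var) simp
  show "rec_nat 0 (\<lambda>l a. if a = l \<and> P w \<rho> l then Suc a else a) l \<le> n w \<rho>" if "l \<le> n w \<rho>" for w \<rho> l
    using run_length_props(1)[of "P w \<rho>" l] that unfolding run_length_def by linarith
qed

text \<open>In the code of a number the tags sit at even and the digits at odd offsets, so the first
  \<open>False\<close> at an even offset closes the number.\<close>

definition nlen :: "bool list \<Rightarrow> nat \<Rightarrow> nat" where
  "nlen x p = run_length (\<lambda>l. bit_at x (p + 2 * l)) (length x)"

definition nend :: "bool list \<Rightarrow> nat \<Rightarrow> nat" where
  "nend x p = Suc (p + 2 * nlen x p)"

text \<open>The second conjunct demands that the most significant digit, which comes last, is not 0: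
  words with leading zeros are not codes.\<close>

definition nok :: "bool list \<Rightarrow> nat \<Rightarrow> bool" where
  "nok x p \<longleftrightarrow> p + 2 * nlen x p < length x \<and> (0 < nlen x p \<longrightarrow> bit_at x (p + 2 * nlen x p - 1))"

definition digit :: "bool list \<Rightarrow> nat \<Rightarrow> nat \<Rightarrow> bool" where
  "digit x p l \<longleftrightarrow> l < nlen x p \<and> bit_at x (Suc (p + 2 * l))"

text \<open>The cap keeps the unary value polynomially bounded.\<close>

definition nval :: "bool list \<Rightarrow> nat \<Rightarrow> nat" where
  "nval x p = rec_nat 0 (\<lambda>i a. min (Suc (length x)) (2 * a + of_bool (digit x p (nlen x p - Suc i)))) (nlen x p)"

lemma ptime_nlen: assumes f: "ptime f" shows "ptime (\<lambda>w \<rho>. nlen (fst w) (f w \<rho>))"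
  unfolding nlen_def by (intro ptime_run_length ptime_intros ptime_subst[OF f])

lemma ptime_nend: assumes f: "ptime f" shows "ptime (\<lambda>w \<rho>. nend (fst w) (f w \<rho>))"
  unfolding nend_def by (intro ptime_intros ptime_nlen f)

lemma dec_nok: assumes f: "ptime f" shows "ptime_dec (\<lambda>w \<rho>. nok (fst w) (f w \<rho>))"
  unfolding nok_def by (intro ptime_intros ptime_nlen f)

lemma dec_digit: assumes f: "ptime f" and g: "ptime g" shows "ptime_dec (\<lambda>w \<rho>. digit (fst w) (f w \<rho>) (g w \<rho>))"
  unfolding digit_def by (intro ptime_intros ptime_nlen f g)

lemma ptime_nval: assumes f: "ptime f" shows "ptime (\<lambda>w \<rho>. nval (fst w) (f w \<rho>))"
  unfolding nval_def
proof (rule ptime_rec[OF ptime_nlen[OF f] ptime_zero _ poly_bounded_add[OF poly_bounded_const[of 1] poly_bounded_len]])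
  show "ptime (\<lambda>w \<rho>. min (Suc (length (fst w))) (2 * \<rho> 0 + of_bool (digit (fst w) (f w (\<lambda>j. \<rho> (Suc (Suc j))))
      (nlen (fst w) (f w (\<lambda>j. \<rho> (Suc (Suc j)))) - Suc (\<rho> 1)))))"
    by (intro ptime_intros dec_digit ptime_nlen ptime_subst[OF f])
  show "rec_nat 0 (\<lambda>i a. min (Suc (length (fst w))) (2 * a + of_bool (digit (fst w) (f w \<rho>) (nlen (fst w) (f w \<rho>) - Suc i)))) l
      \<le> 1 + length (fst w)" for w :: input and \<rho> l
    by (induction l) auto
qed

text \<open>The position of the tag before edge \<open>j\<close>. It is total: past the list or in a
  malformed word it means nothing, but the bounds below still hold.\<close>

definition edge_pos :: "bool list \<Rightarrow> nat \<Rightarrow> nat" where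
  "edge_pos x j = rec_nat (nend x 0) (\<lambda>_ p. nend x (nend x (Suc p))) j"

lemma edge_pos_Suc: "edge_pos x (Suc j) = nend x (nend x (Suc (edge_pos x j)))"
  by (simp add: edge_pos_def)

lemma nend_le: "nend x p \<le> p + (2 * length x + 1)"
  using run_length_props(1) by (simp add: nend_def nlen_def)

text \<open>Each jump by \<open>nend\<close> is linear in \<open>length x\<close>; the sum of the
  jumps is the growth bound that \<open>ptime_rec\<close> asks for.\<close>

lemma edge_pos_le: "edge_pos x j \<le> 2 * length x + 1 + j * (4 * length x + 3)"
proof (induction j)
  case 0
  then show ?case using nend_le[of x 0] by (simp add: edge_pos_def)
next
  case (Suc j)
  then show ?case using nend_le[of x "Suc (edge_pos x j)"] nend_le[of x "nend x (Suc (edge_pos x j))"]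
    by (simp add: edge_pos_Suc)
qed

text \<open>If \<open>edge_pos x (edge_count x)\<close> lies inside the word, this shows that the
  search for the closing tag stopped before its cut-off.\<close>

lemma edge_pos_ge: "j \<le> edge_pos x j"
proof (induction j)
  case (Suc j)
  then show ?case by (simp add: edge_pos_Suc nend_def)
qed simp

lemma ptime_edge_pos: assumes f: "ptime f" shows "ptime (\<lambda>w \<rho>. edge_pos (fst w) (f w \<rho>))"
  unfolding edge_pos_def
proof (rule ptime_rec[OF f ptime_nend[OF ptime_zero]])
  show "ptime (\<lambda>w \<rho>. nend (fst w) (nend (fst w) (Suc (\<rho> 0))))"
    by (intro ptime_nend ptime_Suc ptime_var)
  show "poly_bounded (\<lambda>w \<rho>. 2 * length (fst w) + 1 + f w \<rho> * (4 * length (fst w) + 3))"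
    by (intro ptime_poly_bounded ptime_intros f)
  show "rec_nat (nend (fst w) 0) (\<lambda>_ p. nend (fst w) (nend (fst w) (Suc p))) l
      \<le> 2 * length (fst w) + 1 + f w \<rho> * (4 * length (fst w) + 3)" if "l \<le> f w \<rho>" for w \<rho> l
    using edge_pos_le[of "fst w" l, unfolded edge_pos_def]
      mult_le_mono1[OF that, of "4 * length (fst w) + 3"] by linarith
qed

definition edge_count :: "bool list \<Rightarrow> nat" where
  "edge_count x = run_length (\<lambda>j. bit_at x (edge_pos x j)) (length x)"

definition source :: "bool list \<Rightarrow> nat \<Rightarrow> nat" where
  "source x j = nval x (Suc (edge_pos x j))"

definition target :: "bool list \<Rightarrow> nat \<Rightarrow> nat" where
  "target x j = nval x (nend x (Suc (edge_pos x j)))"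

definition a_pos :: "bool list \<Rightarrow> nat" where "a_pos x = Suc (edge_pos x (edge_count x))"
definition b_pos :: "bool list \<Rightarrow> nat" where "b_pos x = nend x (a_pos x)"
definition k_pos :: "bool list \<Rightarrow> nat" where "k_pos x = nend x (b_pos x)"

lemma ptime_edge_count: "ptime (\<lambda>w \<rho>. edge_count (fst w))"
  unfolding edge_count_def by (intro ptime_run_length ptime_intros ptime_edge_pos)

lemma ptime_source: assumes f: "ptime f" shows "ptime (\<lambda>w \<rho>. source (fst w) (f w \<rho>))"
  unfolding source_def by (intro ptime_nval ptime_Suc ptime_edge_pos f)

lemma ptime_target: assumes f: "ptime f" shows "ptime (\<lambda>w \<rho>. target (fst w) (f w \<rho>))"
  unfolding target_def by (intro ptime_nval ptime_nend ptime_Suc ptime_edge_pos f)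

lemma ptime_a_pos: "ptime (\<lambda>w \<rho>. a_pos (fst w))"
  unfolding a_pos_def by (intro ptime_Suc ptime_edge_pos ptime_edge_count)

lemma ptime_b_pos: "ptime (\<lambda>w \<rho>. b_pos (fst w))"
  unfolding b_pos_def by (intro ptime_nend ptime_a_pos)

lemma ptime_k_pos: "ptime (\<lambda>w \<rho>. k_pos (fst w))"
  unfolding k_pos_def by (intro ptime_nend ptime_b_pos)

lemmas ptime_parse = ptime_nlen ptime_nend dec_nok dec_digit ptime_nval ptime_edge_pos ptime_edge_count
  ptime_source ptime_target ptime_a_pos ptime_b_pos ptime_k_pos

text \<open>The equation for \<open>nend\<close> excludes trailing bits, and the last conjunct
  excludes a negative zero. Exactly the codes of instances remain, connected or not.\<close>

definition well_formed :: "bool list \<Rightarrow> bool" where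
  "well_formed x \<longleftrightarrow> nok x 0 \<and>
     (\<forall>j<edge_count x. nok x (Suc (edge_pos x j)) \<and> nok x (nend x (Suc (edge_pos x j)))) \<and>
     edge_pos x (edge_count x) < length x \<and> nok x (a_pos x) \<and> nok x (b_pos x) \<and>
     k_pos x < length x \<and> nok x (Suc (k_pos x)) \<and> nend x (Suc (k_pos x)) = length x \<and>
     (bit_at x (k_pos x) \<longrightarrow> 0 < nlen x (Suc (k_pos x)))"

lemma dec_well_formed: "ptime_dec (\<lambda>w \<rho>. well_formed (fst w))"
  unfolding well_formed_def by (intro ptime_intros ptime_parse)

section \<open>Inversion of the binary code\<close>

abbreviation value_of :: "bool list \<Rightarrow> nat" where
  "value_of \<equiv> horner_sum of_bool 2"

lemma value_of_bits: "value_of (bits v) = v"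
proof (induction v rule: less_induct)
  case (less v)
  show ?case
  proof (cases "v = 0")
    case False
    then show ?thesis using less[of "v div 2"] by (simp add: bits_pos)
  qed (simp add: bits_0)
qed

lemma bits_eq_Nil: "bits v = [] \<longleftrightarrow> v = 0"
  using bits_pos[of v] bits_0 by (cases "v = 0") auto

lemma last_bits: "0 < v \<Longrightarrow> last (bits v)"
proof (induction v rule: less_induct)
  case (less v)
  show ?case
  proof (cases "v = 1")
    case False
    then have "0 < v div 2" "v div 2 < v" using less.prems by auto
    then show ?thesis using less.IH[of "v div 2"] less.prems bits_eq_Nil[of "v div 2"]
      by (simp add: bits_pos)
  qed (simp add: bits_pos bits_0)
qed

lemma bits_value_of: "bs = [] \<or> last bs \<Longrightarrow> bits (value_of bs) = bs"
proof (induction bs)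
  case (Cons b bs)
  show ?case
  proof (cases bs)
    case Nil
    then show ?thesis using Cons.prems by (simp add: bits_pos bits_0)
  next
    case (Cons c cs)
    then have b: "bits (value_of bs) = bs" using Cons.IH Cons.prems by simp
    then have "0 < value_of bs" using Cons bits_0 by (cases "value_of bs = 0") auto
    then show ?thesis using b by (subst bits_pos) auto
  qed
qed (simp add: bits_0)

abbreviation tagged :: "bool list \<Rightarrow> bool list" where
  "tagged \<equiv> enc_list (\<lambda>b. [b])"

lemma tagged_simps: "tagged [] = [False]" "tagged (b # bs) = True # b # tagged bs"
  by (simp_all add: enc_list_def)

lemma length_tagged: "length (tagged bs) = Suc (2 * length bs)"
  by (induction bs) (simp_all add: tagged_simps)

lemma nth_tagged:
  "i < length bs \<Longrightarrow> (tagged bs @ r) ! (2 * i) \<and> (tagged bs @ r) ! Suc (2 * i) = bs ! i"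
  "\<not> (tagged bs @ r) ! (2 * length bs)"
proof (induction bs arbitrary: i)
  case (Cons b bs)
  { case 1 then show ?case using Cons(1) by (cases i) (auto simp: tagged_simps) next
    case 2 then show ?case using Cons(2) by (auto simp: tagged_simps) }
qed (auto simp: tagged_simps)

lemma bit_at_drop: "bit_at (drop p x) i = bit_at x (p + i)"
  by (auto simp: bit_at_def)

lemma untag:
  assumes "\<And>i. i < k \<Longrightarrow> bit_at y (2 * i)" "2 * k < length y" "\<not> y ! (2 * k)"
  shows "y = tagged (map (\<lambda>l. bit_at y (Suc (2 * l))) [0..<k]) @ drop (Suc (2 * k)) y"
  using assms
proof (induction k arbitrary: y)
  case 0
  then show ?case by (cases y) (auto simp: tagged_simps)
next
  case (Suc k)
  obtain c d z where y: "y = c # d # z" using Suc.prems(2)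
    by (cases y; cases "tl y") auto
  have sh: "bit_at y (Suc (Suc i)) = bit_at z i" for i by (simp add: bit_at_def y)
  have "bit_at z (2 * i)" if "i < k" for i using Suc.prems(1)[of "Suc i"] that sh by simp
  then have "z = tagged (map (\<lambda>l. bit_at z (Suc (2 * l))) [0..<k]) @ drop (Suc (2 * k)) z"
    using Suc.prems(2,3) by (intro Suc.IH) (auto simp: y)
  moreover have "map (\<lambda>l. bit_at y (Suc (2 * l))) [0..<Suc k] = d # map (\<lambda>l. bit_at z (Suc (2 * l))) [0..<k]"
    unfolding map_upt_Suc by (simp add: sh) (simp add: bit_at_def y)
  moreover have "c" using Suc.prems(1)[of 0] by (simp add: bit_at_def y)
  ultimately show ?case by (simp add: tagged_simps y)
qed

lemma parse_nat:
  assumes "drop p x = enc_nat v @ r"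
  shows "nlen x p = length (bits v)" "drop (nend x p) x = r" "nend x p \<le> length x" "nok x p"
    "\<And>l. digit x p l \<longleftrightarrow> l < length (bits v) \<and> bits v ! l"
proof -
  let ?bs = "bits v" and ?k = "length (bits v)"
  have d: "drop p x = tagged ?bs @ r" using assms by (simp add: enc_nat_def)
  have "length x - p = Suc (2 * ?k) + length r" using arg_cong[OF d, of length] by (simp add: length_tagged)
  then have len: "length x = p + Suc (2 * ?k) + length r" by simp
  have at: "bit_at x (p + i) \<longleftrightarrow> (tagged ?bs @ r) ! i" if "i \<le> 2 * ?k" for i
    using that len bit_at_drop[of p x i] unfolding d by (simp add: bit_at_def length_tagged)
  show n: "nlen x p = ?k"
    unfolding nlen_def
  proof (rule run_length_eq)
    show "bit_at x (p + 2 * i)" if "i < ?k" for i using nth_tagged(1)[OF that, of r] that by (subst at) auto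
    show "\<not> bit_at x (p + 2 * ?k)" using nth_tagged(2)[of ?bs r] by (subst at) auto
  qed (use len in simp)
  have "drop (nend x p) x = drop (Suc (2 * ?k)) (drop p x)" by (simp add: nend_def n add.commute)
  also have "\<dots> = r" unfolding d by (simp add: length_tagged)
  finally show "drop (nend x p) x = r" .
  show "nend x p \<le> length x" using len by (simp add: nend_def n)
  show dig: "digit x p l \<longleftrightarrow> l < ?k \<and> ?bs ! l" for l
    using nth_tagged(1)[of l ?bs r] at[of "Suc (2 * l)"] by (auto simp: digit_def n)
  show "nok x p"
  proof -
    have "bit_at x (p + 2 * ?k - 1)" if "0 < ?k"
    proof -
      have "0 < v" using that bits_0 by (cases "v = 0") auto
      then have "?bs ! (?k - 1)" using last_bits[of v] that by (simp add: last_conv_nth)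
      then have "bit_at x (Suc (p + 2 * (?k - 1)))" using dig[of "?k - 1"] that by (simp add: digit_def)
      moreover have "Suc (p + 2 * (?k - 1)) = p + 2 * ?k - 1" using that by linarith
      ultimately show ?thesis by simp
    qed
    then show ?thesis using len by (simp add: nok_def n)
  qed
qed

lemma parse_nat_exists:
  assumes "nok x p"
  shows "\<exists>v. drop p x = enc_nat v @ drop (nend x p) x"
proof -
  let ?k = "nlen x p" and ?y = "drop p x"
  let ?bs = "map (\<lambda>l. bit_at ?y (Suc (2 * l))) [0..<?k]"
  have len: "p + 2 * ?k < length x" using assms by (simp add: nok_def)
  \<comment> \<open>Below the cut-off, the search ended because it met the closing tag.\<close>
  have "?k < length x" using len by simp
  then have "\<not> bit_at x (p + 2 * ?k)"
    unfolding nlen_def by (rule run_length_props(3))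
  moreover have "bit_at x (p + 2 * i)" if "i < ?k" for i
    using that run_length_props(2) unfolding nlen_def by blast
  ultimately have "?y = tagged ?bs @ drop (Suc (2 * ?k)) ?y"
    using len by (intro untag) (auto simp: bit_at_drop, simp add: bit_at_def)
  moreover have "bits (value_of ?bs) = ?bs"
  proof (rule bits_value_of)
    have "last ?bs" if "0 < ?k"
    proof -
      have "bit_at x (p + 2 * ?k - 1)" using assms that by (simp add: nok_def)
      moreover have "p + Suc (2 * (?k - 1)) = p + 2 * ?k - 1" using that by linarith
      ultimately show ?thesis using that by (simp add: last_conv_nth bit_at_drop)
    qed
    then show "?bs = [] \<or> last ?bs" by (cases "?k = 0") auto
  qed
  ultimately have "?y = enc_nat (value_of ?bs) @ drop (nend x p) x"
    by (simp add: enc_nat_def nend_def add.commute)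
  then show ?thesis ..
qed

text \<open>Capping commutes with Horner's step, because \<open>2 * a + f\<close> is monotone in
  \<open>a\<close> and not smaller than \<open>a\<close>: a value that reached \<open>K\<close>
  stays there.\<close>

lemma capped_horner:
  fixes f :: "nat \<Rightarrow> nat"
  assumes "i \<le> n"
  shows "rec_nat 0 (\<lambda>i a. min K (2 * a + f (n - Suc i))) i = min K (\<Sum>l<i. f (n - i + l) * 2 ^ l)"
  using assms
proof (induction i)
  case (Suc i)
  have "(\<Sum>l<Suc i. f (n - Suc i + l) * 2 ^ l) = f (n - Suc i) + (\<Sum>l<i. f (n - i + l) * (2 * 2 ^ l))"
    unfolding sum.lessThan_Suc_shift using Suc.prems by (simp add: Suc_diff_Suc)
  also have "(\<Sum>l<i. f (n - i + l) * (2 * 2 ^ l)) = 2 * (\<Sum>l<i. f (n - i + l) * 2 ^ l)"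
    by (simp add: sum_distrib_left mult.left_commute)
  finally show ?case using Suc by (simp add: min_def)
qed simp

lemma nval_eq:
  assumes "drop p x = enc_nat v @ r" shows "nval x p = min (Suc (length x)) v"
proof -
  note p = parse_nat[OF assms]
  let ?n = "length (bits v)"
  have "nval x p = min (Suc (length x)) (\<Sum>l<?n. of_bool (digit x p l) * 2 ^ l)"
    unfolding nval_def p(1) using capped_horner[of ?n ?n _ "\<lambda>l. of_bool (digit x p l)"] by simp
  also have "(\<Sum>l<?n. of_bool (digit x p l) * 2 ^ l) = value_of (bits v)"
    unfolding horner_sum_eq_sum by (intro sum.cong) (auto simp: p(5))
  finally show ?thesis by (simp add: value_of_bits)
qed

lemma digit_sum:
  assumes "drop p x = enc_nat v @ r" and W: "length x \<le> W"
  shows "(\<Sum>l<W. of_bool (digit x p l) * 2 ^ l) = v" "v < 2 ^ length x"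
proof -
  note p = parse_nat[OF assms(1)]
  let ?n = "length (bits v)"
  have le: "?n \<le> length x" using p(3) by (simp add: nend_def p(1))
  then have "(\<Sum>l<W. of_bool (digit x p l) * 2 ^ l) = (\<Sum>l<?n. of_bool (digit x p l) * 2 ^ l :: nat)"
    using W by (intro sum.mono_neutral_right) (auto simp: p(5))
  also have "\<dots> = value_of (bits v)"
    unfolding horner_sum_eq_sum by (intro sum.cong) (auto simp: p(5))
  finally show "(\<Sum>l<W. of_bool (digit x p l) * 2 ^ l) = v" by (simp add: value_of_bits)
  have "v < 2 ^ ?n" using horner_sum_of_bool_2_less[of "bits v", where 'a = nat] by (simp add: value_of_bits)
  also have "\<dots> \<le> 2 ^ length x" using le by (intro power_increasing) auto
  finally show "v < 2 ^ length x" .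
qed

lemma enc_edges_Cons:
  "enc_list enc_edge (e # es) = True # enc_nat (fst e) @ enc_nat (snd e) @ enc_list enc_edge es"
  by (simp add: enc_list_def enc_edge_def)

lemma drop_Suc_Cons: "drop p x = y # r \<Longrightarrow> drop (Suc p) x = r"
  by (metis drop_Suc list.sel(3) tl_drop)

lemma bit_at_Cons: "drop p x = y # r \<Longrightarrow> bit_at x p = y \<and> p < length x"
  using bit_at_drop[of p x 0] by (metis add.right_neutral bit_at_def drop_eq_Nil length_greater_0_conv
    linorder_not_less list.distinct(1) nth_Cons_0)

lemma parse_instance:
  assumes x: "x = enc_instance n es a b k"
  shows "well_formed x" "edge_count x = length es" "length es \<le> length x" "2 * length es \<le> length x"
    "nval x 0 = min (Suc (length x)) n"
    "\<And>j. j < length es \<Longrightarrow> source x j = min (Suc (length x)) (fst (es ! j))"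
    "\<And>j. j < length es \<Longrightarrow> target x j = min (Suc (length x)) (snd (es ! j))"
    "\<exists>r. drop (a_pos x) x = enc_nat a @ r" "\<exists>r. drop (b_pos x) x = enc_nat b @ r"
    "\<exists>r. drop (Suc (k_pos x)) x = enc_nat (nat \<bar>k\<bar>) @ r" "bit_at x (k_pos x) \<longleftrightarrow> k < 0" "1 \<le> length x"
proof -
  define R where "R = enc_nat a @ enc_nat b @ enc_int k"
  have x0: "drop 0 x = enc_nat n @ enc_list enc_edge es @ R" by (simp add: x enc_instance_def R_def)
  note p0 = parse_nat[OF x0]
  have E: "drop (edge_pos x j) x = enc_list enc_edge (drop j es) @ R" if "j \<le> length es" for j
    using that
  proof (induction j)
    case 0
    then show ?case using p0(2) by (simp add: edge_pos_def)
  next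
    case (Suc j)
    then have "drop j es = es ! j # drop (Suc j) es" by (simp add: Cons_nth_drop_Suc)
    then have "drop (edge_pos x j) x = True # enc_nat (fst (es ! j)) @ enc_nat (snd (es ! j)) @ enc_list enc_edge (drop (Suc j) es) @ R"
      using Suc by (simp add: enc_edges_Cons)
    from parse_nat(2)[OF parse_nat(2)[OF drop_Suc_Cons[OF this]]] show ?case by (simp add: edge_pos_Suc)
  qed
  have Ej: "drop (edge_pos x j) x = True # enc_nat (fst (es ! j)) @ enc_nat (snd (es ! j)) @ enc_list enc_edge (drop (Suc j) es) @ R"
    if "j < length es" for j
  proof -
    have "drop j es = es ! j # drop (Suc j) es" using that by (simp add: Cons_nth_drop_Suc)
    then show ?thesis using E[of j] that by (simp add: enc_edges_Cons)
  qed
  have Em: "drop (edge_pos x (length es)) x = False # R"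
    using E[of "length es"] by (simp add: enc_list_def)
  \<comment> \<open>Two bits per edge are enough to bound the vertices of a connected graph by
    \<open>length x\<close>.\<close>
  have "2 * length es \<le> length (enc_list enc_edge es)"
    by (induction es) (auto simp: enc_edges_Cons enc_list_def[of _ "[]"] enc_nat_def length_tagged)
  also have "\<dots> \<le> length x" by (simp add: x enc_instance_def)
  finally show l2: "2 * length es \<le> length x" .
  then show l: "length es \<le> length x" by simp
  show "1 \<le> length x" by (simp add: x enc_instance_def enc_list_def)
  show ec: "edge_count x = length es"
    unfolding edge_count_def
    by (rule run_length_eq[OF _ _ l]) (use bit_at_Cons[OF Ej] bit_at_Cons[OF Em] in auto)
  show "nval x 0 = min (Suc (length x)) n" by (rule nval_eq[OF x0])
  note Ej1 = drop_Suc_Cons[OF Ej] and Ej2 = parse_nat(2)[OF drop_Suc_Cons[OF Ej]]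
  show "source x j = min (Suc (length x)) (fst (es ! j))" if "j < length es" for j
    unfolding source_def by (rule nval_eq[OF Ej1[OF that]])
  show "target x j = min (Suc (length x)) (snd (es ! j))" if "j < length es" for j
    unfolding target_def by (rule nval_eq[OF Ej2[OF that]])
  have A: "drop (a_pos x) x = enc_nat a @ enc_nat b @ enc_int k"
    using drop_Suc_Cons[OF Em] by (simp add: a_pos_def ec R_def)
  then show "\<exists>r. drop (a_pos x) x = enc_nat a @ r" ..
  have B: "drop (b_pos x) x = enc_nat b @ enc_int k" using parse_nat(2)[OF A] by (simp add: b_pos_def)
  then show "\<exists>r. drop (b_pos x) x = enc_nat b @ r" ..
  have K: "drop (k_pos x) x = (k < 0) # enc_nat (nat \<bar>k\<bar>) @ []"
    using parse_nat(2)[OF B] by (simp add: k_pos_def enc_int_def)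
  note K1 = drop_Suc_Cons[OF K]
  then show "\<exists>r. drop (Suc (k_pos x)) x = enc_nat (nat \<bar>k\<bar>) @ r" ..
  show sg: "bit_at x (k_pos x) \<longleftrightarrow> k < 0" using bit_at_Cons[OF K] by simp
  show "well_formed x"
    unfolding well_formed_def ec
  proof (intro conjI allI impI)
    show "nend x (Suc (k_pos x)) = length x" using parse_nat(2,3)[OF K1] by simp
    show "0 < nlen x (Suc (k_pos x))" if "bit_at x (k_pos x)"
      using that sg bits_eq_Nil[of "nat \<bar>k\<bar>"] by (simp add: parse_nat(1)[OF K1])
  qed (use parse_nat(4)[OF x0] parse_nat(4)[OF Ej1] parse_nat(4)[OF Ej2] parse_nat(4)[OF A] parse_nat(4)[OF B]
      parse_nat(4)[OF K1] bit_at_Cons[OF Em] bit_at_Cons[OF K] in auto)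
qed

lemma well_formed_instance:
  assumes wf: "well_formed x"
  shows "\<exists>n es a b k. x = enc_instance n es a b k"
proof -
  let ?m = "edge_count x"
  have m: "edge_pos x ?m < length x" using wf by (simp add: well_formed_def)
  then have "?m < length x" using edge_pos_ge[of ?m x] by linarith
  then have "\<not> bit_at x (edge_pos x ?m)"
    unfolding edge_count_def by (rule run_length_props(3))
  then have last: "drop (edge_pos x ?m) x = False # drop (a_pos x) x"
    using m Cons_nth_drop_Suc[OF m] by (simp add: bit_at_def a_pos_def)
  \<comment> \<open>The list is recovered from its end, with \<open>d\<close> edges read so
    far.\<close>
  have "\<exists>es. drop (edge_pos x (?m - d)) x = enc_list enc_edge es @ drop (a_pos x) x" if "d \<le> ?m" for d
    using that
  proof (induction d)
    case 0
    show ?case using last by (intro exI[of _ "[]"]) (simp add: enc_list_def)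
  next
    case (Suc d)
    let ?j = "?m - Suc d"
    have j: "?j < ?m" "Suc ?j = ?m - d" using Suc.prems by auto
    obtain es where es: "drop (edge_pos x (Suc ?j)) x = enc_list enc_edge es @ drop (a_pos x) x"
      using Suc j by auto
    have "bit_at x (edge_pos x ?j)"
      using run_length_props(2) j(1) unfolding edge_count_def by blast
    then have 1: "drop (edge_pos x ?j) x = True # drop (Suc (edge_pos x ?j)) x"
      by (metis Cons_nth_drop_Suc bit_at_def)
    obtain u where u: "drop (Suc (edge_pos x ?j)) x = enc_nat u @ drop (nend x (Suc (edge_pos x ?j))) x"
      using parse_nat_exists wf j(1) unfolding well_formed_def by blast
    obtain v where v: "drop (nend x (Suc (edge_pos x ?j))) x = enc_nat v @ drop (edge_pos x (Suc ?j)) x"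
      using parse_nat_exists wf j(1) unfolding well_formed_def edge_pos_Suc by blast
    have "drop (edge_pos x ?j) x = enc_list enc_edge ((u, v) # es) @ drop (a_pos x) x"
      by (simp add: enc_edges_Cons 1 u v es)
    then show ?case ..
  qed
  from this[of ?m] obtain es where es: "drop (nend x 0) x = enc_list enc_edge es @ drop (a_pos x) x"
    by (auto simp: edge_pos_def)
  obtain n where n: "x = enc_nat n @ drop (nend x 0) x"
    using parse_nat_exists[of x 0] wf by (auto simp: well_formed_def)
  obtain a where a: "drop (a_pos x) x = enc_nat a @ drop (b_pos x) x"
    using parse_nat_exists[of x "a_pos x"] wf by (auto simp: well_formed_def b_pos_def)
  obtain b where b: "drop (b_pos x) x = enc_nat b @ drop (k_pos x) x"
    using parse_nat_exists[of x "b_pos x"] wf by (auto simp: well_formed_def k_pos_def)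
  obtain c where c: "drop (Suc (k_pos x)) x = enc_nat c @ []"
    using parse_nat_exists[of x "Suc (k_pos x)"] wf by (auto simp: well_formed_def)
  have k: "drop (k_pos x) x = bit_at x (k_pos x) # enc_nat c"
    using c wf Cons_nth_drop_Suc[of "k_pos x" x] by (simp add: well_formed_def bit_at_def)
  have pos: "0 < c" if "bit_at x (k_pos x)"
    using that wf bits_eq_Nil[of c] parse_nat(1)[OF c] by (auto simp: well_formed_def)
  define z where "z = (if bit_at x (k_pos x) then - int c else int c)"
  have "drop (k_pos x) x = enc_int z" unfolding k enc_int_def using pos by (auto simp: z_def)
  then have "x = enc_instance n es a b z" using n es a b by (simp add: enc_instance_def)
  then show ?thesis by blast
qed

section \<open>The verifier\<close>

text \<open>With \<open>B = 2 ^ length x\<close> above all input numbers,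
  \<open>2 ^ num_bits x\<close> is \<open>16 * B * B\<close>: the square covers
  \<open>n * n\<close>, the bound on ranks, and the factor covers
  \<open>2 * a + 2 * b + 1\<close>.\<close>

definition num_bits :: "bool list \<Rightarrow> nat" where
  "num_bits x = 2 * length x + 4"

text \<open>Functions whose values may be exponential, given by bounded binary digits that are computable in
  polynomial time.\<close>

definition big :: "(input \<Rightarrow> env \<Rightarrow> nat) \<Rightarrow> bool" where
  "big f \<longleftrightarrow> (\<exists>d K. ptime (\<lambda>w \<rho>. d w (\<lambda>j. \<rho> (Suc j)) (\<rho> 0)) \<and> (\<forall>w \<rho> l. d w \<rho> l \<le> K) \<and>
     (\<forall>w \<rho>. f w \<rho> = (\<Sum>l<num_bits (fst w). d w \<rho> l * 2 ^ l)))"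

lemma bigI:
  assumes "ptime (\<lambda>w \<rho>. d w (\<lambda>j. \<rho> (Suc j)) (\<rho> 0))" "\<And>w \<rho> l. d w \<rho> l \<le> K"
    "\<And>w \<rho>. f w \<rho> = (\<Sum>l<num_bits (fst w). d w \<rho> l * 2 ^ l)"
  shows "big f"
  unfolding big_def using assms by blast

lemma bigE:
  assumes "big f"
  obtains d K where "ptime (\<lambda>w \<rho>. d w (\<lambda>j. \<rho> (Suc j)) (\<rho> 0))" "\<forall>w \<rho> l. d w \<rho> l \<le> K"
    "f = (\<lambda>w \<rho>. \<Sum>l<num_bits (fst w). d w \<rho> l * 2 ^ l)"
  using assms unfolding big_def by blast

lemma big_add:
  assumes "big f" "big g" shows "big (\<lambda>w \<rho>. f w \<rho> + g w \<rho>)"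
proof -
  from assms(1) obtain d K where d: "ptime (\<lambda>w \<rho>. d w (\<lambda>j. \<rho> (Suc j)) (\<rho> 0))" "\<forall>w \<rho> l. d w \<rho> l \<le> K"
    "f = (\<lambda>w \<rho>. \<Sum>l<num_bits (fst w). d w \<rho> l * 2 ^ l)" by (rule bigE)
  from assms(2) obtain e L where e: "ptime (\<lambda>w \<rho>. e w (\<lambda>j. \<rho> (Suc j)) (\<rho> 0))" "\<forall>w \<rho> l. e w \<rho> l \<le> L"
    "g = (\<lambda>w \<rho>. \<Sum>l<num_bits (fst w). e w \<rho> l * 2 ^ l)" by (rule bigE)
  show ?thesis
    \<comment> \<open>Digits are added place by place without carrying; only their bound
      grows.\<close>
    by (rule bigI[where d = "\<lambda>w \<rho> l. d w \<rho> l + e w \<rho> l" and K = "K + L"])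
      (simp_all add: ptime_add[OF d(1) e(1)] add_mono d(2)[rule_format] e(2)[rule_format] d(3) e(3)
        add_mult_distrib sum.distrib)
qed

lemma big_double: "big f \<Longrightarrow> big (\<lambda>w \<rho>. 2 * f w \<rho>)"
  using big_add[of f f] by (simp add: mult_2)

lemma big_of_bool:
  assumes P: "ptime_dec P" shows "big (\<lambda>w \<rho>. of_bool (P w \<rho>))"
proof (rule bigI[where d = "\<lambda>w \<rho> l. of_bool (l = 0 \<and> P w \<rho>)" and K = 1])
  show "ptime_dec (\<lambda>w \<rho>. \<rho> 0 = 0 \<and> P w (\<lambda>j. \<rho> (Suc j)))"
    by (intro ptime_intros ptime_subst[OF P])
  show "of_bool (P w \<rho>) = (\<Sum>l<num_bits (fst w). of_bool (l = 0 \<and> P w \<rho>) * 2 ^ l :: nat)" for w :: input and \<rho>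
    by (simp add: num_bits_def sum.lessThan_Suc_shift del: sum.lessThan_Suc)
qed simp

lemma big_0: "big (\<lambda>w \<rho>. 0)"
  by (rule bigI[where d = "\<lambda>_ _ _. 0"]) (simp_all add: ptime_zero)

lemma big_1: "big (\<lambda>w \<rho>. 1)"
  using big_of_bool[of "\<lambda>_ _. True"] ptime_const[of 1] by simp

lemma big_guard:
  assumes P: "ptime_dec P" and f: "big f" shows "big (\<lambda>w \<rho>. of_bool (P w \<rho>) * f w \<rho>)"
proof -
  from f obtain d K where d: "ptime (\<lambda>w \<rho>. d w (\<lambda>j. \<rho> (Suc j)) (\<rho> 0))" "\<forall>w \<rho> l. d w \<rho> l \<le> K"
    "f = (\<lambda>w \<rho>. \<Sum>l<num_bits (fst w). d w \<rho> l * 2 ^ l)" by (rule bigE)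
  show ?thesis
    by (rule bigI[where d = "\<lambda>w \<rho> l. of_bool (P w \<rho>) * d w \<rho> l" and K = K])
      (simp_all add: ptime_mult[OF ptime_subst[OF P] d(1)] d(2)[rule_format] d(3) sum_distrib_left mult.assoc)
qed

lemma ptime_num_bits: "ptime (\<lambda>w \<rho>. num_bits (fst w))"
  unfolding num_bits_def by (intro ptime_intros)

lemma dec_big_le:
  assumes "big f" "big g" shows "ptime_dec (\<lambda>w \<rho>. f w \<rho> \<le> g w \<rho>)"
proof -
  from assms(1) obtain d K where d: "ptime (\<lambda>w \<rho>. d w (\<lambda>j. \<rho> (Suc j)) (\<rho> 0))" "\<forall>w \<rho> l. d w \<rho> l \<le> K"
    "f = (\<lambda>w \<rho>. \<Sum>l<num_bits (fst w). d w \<rho> l * 2 ^ l)" by (rule bigE)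
  from assms(2) obtain e L where e: "ptime (\<lambda>w \<rho>. e w (\<lambda>j. \<rho> (Suc j)) (\<rho> 0))" "\<forall>w \<rho> l. e w \<rho> l \<le> L"
    "g = (\<lambda>w \<rho>. \<Sum>l<num_bits (fst w). e w \<rho> l * 2 ^ l)" by (rule bigE)
  show ?thesis unfolding d(3) e(3)
    by (rule dec_sum_le[where K = "K + L", OF ptime_num_bits e(1) d(1)])
      (simp_all add: trans_le_add1 trans_le_add2 d(2)[rule_format] e(2)[rule_format])
qed

section \<open>Binary numbers in the input and in the certificate\<close>

definition input_num :: "bool list \<Rightarrow> nat \<Rightarrow> nat" where
  "input_num x p = (\<Sum>l<num_bits x. of_bool (digit x p l) * 2 ^ l)"

lemma big_input_num:
  assumes f: "ptime f" shows "big (\<lambda>w \<rho>. input_num (fst w) (f w \<rho>))"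
  by (rule bigI[where d = "\<lambda>w \<rho> l. of_bool (digit (fst w) (f w \<rho>) l)" and K = 1])
    (simp_all add: input_num_def dec_digit[OF ptime_subst[OF f] ptime_var])

definition table_index :: "nat \<Rightarrow> nat \<Rightarrow> nat \<Rightarrow> nat \<Rightarrow> nat \<Rightarrow> nat" where
  "table_index D c i j l = ((c * D + i) * D + j) * D + l"

definition table :: "bool list \<Rightarrow> bool list \<Rightarrow> nat \<Rightarrow> nat \<Rightarrow> nat \<Rightarrow> nat" where
  "table x u c i j =
     (\<Sum>l<num_bits x. of_bool (bit_at u (table_index (Suc (num_bits x)) c i j l)) * 2 ^ l)"

lemma big_table:
  assumes f: "ptime f" and g: "ptime g"
  shows "big (\<lambda>w \<rho>. table (fst w) (snd w) c (f w \<rho>) (g w \<rho>))"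
proof (rule bigI[where d = "\<lambda>w \<rho> l. of_bool (bit_at (snd w) (table_index (Suc (num_bits (fst w))) c (f w \<rho>) (g w \<rho>) l))" and K = 1])
  show "ptime_dec (\<lambda>w \<rho>. bit_at (snd w) (table_index (Suc (num_bits (fst w))) c (f w (\<lambda>j. \<rho> (Suc j))) (g w (\<lambda>j. \<rho> (Suc j))) (\<rho> 0)))"
    unfolding table_index_def by (intro ptime_intros ptime_num_bits ptime_subst[OF f] ptime_subst[OF g])
qed (simp_all add: table_def)

lemma table_index_bound:
  assumes "c < C" "i < D" "j < D" "l < D"
  shows "table_index D c i j l < C * D ^ 3"
proof -
  have step: "p * D + q < P * D" if "p < P" "q < D" for p q P
  proof -
    have "p * D + q < Suc p * D" using that(2) by simp
    also have "\<dots> \<le> P * D" using that(1) by (intro mult_le_mono1) simp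
    finally show ?thesis .
  qed
  show ?thesis unfolding table_index_def
    using step[OF step[OF step[OF assms(1,2)] assms(3)] assms(4)] by (simp add: power3_eq_cube mult.assoc)
qed

lemma table_index_decode:
  assumes "i < D" "j < D" "l < D"
  shows "table_index D c i j l mod D = l" "table_index D c i j l div D mod D = j"
    "table_index D c i j l div D div D mod D = i" "table_index D c i j l div D div D div D = c"
  using assms by (simp_all add: table_index_def)

text \<open>Bit \<open>q\<close> of the certificate is found from the base \<open>D\<close> digits
  of \<open>q\<close>; seven blocks hold the seven tables. \<open>D\<close> exceeds
  \<open>num_bits x\<close> because the column \<open>W = num_bits x\<close> of \<open>F 1\<close>
  is read as well.\<close>

lemma table_exists:
  assumes D: "D = Suc (num_bits x)" and F: "\<And>c i j. F c i j < 2 ^ num_bits x"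
  shows "\<exists>u. length u = 7 * D ^ 3 \<and> (\<forall>c i j. c < 7 \<longrightarrow> i < D \<longrightarrow> j < D \<longrightarrow> table x u c i j = F c i j)"
proof -
  define u where "u = map (\<lambda>q. odd (F (q div D div D div D) (q div D div D mod D) (q div D mod D) div 2 ^ (q mod D))) [0..<7 * D ^ 3]"
  have "table x u c i j = F c i j" if c: "c < 7" "i < D" "j < D" for c i j
  proof -
    have "bit_at u (table_index D c i j l) \<longleftrightarrow> odd (F c i j div 2 ^ l)" if "l < num_bits x" for l
      using table_index_bound[OF c, of l] table_index_decode[OF c(2,3), of l c] that D
      by (simp add: bit_at_def u_def)
    then have "table x u c i j = (\<Sum>l<num_bits x. of_bool (odd (F c i j div 2 ^ l)) * 2 ^ l)"
      unfolding table_def D[symmetric] by simp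
    also have "\<dots> = F c i j mod 2 ^ num_bits x"
      using horner_sum_bit_eq_take_bit[of "F c i j" "num_bits x"]
      by (simp add: horner_sum_eq_sum take_bit_eq_mod bit_iff_odd atLeast0LessThan)
    finally show ?thesis using F[of c i j] by simp
  qed
  then show ?thesis by (intro exI[of _ u]) (simp add: u_def)
qed

text \<open>All rows and columns that the conditions mention lie below \<open>D\<close>, including
  the column \<open>W\<close> and the row \<open>m\<close> of the final prefix sum.\<close>

lemma certificate_cong:
  assumes st: "\<And>e. e < m \<Longrightarrow> src e = src' e" "\<And>e. e < m \<Longrightarrow> tgt e = tgt' e"
    "\<And>e. e < m \<Longrightarrow> src' e < n" "\<And>e. e < m \<Longrightarrow> tgt' e < n"
    and D: "n \<le> D" "m < D" "W < D"
    and F: "\<And>c i j. c < 7 \<Longrightarrow> i < D \<Longrightarrow> j < D \<Longrightarrow> F c i j = F' c i j"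
  shows "certificate n m src tgt a b k W F \<longleftrightarrow> certificate n m src' tgt' a b k W F'"
proof -
  have st': "src' e < D" "tgt' e < D" if "e < m" for e
    using st(3,4)[OF that] D(1) by auto
  have lt: "v < n \<Longrightarrow> v < D" "e < m \<Longrightarrow> e < D" "e < m \<Longrightarrow> Suc e < D" "i < W \<Longrightarrow> i < D" "i < W \<Longrightarrow> Suc i < D" "0 < D"
    for v e i using D by auto
  show ?thesis unfolding certificate_def
    by (simp add: st(1,2) st' lt D F cong: conj_cong imp_cong ex_cong del: One_nat_def)
qed

text \<open>A value of \<open>nval\<close> below its cap is exact, and a number is positive if it
  has a digit. A negative \<open>k\<close> is replaced by 0, which is harmless as
  \<open>disp\<close> is a natural number.\<close>

definition verify :: "bool list \<Rightarrow> bool list \<Rightarrow> bool" where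
  "verify x u \<longleftrightarrow> well_formed x \<and> 0 < nval x 0 \<and> nval x 0 < Suc (length x) \<and>
     (\<forall>e<edge_count x. source x e < nval x 0 \<and> target x e < nval x 0 \<and> \<not> source x e = target x e) \<and>
     0 < nlen x (a_pos x) \<and> 0 < nlen x (b_pos x) \<and>
     certificate (nval x 0) (edge_count x) (source x) (target x) (input_num x (a_pos x)) (input_num x (b_pos x))
       (of_bool (\<not> bit_at x (k_pos x)) * input_num x (Suc (k_pos x))) (num_bits x) (table x u)"

lemma dec_verify: "ptime_dec (\<lambda>w \<rho>. verify (fst w) (snd w))"
  unfolding verify_def certificate_def
  by (intro ptime_const ptime_Suc ptime_var ptime_len dec_less dec_eq dec_not dec_conj dec_disj dec_imp dec_ex dec_all
      dec_bit_x dec_well_formed ptime_parse ptime_num_bits dec_big_le big_add big_double big_0 big_1 big_of_bool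
      big_guard big_table big_input_num)

lemma input_num_eq:
  assumes "drop p x = enc_nat v @ r" shows "input_num x p = v" "v < 2 ^ length x"
  using digit_sum[OF assms, of "num_bits x"] by (simp_all add: input_num_def num_bits_def)

text \<open>With at least two vertices, each is an end of some listed edge. This keeps
  \<open>n\<close> below the cap of \<open>nval\<close> although the input gives it in
  binary.\<close>

lemma connected_vertices_le:
  assumes G: "connected_graph {..<n} (edge_set es)" shows "n \<le> max 1 (2 * length es)"
proof (cases "n \<le> 1")
  case False
  have "{..<n} \<subseteq> fst ` set es \<union> snd ` set es"
  proof
    fix v assume v: "v \<in> {..<n}"
    obtain w where w: "w < n" "w \<noteq> v" using False v by (metis One_nat_def lessThan_iff not_less_eq zero_neq_one
          less_or_eq_imp_le linorder_not_le not_less_zero)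
    then have "(v, w) \<in> {(x, y). {x, y} \<in> edge_set es}\<^sup>*" using G v by (auto simp: connected_graph_def)
    then obtain z where "{v, z} \<in> edge_set es" using w(2) by (auto elim: converse_rtranclE)
    then show "v \<in> fst ` set es \<union> snd ` set es" by (force simp: edge_set_iff)
  qed
  from card_mono[OF _ this] have "n \<le> card (fst ` set es \<union> snd ` set es)" by simp
  also have "\<dots> \<le> card (fst ` set es) + card (snd ` set es)" by (rule card_Un_le)
  also have "\<dots> \<le> length es + length es"
    by (intro add_mono order_trans[OF card_image_le card_length]) auto
  finally show ?thesis by simp
qed simp

lemma verify_sound:
  assumes x: "x = enc_instance n es a b k" and V: "verify x u"
  shows "connected_graph {..<n} (edge_set es)" "0 < a" "0 < b"
    "k \<le> int (disp {..<n} (edge_set es) (real a / real b))"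
proof -
  note p = parse_instance[OF x]
  have n: "nval x 0 = n" "0 < n" "n \<le> length x" using V p(5) by (auto simp: verify_def)
  have st: "source x e = fst (es ! e)" "target x e = snd (es ! e)" "fst (es ! e) < n" "snd (es ! e) < n"
    "fst (es ! e) \<noteq> snd (es ! e)" if "e < length es" for e
  proof -
    have "source x e < n \<and> target x e < n \<and> source x e \<noteq> target x e"
      using V that by (simp add: verify_def p(2) n(1))
    then show "source x e = fst (es ! e)" "target x e = snd (es ! e)" "fst (es ! e) < n" "snd (es ! e) < n"
      "fst (es ! e) \<noteq> snd (es ! e)"
      using p(6,7)[OF that] n(3) by (auto simp: min_def split: if_splits)
  qed
  obtain r1 r2 r3 where r: "drop (a_pos x) x = enc_nat a @ r1" "drop (b_pos x) x = enc_nat b @ r2"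
    "drop (Suc (k_pos x)) x = enc_nat (nat \<bar>k\<bar>) @ r3" using p(8-10) by blast
  have "0 < nlen x (a_pos x)" "0 < nlen x (b_pos x)" using V by (simp_all add: verify_def)
  then show ab: "0 < a" "0 < b"
    using parse_nat(1)[OF r(1)] parse_nat(1)[OF r(2)] bits_eq_Nil by (metis length_0_conv gr0I)+
  have K: "of_bool (\<not> bit_at x (k_pos x)) * input_num x (Suc (k_pos x)) = nat k"
    by (simp add: input_num_eq[OF r(3)] p(11))
  have "certificate n (length es) (source x) (target x) a b (nat k) (num_bits x) (table x u)"
    using V unfolding verify_def K input_num_eq(1)[OF r(1)] input_num_eq(1)[OF r(2)] n(1) p(2) by blast
  then have C: "certificate n (length es) (\<lambda>e. fst (es ! e)) (\<lambda>e. snd (es ! e)) a b (nat k) (num_bits x) (table x u)"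
    using certificate_cong[of "length es" "source x" "\<lambda>e. fst (es ! e)" "target x" "\<lambda>e. snd (es ! e)" n
      "n + length es + num_bits x + 1"] st by simp
  have "u < n \<and> v < n \<and> u \<noteq> v" if "(u, v) \<in> set es" for u v
    using that st(3-5) unfolding in_set_conv_nth by (metis fst_conv snd_conv)
  note S = certificate_sound[OF this n(2) ab C]
  show "connected_graph {..<n} (edge_set es)" by (rule S)
  show "k \<le> int (disp {..<n} (edge_set es) (real a / real b))" using S(2) by linarith
qed

lemma verify_complete:
  assumes x: "x = enc_instance n es a b k" and G: "connected_graph {..<n} (edge_set es)"
    and ab: "0 < a" "0 < b" and k: "k \<le> int (disp {..<n} (edge_set es) (real a / real b))"
  shows "\<exists>u. length u = 7 * Suc (num_bits x) ^ 3 \<and> verify x u"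
proof -
  note p = parse_instance[OF x]
  let ?N = "length x"
  have n: "0 < n" "n \<le> ?N"
    using G connected_vertices_le[OF G] p(4,12) by (auto simp: connected_graph_def)
  have es: "fst (es ! e) < n" "snd (es ! e) < n" "fst (es ! e) \<noteq> snd (es ! e)" if "e < length es" for e
    using connected_graphD[OF G edge_set_nth[OF that]] by auto
  have st: "source x e = fst (es ! e)" "target x e = snd (es ! e)" if "e < length es" for e
    using p(6,7)[OF that] es[OF that] n(2) by auto
  have nv: "nval x 0 = n" using p(5) n(2) by simp
  obtain r1 r2 r3 where r: "drop (a_pos x) x = enc_nat a @ r1" "drop (b_pos x) x = enc_nat b @ r2"
    "drop (Suc (k_pos x)) x = enc_nat (nat \<bar>k\<bar>) @ r3" using p(8-10) by blast
  have K: "of_bool (\<not> bit_at x (k_pos x)) * input_num x (Suc (k_pos x)) = nat k"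
    by (simp add: input_num_eq[OF r(3)] p(11))
  define B :: nat where "B = 2 ^ ?N"
  have B: "a < B" "b < B" "nat k < B" "n < B" "1 \<le> B"
  proof -
    show "a < B" "b < B" using input_num_eq(2)[OF r(1)] input_num_eq(2)[OF r(2)] by (simp_all add: B_def)
    show "nat k < B" using input_num_eq(2)[OF r(3)] by (simp add: B_def)
    show "n < B" using le_less_trans[OF n(2) less_exp] by (simp add: B_def)
    show "1 \<le> B" by (simp add: B_def)
  qed
  have W: "2 ^ num_bits x = 16 * (B * B)" by (simp add: num_bits_def B_def power_add power_even_eq power2_eq_square)
  have BB: "B \<le> B * B" using B(5) by simp
  have nn: "n * n < B * B" using B(4,4) by (rule mult_strict_mono') simp_all
  have "n * n < 2 ^ num_bits x" "2 * a + 2 * b + 1 < 2 ^ num_bits x" "nat k + 1 < 2 ^ num_bits x"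
    unfolding W using nn B BB by linarith+
  moreover have "nat k \<le> disp {..<n} (edge_set es) (real a / real b)" using k by linarith
  ultimately obtain F where F: "certificate n (length es) (\<lambda>e. fst (es ! e)) (\<lambda>e. snd (es ! e)) a b (nat k) (num_bits x) F"
    "\<And>c i j. F c i j < 2 ^ num_bits x"
    using certificate_complete[OF G ab, of "nat k" "num_bits x"] by blast
  obtain u where u: "length u = 7 * Suc (num_bits x) ^ 3"
    "\<And>c i j. c < 7 \<Longrightarrow> i < Suc (num_bits x) \<Longrightarrow> j < Suc (num_bits x) \<Longrightarrow> table x u c i j = F c i j"
    using table_exists[where F = F, OF refl F(2)] by blast
  have "certificate n (length es) (source x) (target x) a b (nat k) (num_bits x) (table x u)"
    using F(1) certificate_cong[of "length es" "source x" "\<lambda>e. fst (es ! e)" "target x" "\<lambda>e. snd (es ! e)" n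
      "Suc (num_bits x)" "num_bits x" "table x u" F] st es u(2) n(2) p(3) by (simp add: num_bits_def)
  moreover have "0 < nlen x (a_pos x)" "0 < nlen x (b_pos x)"
    using parse_nat(1)[OF r(1)] parse_nat(1)[OF r(2)] bits_eq_Nil ab by simp_all
  ultimately have "verify x u"
    unfolding verify_def K input_num_eq(1)[OF r(1)] input_num_eq(1)[OF r(2)] nv p(2)
    using p(1) n es st by simp
  with u(1) show ?thesis by blast
qed

theorem theorem8: "DISPERSION \<in> NP"
proof (rule NP_I[OF dec_verify])
  fix x
  \<comment> \<open>The certificate has seven tables of \<open>D ^ 3\<close> bits with
    \<open>D = Suc (num_bits x) = 2 * length x + 5\<close>.\<close>
  let ?p = "[:7:] * [:5, 2:] ^ 3 :: nat poly"
  have p: "poly ?p (length x) = 7 * Suc (num_bits x) ^ 3"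
    by (simp add: num_bits_def poly_power mult.commute)
  show "x \<in> DISPERSION \<longleftrightarrow> (\<exists>u. length u \<le> poly ?p (length x) \<and> verify x u)"
  proof
    assume "x \<in> DISPERSION"
    then obtain n es a b k where x: "x = enc_instance n es a b k" and "connected_graph {..<n} (edge_set es)"
      "0 < a" "0 < b" "k \<le> int (disp {..<n} (edge_set es) (real a / real b))"
      by (auto simp: DISPERSION_def)
    from verify_complete[OF this] show "\<exists>u. length u \<le> poly ?p (length x) \<and> verify x u"
      unfolding p by (elim exE conjE) (intro exI conjI, rule eq_imp_le)
  next
    assume "\<exists>u. length u \<le> poly ?p (length x) \<and> verify x u"
    then obtain u where u: "verify x u" by blast
    then obtain n es a b k where x: "x = enc_instance n es a b k"
      using well_formed_instance[of x] unfolding verify_def by blast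
    from verify_sound[OF x u] show "x \<in> DISPERSION" using x unfolding DISPERSION_def by blast
  qed
qed

end
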